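(* Let $p$ be a positive integer, let $\mu=(\mu_1,\ldots,\mu_k)\vdash p$ be a partition of $p$, and let $\nu=(\nu_1,\ldots,\nu_\ell)\vdash p$ be a refinement of $\mu$. Write the multisets $\Upsilon_\mu=\{a_1,\ldots,a_p\}$ and $\Upsilon_\nu=\{b_1,\ldots,b_p\}$, and fix $r=r_1/r_2\in\mathbb{Q}$ (with $r_1,r_2$ integers). Denote $$A={}_{p+1}F_{p}(a_1,\ldots,a_p,1;b_1,\ldots,b_p;r),$$ and suppose that $A<\infty$ is well defined. Finally, let $c\in\mathbb{N}$ be a multiple of all prime factors of $\mu_1\cdot\mu_2\cdots\mu_k\cdot r_2$. Then there exists a tile counting function $f\in\mathcal{F}$ such that $f(n)\sim A\,c^n$.
   Context: $\mathbb{N}=\{0,1,2,\ldots\}$; $f\sim g$ means $f(n)/g(n)\to 1$ as $n\to\infty$. The hypergeometric function used is $${}_{p+1}F_{p}(a_1,\ldots,a_p,1;b_1,\ldots,b_p;r)=\sum_{m=0}^\infty\prod_{j=0}^{m-1}\frac{(j+a_1)(j+a_2)\cdots(j+a_p)\,r}{(j+b_1)(j+b_2)\cdots(j+b_p)}.$$ For a partition $\lambda=(\lambda_1,\ldots,\lambda_s)\vdash p$, $\Upsilon_\lambda$ is the multiset of $p$ rational numbers $$\Upsilon_\lambda=\bigcup_{i=1}^{s}\left\{\tfrac{1}{\lambda_i},\tfrac{2}{\lambda_i},\ldots,\tfrac{\lambda_i-1}{\lambda_i},1\right\}$$ (union with multiplicities). A partition $\nu$ is a refinement of $\mu$ if the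 parts of $\nu$ can be grouped into $k$ blocks so that the parts in the $i$-th block sum to $\mu_i$. Tile counting functions: a tile is an axis-parallel simply connected closed polygon in $\mathbb{R}^2$ (side lengths may be irrational). A finite set of tiles is tall if every tile in it has height $1$. Let $R_a=[1\times a]$ be the rectangle of height $1$ and length $a$. A tiling of $R_a$ with a finite set of tiles $T$ is a collection of translates of tiles of $T$ (no rotations or reflections), non-overlapping except along boundaries, which covers $R_a$ exactly (for $a=0$ the only tiling is the empty one). For a finite tall set of tiles $T$ and a fixed real $\varepsilon\ge 0$, let $f_{T,\varepsilon}(n)$ be the number of tilings of $R_{n+\varepsilon}$ with $T$, $n\in\mathbb{N}$. Functions $f_{T,\varepsilon}:\mathbb{N}\to\mathbb{N}$ of this form are called tile counting functions, and $\mathcal{F}$ denotes the set of all of them. *)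

theory Defs
  imports "HOL-Analysis.Analysis" "HOL-Library.Multiset" "HOL-Library.Landau_Symbols"
    "HOL-Computational_Algebra.Primes"
begin

definition is_partition :: "nat multiset \<Rightarrow> nat \<Rightarrow> bool" where
  "is_partition la p \<longleftrightarrow> 0 \<notin># la \<and> \<Sum>\<^sub># la = p"

text \<open>The elements of \<open>bl\<close> are the blocks into which the parts of \<open>nu\<close> are grouped;
  the block sums are the parts of \<open>mu\<close>.\<close>

definition is_refinement :: "nat multiset \<Rightarrow> nat multiset \<Rightarrow> bool" where
  "is_refinement nu mu \<longleftrightarrow>
     (\<exists>bl :: nat multiset multiset. \<Sum>\<^sub># bl = nu \<and> image_mset sum_mset bl = mu)"

definition Upsilon :: "nat multiset \<Rightarrow> real multiset" where
  "Upsilon la =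
     \<Sum>\<^sub># (image_mset (\<lambda>l. image_mset (\<lambda>j. real j / real l) (mset_set {1..l})) la)"

text \<open>\<open>hypergeom as bs r\<close> is the series with upper parameters \<open>as\<close> together with an additional \<open>1\<close>,
  and lower parameters \<open>bs\<close>; the additional \<open>1\<close> cancels the \<open>m!\<close> of the usual normalisation.\<close>

definition hypergeom_term :: "real multiset \<Rightarrow> real multiset \<Rightarrow> real \<Rightarrow> nat \<Rightarrow> real" where
  "hypergeom_term as bs r m =
     (\<Prod>j<m. ((\<Prod>a\<in>#as. real j + a) * r) / (\<Prod>b\<in>#bs. real j + b))"

definition hypergeom :: "real multiset \<Rightarrow> real multiset \<Rightarrow> real \<Rightarrow> real" where
  "hypergeom as bs r = (\<Sum>m. hypergeom_term as bs r m)"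

text \<open>A closed polygon is a nonempty compact region that is the closure of its connected interior
  and whose boundary is made of finitely many segments. It suffices to demand that finitely many
  axis-parallel segments cover the boundary: the region is then a union of cells of the grid
  spanned by the segments, so its boundary is a union of finitely many axis-parallel edges.
  Connectedness of the interior excludes regions pinched at a vertex (two squares
  sharing only a corner), so that, for a simply connected region, the boundary is a simple closed
  polygonal curve.\<close>

definition axis_parallel_polygon :: "(real \<times> real) set \<Rightarrow> bool" where
  "axis_parallel_polygon P \<longleftrightarrow>
     P \<noteq> {} \<and> compact P \<and> P = closure (interior P) \<and> connected (interior P) \<and>
     (\<exists>E. finite E \<and> (\<forall>(u, v)\<in>E. fst u = fst v \<or> snd u = snd v) \<and>
          frontier P \<subseteq> (\<Union>(u, v)\<in>E. closed_segment u v))"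

definition is_tile :: "(real \<times> real) set \<Rightarrow> bool" where
  "is_tile P \<longleftrightarrow> axis_parallel_polygon P \<and> simply_connected P"

definition height :: "(real \<times> real) set \<Rightarrow> real" where
  "height P = Sup (snd ` P) - Inf (snd ` P)"

definition tall_tile_set :: "(real \<times> real) set set \<Rightarrow> bool" where
  "tall_tile_set T \<longleftrightarrow> finite T \<and> (\<forall>P\<in>T. is_tile P \<and> height P = 1)"

text \<open>For \<open>a = 0\<close> the region is empty rather than a vertical segment, so that the empty tiling is
  the unique tiling.\<close>

definition rect :: "real \<Rightarrow> (real \<times> real) set" where
  "rect a = (if a = 0 then {} else {0..a} \<times> {0..1})"

definition is_tiling ::
  "(real \<times> real) set set \<Rightarrow> real \<Rightarrow> (real \<times> real) set set \<Rightarrow> bool" where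
  "is_tiling T a X \<longleftrightarrow>
     (\<forall>Q\<in>X. \<exists>P\<in>T. \<exists>v. Q = (+) v ` P) \<and>
     pairwise (\<lambda>Q Q'. interior Q \<inter> interior Q' = {}) X \<and>
     \<Union>X = rect a"

text \<open>Since every tall tile runs from the bottom to the top of the rectangle, a tiling is determined
  by the left-to-right sequence of its tiles, so the set counted here is finite.\<close>

definition tile_count :: "(real \<times> real) set set \<Rightarrow> real \<Rightarrow> nat \<Rightarrow> nat" where
  "tile_count T \<epsilon> n = card {X. is_tiling T (real n + \<epsilon>) X}"

definition tile_counting_functions :: "(nat \<Rightarrow> nat) set" where
  "tile_counting_functions = {tile_count T \<epsilon> |T \<epsilon>. tall_tile_set T \<and> \<epsilon> \<ge> 0}"

end

theory Submission
  imports Defs "HOL-Library.Poly_Mapping"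
begin

text \<open>
  With \<open>F(l, j) = (j + 1/l) (j + 2/l) \<cdots> (j + l/l)\<close> the \<open>m\<close>-th hypergeometric term is
  \<open>r\<^sup>m \<Prod>\<^sub>j\<^sub><\<^sub>m \<Prod>\<^sub>i F(\<mu>\<^sub>i, j) / \<Prod>\<^sub>i F(\<nu>\<^sub>i, j)\<close>, and since \<open>\<Prod>\<^sub>j\<^sub><\<^sub>m F(l, j) = (l m)! / l\<^bsup>l m\<^esup>\<close>
  it equals \<open>r\<^sup>m\<close> times the probability that
  in \<open>m\<close> rounds of multinomial experiments (one experiment per part of \<open>\<mu>\<close>) all outcomes occur exactly
  as often as expected. In other words it is the constant term of \<open>(r \<phi>)\<^sup>m\<close> for a Laurent polynomial
  \<open>\<phi>\<close> with nonnegative coefficients of total mass 1 and with denominators dividing a power of \<open>c\<close>.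

  A tall tile is a step from its left to its right contour, so tilings are paths in a finite graph.
  Irrational lengths add any number of integer-valued coordinates that must cancel along the path.
  Hence words with prescribed sums can be counted, and for \<open>r \<ge> 0\<close> the truncated series
  \<open>\<Sum>\<^sub>m c\<^sup>n CT((r \<phi>)\<^sup>m)\<close> is a tile counting function.

  For \<open>r = - \<rho> < 0\<close> convergence forces \<open>\<rho> \<le> 1\<close>. Split off the constant term:
  \<open>1 + \<rho> \<phi> = Q + B\<close> with \<open>Q = 1 + \<rho> \<phi>\<^sub>0\<close> and \<open>B = \<rho> (\<phi> - \<phi>\<^sub>0)\<close>. Up to a power of \<open>c\<close>,
  \<open>1 / (1 + \<rho> \<phi>) = (Q - B) \<Sum>\<^sub>k H\<^sup>k\<close> where \<open>1 - H\<close> is a small multiple of \<open>Q\<^sup>2 - B\<^sup>2\<close>. Here \<open>H\<close> has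
  nonnegative coefficients of total mass less than 1, so the series converges geometrically, and it is
  a regular summation method applied to the original, possibly only conditionally convergent, series.
  The negative contribution \<open>- CT(B H\<^sup>k)\<close> is the number of words with nonzero sum, which can be
  counted by appending a compensating word, minus the total mass of \<open>B H\<^sup>k\<close>. These total
  masses form a tail of a geometric series, which is absorbed by finitely many initial terms because
  the sum \<open>A\<close> is positive.
\<close>

section \<open>Tiles made of horizontal bars\<close>

text \<open>The common shape of all tiles in use: both contours are step functions over
  \<open>S\<close> bands of equal height, so contours are finite data.\<close>

definition bars :: "nat \<Rightarrow> (nat \<Rightarrow> real) \<Rightarrow> (nat \<Rightarrow> real) \<Rightarrow> (real \<times> real) set" where
  "bars S l u = (\<Union>b<S. {l b..u b} \<times> {real b / real S..(real b + 1) / real S})"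

lemma bars_iff:
  "(x, y) \<in> bars S l u \<longleftrightarrow>
     (\<exists>b<S. l b \<le> x \<and> x \<le> u b \<and> real b / real S \<le> y \<and> y \<le> (real b + 1) / real S)"
  by (auto simp: bars_def)

lemma bars_height_range:
  assumes "(x, y) \<in> bars S l u"
  shows "0 \<le> y" "y \<le> 1"
proof -
  obtain b where b: "b < S" "real b / real S \<le> y" "y \<le> (real b + 1) / real S"
    using assms by (auto simp: bars_iff)
  have "0 \<le> real b / real S" by simp
  then show "0 \<le> y" using b(2) by linarith
  have "(real b + 1) / real S \<le> 1" using b(1) by (simp add: divide_le_eq)
  then show "y \<le> 1" using b(3) by linarith
qed

lemma band_exists:
  assumes "S > 0" "0 \<le> y" "y \<le> 1"
  obtains b where "b < S" "real b / real S \<le> y" "y \<le> (real b + 1) / real S"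
proof (cases "y = 1")
  case True
  show ?thesis
    by (rule that[of "S - 1"]) (use True assms in \<open>auto simp: field_simps\<close>)
next
  case False
  define b where "b = nat \<lfloor>y * real S\<rfloor>"
  have nonneg: "0 \<le> y * real S" using assms by simp
  have b: "real b \<le> y * real S" "y * real S < real b + 1"
    using nonneg unfolding b_def by linarith+
  have "y * real S < real S" using False assms by simp
  then have "b < S" using b by linarith
  then show ?thesis
    using that[of b] b assms by (auto simp: field_simps)
qed

text \<open>A height on a band boundary belongs to two bars. Strictly inside a band only one bar is
  visible, so individual intervals are read off at such heights.\<close>

lemma bars_iff_open_band:
  assumes "b < S" "real b / real S < y" "y < (real b + 1) / real S"
  shows "(x, y) \<in> bars S l u \<longleftrightarrow> l b \<le> x \<and> x \<le> u b"
proof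
  assume "(x, y) \<in> bars S l u"
  then obtain b' where b': "b' < S" "l b' \<le> x" "x \<le> u b'"
    "real b' / real S \<le> y" "y \<le> (real b' + 1) / real S"
    by (auto simp: bars_iff)
  have S: "real S > 0" using assms(1) by simp
  have "real b' / real S < (real b + 1) / real S" using b' assms by linarith
  then have "real b' < real b + 1" using S by (simp add: divide_less_cancel)
  moreover have "real b / real S < (real b' + 1) / real S" using b' assms by linarith
  then have "real b < real b' + 1" using S by (simp add: divide_less_cancel)
  ultimately have "b' = b" by linarith
  then show "l b \<le> x \<and> x \<le> u b" using b' by simp
next
  assume "l b \<le> x \<and> x \<le> u b"
  then show "(x, y) \<in> bars S l u" using assms by (auto simp: bars_iff intro!: exI[of _ b])
qed

lemma compact_bars: "compact (bars S l u)"
  unfolding bars_def by (intro compact_UN compact_Times) auto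

lemma interior_bars_superset:
  assumes "b < S"
  shows "{l b<..<u b} \<times> {real b / real S<..<(real b + 1) / real S} \<subseteq> interior (bars S l u)"
proof (rule interior_maximal)
  show "{l b<..<u b} \<times> {real b / real S<..<(real b + 1) / real S} \<subseteq> bars S l u"
    using assms by (auto simp: bars_iff intro!: exI[of _ b])
qed (intro open_Times open_greaterThanLessThan)

lemma closure_interior_bars:
  assumes "\<And>b. b < S \<Longrightarrow> l b < u b"
  shows "closure (interior (bars S l u)) = bars S l u"
proof
  show "closure (interior (bars S l u)) \<subseteq> bars S l u"
    by (metis closure_minimal compact_bars compact_imp_closed interior_subset)
  show "bars S l u \<subseteq> closure (interior (bars S l u))"
  proof
    fix z assume "z \<in> bars S l u"
    then obtain b where b: "b < S"
      "z \<in> {l b..u b} \<times> {real b / real S..(real b + 1) / real S}"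
      by (auto simp: bars_def)
    have "closure ({l b<..<u b} \<times> {real b / real S<..<(real b + 1) / real S}) =
        {l b..u b} \<times> {real b / real S..(real b + 1) / real S}"
      using assms[OF b(1)] b(1) by (simp add: closure_Times divide_strict_right_mono)
    then show "z \<in> closure (interior (bars S l u))"
      using b closure_mono[OF interior_bars_superset[OF b(1), of l u]] by auto
  qed
qed

text \<open>As there are finitely many bands, a whole vertical strip around \<open>x0\<close>, and
  not just a line, lies in every bar.\<close>

lemma uniform_gap:
  fixes l u :: "nat \<Rightarrow> real"
  assumes "\<And>b. b < S \<Longrightarrow> l b < x0 \<and> x0 < u b"
  obtains d where "d > 0" "\<And>b. b < S \<Longrightarrow> l b \<le> x0 - d \<and> x0 + d \<le> u b"
proof -
  have "\<exists>d>0. \<forall>b<S. l b \<le> x0 - d \<and> x0 + d \<le> u b"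
    using assms
  proof (induction S)
    case 0
    show ?case by (auto intro: exI[of _ 1])
  next
    case (Suc S)
    then obtain d where d: "d > 0" "\<forall>b<S. l b \<le> x0 - d \<and> x0 + d \<le> u b"
      by (meson less_Suc_eq)
    have g: "l S < x0" "x0 < u S" using Suc.prems by auto
    have "\<forall>b<Suc S. l b \<le> x0 - min d (min (x0 - l S) (u S - x0)) \<and>
        x0 + min d (min (x0 - l S) (u S - x0)) \<le> u b"
      using d(2) by (fastforce simp: less_Suc_eq)
    then show ?case using d(1) g by (intro exI[of _ "min d (min (x0 - l S) (u S - x0))"]) auto
  qed
  then show ?thesis using that by blast
qed

text \<open>Every interior point is joined inside the interior to the vertical line over
  \<open>x0\<close> by a horizontal segment, and that line crosses all bands.\<close>

lemma connected_interior_bars: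
  assumes S: "S > 0" and gap: "\<And>b. b < S \<Longrightarrow> l b < x0 \<and> x0 < u b"
  shows "connected (interior (bars S l u))"
proof -
  let ?P = "bars S l u"
  let ?C = "{x0} \<times> {0<..<1::real}"
  obtain d where d: "d > 0" "\<And>b. b < S \<Longrightarrow> l b \<le> x0 - d \<and> x0 + d \<le> u b"
    using uniform_gap[of S l x0 u] gap by blast
  have "{x0 - d<..<x0 + d} \<times> {0<..<1} \<subseteq> ?P"
  proof clarify
    fix x y :: real assume xy: "x \<in> {x0 - d<..<x0 + d}" "y \<in> {0<..<1}"
    obtain b where "b < S" "real b / real S \<le> y" "y \<le> (real b + 1) / real S"
      using band_exists[of S y] S xy by auto
    then show "(x, y) \<in> ?P" using d(2)[of b] xy by (auto simp: bars_iff intro!: exI[of _ b])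
  qed
  then have "{x0 - d<..<x0 + d} \<times> {0<..<1} \<subseteq> interior ?P"
    by (intro interior_maximal open_Times) auto
  then have C: "?C \<subseteq> interior ?P" using d(1) by auto
  have seg: "closed_segment x x0 \<times> {y} \<subseteq> interior ?P \<and> 0 < y \<and> y < 1"
    if xy: "(x, y) \<in> interior ?P" for x y
  proof -
    obtain A B where AB: "open A" "open B" "x \<in> A" "y \<in> B" "A \<times> B \<subseteq> ?P"
      using xy open_prod_elim[OF open_interior xy] interior_subset[of ?P] by (metis SigmaE mem_Sigma_iff subset_trans)
    obtain e1 where e1: "e1 > 0" "ball x e1 \<subseteq> A" using AB open_contains_ball by blast
    obtain e2 where e2: "e2 > 0" "ball y e2 \<subseteq> B" using AB open_contains_ball by blast
    have box: "(x', y') \<in> ?P" if "\<bar>x' - x\<bar> < e1" "\<bar>y' - y\<bar> < e2" for x' y'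
      using that e1(2) e2(2) AB(5) by (auto simp: subset_iff dist_real_def abs_minus_commute)
    have "0 \<le> y - e2 / 2" "y + e2 / 2 \<le> 1"
      using bars_height_range[OF box[of x "y - e2 / 2"]] bars_height_range[OF box[of x "y + e2 / 2"]]
        e1(1) e2(1) by auto
    then have y: "0 < y" "y < 1" using e2(1) by linarith+
    have "(w, y) \<in> interior ?P" if w: "w \<in> closed_segment x x0" for w
    proof -
      let ?e = "min e1 d"
      have "{w - ?e<..<w + ?e} \<times> {y - e2<..<y + e2} \<subseteq> ?P"
      proof clarify
        fix x' y' assume xy': "x' \<in> {w - ?e<..<w + ?e}" "y' \<in> {y - e2<..<y + e2}"
        \<comment> \<open>Moving the point back into the box around \<open>x\<close> reveals its
          band. There both \<open>x + (x' - w)\<close> and \<open>x0 + (x' - w)\<close> lie in the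
          bar, and \<open>x'\<close> lies between them because \<open>w\<close> lies between
          \<open>x\<close> and \<open>x0\<close>.\<close>
        have "(x + (x' - w), y') \<in> ?P" using xy' by (intro box) auto
        then obtain b where b: "b < S" "l b \<le> x + (x' - w)" "x + (x' - w) \<le> u b"
          "real b / real S \<le> y'" "y' \<le> (real b + 1) / real S"
          by (auto simp: bars_iff)
        have "l b \<le> x0 + (x' - w)" "x0 + (x' - w) \<le> u b" using d(2)[OF b(1)] xy' by auto
        then have "l b \<le> x'" "x' \<le> u b"
          using b w by (auto simp: closed_segment_eq_real_ivl split: if_splits)
        then show "(x', y') \<in> ?P" using b by (auto simp: bars_iff)
      qed
      then have "{w - ?e<..<w + ?e} \<times> {y - e2<..<y + e2} \<subseteq> interior ?P"
        by (intro interior_maximal open_Times) auto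
      then show ?thesis using e1(1) e2(1) d(1) by auto
    qed
    then show ?thesis using y by auto
  qed
  let ?F = "(\<lambda>(x, y). closed_segment x x0 \<times> {y} \<union> ?C) ` interior ?P"
  have "interior ?P = \<Union> ?F"
  proof
    show "interior ?P \<subseteq> \<Union> ?F" by fastforce
    show "\<Union> ?F \<subseteq> interior ?P" using seg C by fastforce
  qed
  moreover have "connected (\<Union> ?F)"
  proof (rule connected_Union)
    fix s assume "s \<in> ?F"
    then obtain x y where xy: "(x, y) \<in> interior ?P" and s: "s = closed_segment x x0 \<times> {y} \<union> ?C"
      by (elim imageE, case_tac x) simp
    have "0 < y" "y < 1" using seg[OF xy] by auto
    then have "(x0, y) \<in> closed_segment x x0 \<times> {y} \<inter> ?C" by auto
    moreover have "connected (closed_segment x x0 \<times> {y})" "connected ?C"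
      by (simp_all add: connected_Times)
    ultimately show "connected s"
      unfolding s by (intro connected_Un) blast+
  next
    have "(x0, 1/2) \<in> s" if "s \<in> ?F" for s
      using that by auto
    then have "(x0, 1/2) \<in> \<Inter> ?F" by blast
    then show "\<Inter> ?F \<noteq> {}" by blast
  qed
  ultimately show ?thesis by simp
qed

lemma frontier_rectangle_subset:
  fixes a b c d :: real
  assumes "a \<le> b" "c \<le> d"
  shows "frontier ({a..b} \<times> {c..d}) \<subseteq>
    closed_segment (a, c) (a, d) \<union> closed_segment (b, c) (b, d) \<union>
    closed_segment (a, c) (b, c) \<union> closed_segment (a, d) (b, d)"
proof -
  have v: "(x, y) \<in> closed_segment (x, c) (x, d)" if "c \<le> y" "y \<le> d" for x y :: real
  proof -
    have "y \<in> closed_segment c d" using that assms by (simp add: closed_segment_eq_real_ivl)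
    then show ?thesis by (auto simp: in_segment algebra_simps)
  qed
  have h: "(x, y) \<in> closed_segment (a, y) (b, y)" if "a \<le> x" "x \<le> b" for x y :: real
  proof -
    have "x \<in> closed_segment a b" using that assms by (simp add: closed_segment_eq_real_ivl)
    then show ?thesis by (auto simp: in_segment algebra_simps)
  qed
  have "{a<..<b} \<times> {c<..<d} \<subseteq> interior ({a..b} \<times> {c..d})"
    by (intro interior_maximal open_Times) auto
  then have "frontier ({a..b} \<times> {c..d}) \<subseteq> {a..b} \<times> {c..d} - {a<..<b} \<times> {c<..<d}"
    by (auto simp: frontier_def closure_Times)
  moreover have "{a..b} \<times> {c..d} - {a<..<b} \<times> {c<..<d} \<subseteq>
    closed_segment (a, c) (a, d) \<union> closed_segment (b, c) (b, d) \<union>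
    closed_segment (a, c) (b, c) \<union> closed_segment (a, d) (b, d)"
  proof
    fix z assume z: "z \<in> {a..b} \<times> {c..d} - {a<..<b} \<times> {c<..<d}"
    obtain x y where xy: "z = (x, y)" by (cases z)
    have "x = a \<or> x = b \<or> y = c \<or> y = d" "a \<le> x" "x \<le> b" "c \<le> y" "y \<le> d"
      using z xy by auto
    then show "z \<in> closed_segment (a, c) (a, d) \<union> closed_segment (b, c) (b, d) \<union>
        closed_segment (a, c) (b, c) \<union> closed_segment (a, d) (b, d)"
      using v h xy by auto
  qed
  ultimately show ?thesis by blast
qed

lemma frontier_bars_segments:
  assumes "\<And>b. b < S \<Longrightarrow> l b < u b"
  shows "\<exists>E. finite E \<and> (\<forall>(u, v)\<in>E. fst u = fst v \<or> snd u = snd v) \<and>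
      frontier (bars S l u) \<subseteq> (\<Union>(u, v)\<in>E. closed_segment u v)"
proof -
  define R where "R b = {l b..u b} \<times> {real b / real S..(real b + 1) / real S}" for b
  define D where "D b = (let p = real b / real S; q = (real b + 1) / real S in
    {((l b, p), (l b, q)), ((u b, p), (u b, q)), ((l b, p), (u b, p)), ((l b, q), (u b, q))})" for b
  have R: "frontier (R b) \<subseteq> (\<Union>(u, v)\<in>D b. closed_segment u v)" if "b < S" for b
    using frontier_rectangle_subset[of "l b" "u b" "real b / real S" "(real b + 1) / real S"]
      assms[OF that] by (auto simp: R_def D_def Let_def divide_right_mono)
  have "frontier (bars S l u) \<subseteq> (\<Union>t\<in>R ` {..<S}. frontier t)"
    using frontier_Union_subset[of "R ` {..<S}"] by (simp add: bars_def R_def)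
  also have "\<dots> \<subseteq> (\<Union>(u, v)\<in>(\<Union>b<S. D b). closed_segment u v)"
    using R by fastforce
  finally show ?thesis
    by (intro exI[of _ "\<Union>b<S. D b"]) (auto simp: D_def Let_def)
qed

text \<open>The region contracts: first horizontally onto the vertical line over \<open>x0\<close>,
  then along that line to \<open>(x0, 0)\<close>.\<close>

lemma simply_connected_bars:
  assumes S: "S > 0" and gap: "\<And>b. b < S \<Longrightarrow> l b < x0 \<and> x0 < u b"
  shows "simply_connected (bars S l u)"
proof -
  let ?P = "bars S l u"
  have mem: "(w, y) \<in> ?P" if xy: "(x, y) \<in> ?P" and w: "w \<in> closed_segment x x0" for w x y
  proof -
    obtain b where b: "b < S" "l b \<le> x" "x \<le> u b" "real b / real S \<le> y" "y \<le> (real b + 1) / real S"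
      using xy by (auto simp: bars_iff)
    then have "l b \<le> w" "w \<le> u b"
      using w gap[OF b(1)] by (auto simp: closed_segment_eq_real_ivl split: if_splits)
    then show ?thesis using b by (auto simp: bars_iff)
  qed
  have C: "(x0, y) \<in> ?P" if y: "0 \<le> y" "y \<le> 1" for y
  proof -
    obtain b where "b < S" "real b / real S \<le> y" "y \<le> (real b + 1) / real S"
      using band_exists[of S y] S y by auto
    then show ?thesis using gap[of b] by (auto simp: bars_iff intro!: exI[of _ b])
  qed
  have "homotopic_with_canon (\<lambda>_. True) ?P ?P id (\<lambda>z. (x0, snd z))"
  proof (rule homotopic_with_linear)
    show "closed_segment (id z) (x0, snd z) \<subseteq> ?P" if "z \<in> ?P" for z
    proof
      fix w assume "w \<in> closed_segment (id z) (x0, snd z)"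
      then obtain t where t: "0 \<le> t" "t \<le> 1" "w = (1 - t) *\<^sub>R z + t *\<^sub>R (x0, snd z)"
        by (auto simp: in_segment)
      then have "w = ((1 - t) * fst z + t * x0, snd z)"
        by (cases z) (auto simp: algebra_simps)
      moreover have "(1 - t) * fst z + t * x0 \<in> closed_segment (fst z) x0"
        using t by (auto simp: in_segment)
      ultimately show "w \<in> ?P" using mem[of "fst z" "snd z"] that by simp
    qed
  qed (auto intro!: continuous_intros)
  moreover have "homotopic_with_canon (\<lambda>_. True) ?P ?P (\<lambda>z. (x0, snd z)) (\<lambda>z. (x0, 0))"
  proof (rule homotopic_with_linear)
    show "closed_segment (x0, snd z) (x0, 0) \<subseteq> ?P" if "z \<in> ?P" for z
    proof
      fix w assume "w \<in> closed_segment (x0, snd z) (x0, 0)"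
      then obtain t where t: "0 \<le> t" "t \<le> 1" "w = (1 - t) *\<^sub>R (x0, snd z) + t *\<^sub>R (x0, 0)"
        by (auto simp: in_segment)
      then have "w = (x0, (1 - t) * snd z)"
        by (auto simp: algebra_simps)
      moreover have "0 \<le> snd z" "snd z \<le> 1"
        using bars_height_range[of "fst z" "snd z"] that by auto
      ultimately show "w \<in> ?P" using C[of "(1 - t) * snd z"] t by (auto simp: mult_le_one)
    qed
  qed (auto intro!: continuous_intros)
  ultimately have "contractible ?P"
    unfolding contractible_def using homotopic_with_trans by blast
  then show ?thesis by (rule contractible_imp_simply_connected)
qed

lemma is_tile_bars:
  assumes "S > 0" and gap: "\<And>b. b < S \<Longrightarrow> l b < x0 \<and> x0 < u b"
  shows "is_tile (bars S l u)"
proof -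
  have lu: "l b < u b" if "b < S" for b using gap[OF that] by linarith
  have "(x0, 0) \<in> bars S l u"
    using assms(1) gap[of 0] by (auto simp: bars_iff intro!: exI[of _ 0])
  then show ?thesis
    unfolding is_tile_def axis_parallel_polygon_def
    using compact_bars connected_interior_bars[of S l x0 u] simply_connected_bars[of S l x0 u]
      closure_interior_bars[of S l u] frontier_bars_segments[of S l u] assms lu by auto
qed

lemma height_bars:
  assumes S: "S > 0" and gap: "\<And>b. b < S \<Longrightarrow> l b \<le> u b"
  shows "height (bars S l u) = 1"
proof -
  have "snd ` bars S l u = {0..1}"
  proof
    show "snd ` bars S l u \<subseteq> {0..1}"
    proof
      fix y assume "y \<in> snd ` bars S l u"
      then obtain x where "(x, y) \<in> bars S l u" by auto
      then show "y \<in> {0..1}" using bars_height_range[of x y S l u] by simp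
    qed
    show "{0..1} \<subseteq> snd ` bars S l u"
    proof
      fix y :: real assume y: "y \<in> {0..1}"
      then obtain b where "b < S" "real b / real S \<le> y" "y \<le> (real b + 1) / real S"
        using band_exists[of S y] S by auto
      then have "(l b, y) \<in> bars S l u" using gap[of b] by (auto simp: bars_iff intro!: exI[of _ b])
      then show "y \<in> snd ` bars S l u" by force
    qed
  qed
  then show ?thesis by (simp add: height_def)
qed

lemma translate_bars:
  "(+) (x, 0) ` bars S l u = bars S (\<lambda>b. x + l b) (\<lambda>b. x + u b)"
proof
  show "(+) (x, 0) ` bars S l u \<subseteq> bars S (\<lambda>b. x + l b) (\<lambda>b. x + u b)"
    by (auto simp: bars_iff)
  show "bars S (\<lambda>b. x + l b) (\<lambda>b. x + u b) \<subseteq> (+) (x, 0) ` bars S l u"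
  proof
    fix z assume z: "z \<in> bars S (\<lambda>b. x + l b) (\<lambda>b. x + u b)"
    then obtain b where "b < S" "x + l b \<le> fst z" "fst z \<le> x + u b"
      "real b / real S \<le> snd z" "snd z \<le> (real b + 1) / real S"
      by (cases z) (auto simp: bars_iff)
    then have "(fst z - x, snd z) \<in> bars S l u" by (auto simp: bars_iff intro!: exI[of _ b])
    moreover have "z = (x, 0) + (fst z - x, snd z)" by (cases z) auto
    ultimately show "z \<in> (+) (x, 0) ` bars S l u" by blast
  qed
qed

section \<open>Tilings as paths\<close>

text \<open>State 0 stands for the straight vertical contour. The rectangle ends with it, so paths
  have to end there.\<close>

fun epath :: "'e set \<Rightarrow> ('e \<Rightarrow> nat) \<Rightarrow> ('e \<Rightarrow> nat) \<Rightarrow> nat \<Rightarrow> 'e list \<Rightarrow> bool" where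
  "epath E src tgt q [] \<longleftrightarrow> q = 0"
| "epath E src tgt q (e # es) \<longleftrightarrow> e \<in> E \<and> src e = q \<and> epath E src tgt (tgt e) es"

fun places :: "('e \<Rightarrow> real) \<Rightarrow> real \<Rightarrow> 'e list \<Rightarrow> (real \<times> 'e) set" where
  "places len t [] = {}"
| "places len t (e # es) = insert (t, e) (places len (t + len e) es)"

text \<open>Teeth have width \<delta>, so the bound \<open>2 * \<delta> \<le> len e\<close> leaves
  every bar a positive length whatever the two contours are. Tiles form a set, hence distinct edges
  must differ in a contour or in length to be counted separately.\<close>

locale tile_edges =
  fixes E :: "'e set" and src tgt :: "'e \<Rightarrow> nat" and len :: "'e \<Rightarrow> real"
    and S :: nat and \<delta> :: real
  assumes finite_E: "finite E"
    and S_pos: "S > 0"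
    and states: "\<And>e. e \<in> E \<Longrightarrow> src e < S \<and> tgt e < S"
    and \<delta>_pos: "\<delta> > 0"
    and len_ge: "\<And>e. e \<in> E \<Longrightarrow> 2 * \<delta> \<le> len e"
    and inj_edges: "inj_on (\<lambda>e. (src e, tgt e, len e)) E"
begin

text \<open>A state other than \<open>0\<close> is a tooth of width \<open>\<delta>\<close> in its own horizontal band. Band \<open>0\<close> carries no
  tooth, so there the tiles of a tiling form a partition of an interval.\<close>

definition prof :: "nat \<Rightarrow> nat \<Rightarrow> real" where
  "prof q b = (if q = b \<and> q \<noteq> 0 then \<delta> else 0)"

definition lo :: "nat \<Rightarrow> real \<times> 'e \<Rightarrow> real" where
  "lo b z = fst z + prof (src (snd z)) b"

definition hi :: "nat \<Rightarrow> real \<times> 'e \<Rightarrow> real" where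
  "hi b z = fst z + len (snd z) + prof (tgt (snd z)) b"

definition placed :: "real \<times> 'e \<Rightarrow> (real \<times> real) set" where
  "placed z = bars S (\<lambda>b. lo b z) (\<lambda>b. hi b z)"

definition tile :: "'e \<Rightarrow> (real \<times> real) set" where
  "tile e = placed (0, e)"

definition tiles :: "(real \<times> real) set set" where
  "tiles = tile ` E"

text \<open>Half-open intervals turn covering without overlap into an exact partition in every band.
  The region to be filled lies between contour \<open>q\<close> placed at \<open>t\<close> and the
  straight line at \<open>a\<close>.\<close>

definition part :: "(real \<times> 'e) set \<Rightarrow> nat \<Rightarrow> real \<Rightarrow> real \<Rightarrow> bool" where
  "part Z q t a \<longleftrightarrow> Z \<subseteq> UNIV \<times> E \<and> (\<forall>b<S. t + prof q b \<le> a \<and>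
     (\<Union>z\<in>Z. {lo b z..<hi b z}) = {t + prof q b..<a} \<and>
     (\<forall>z\<in>Z. \<forall>z'\<in>Z. z \<noteq> z' \<longrightarrow> {lo b z..<hi b z} \<inter> {lo b z'..<hi b z'} = {}))"

lemma prof_0 [simp]: "prof q 0 = 0" "prof 0 b = 0"
  by (auto simp: prof_def)

lemma prof_bounds: "0 \<le> prof q b" "prof q b \<le> \<delta>"
  using \<delta>_pos by (auto simp: prof_def)

lemma prof_inj:
  assumes "q < S" "q' < S" "\<And>b. b < S \<Longrightarrow> prof q b = prof q' b"
  shows "q = q'"
  using assms(3)[of q] assms(3)[of q'] assms(1,2) \<delta>_pos by (auto simp: prof_def split: if_splits)

lemma lo_less_hi:
  assumes "snd z \<in> E"
  shows "lo b z < hi b z"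
  using len_ge[OF assms] \<delta>_pos prof_bounds[of "src (snd z)" b] prof_bounds[of "tgt (snd z)" b]
  by (simp add: lo_def hi_def)

lemma translate_tile: "(+) (x, 0) ` tile e = placed (x, e)"
  by (simp add: tile_def placed_def translate_bars lo_def hi_def add.assoc)

lemma tall_tiles: "tall_tile_set tiles"
  unfolding tall_tile_set_def
proof (intro conjI ballI)
  show "finite tiles" using finite_E by (simp add: tiles_def)
  fix P assume "P \<in> tiles"
  then obtain e where e: "e \<in> E" "P = tile e" by (auto simp: tiles_def)
  \<comment> \<open>Left contours stay within \<delta> and right contours start at
    \<open>2 * \<delta>\<close> or later, so the vertical line half way between crosses every
    bar.\<close>
  have "lo b (0, e) < 3 / 2 * \<delta> \<and> 3 / 2 * \<delta> < hi b (0, e)" for b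
    using len_ge[OF e(1)] \<delta>_pos prof_bounds[of "src e" b] prof_bounds[of "tgt e" b]
    by (simp add: lo_def hi_def)
  then show "is_tile P"
    using is_tile_bars[of S "\<lambda>b. lo b (0, e)" "3 / 2 * \<delta>" "\<lambda>b. hi b (0, e)"] S_pos e
    by (simp add: tile_def placed_def)
  show "height P = 1"
    using height_bars[of S "\<lambda>b. lo b (0, e)" "\<lambda>b. hi b (0, e)"] S_pos e lo_less_hi[of "(0, e)"]
    by (simp add: tile_def placed_def less_imp_le)
qed

lemma part_places:
  assumes "epath E src tgt q es" "t + sum_list (map len es) = a"
  shows "part (places len t es) q t a"
  using assms
proof (induction es arbitrary: q t)
  case Nil
  then show ?case by (simp add: part_def)
next
  case (Cons e es)
  let ?Z = "places len (t + len e) es"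
  have e: "e \<in> E" "src e = q" using Cons.prems by auto
  have IH: "part ?Z (tgt e) (t + len e) a" using Cons by (simp add: add.assoc)
  show ?case
    unfolding part_def
  proof (intro conjI allI impI)
    show "places len t (e # es) \<subseteq> UNIV \<times> E" using IH e by (auto simp: part_def)
    fix b assume b: "b < S"
    have U: "(\<Union>z\<in>?Z. {lo b z..<hi b z}) = {hi b (t, e)..<a}" and le: "hi b (t, e) \<le> a"
      and D: "\<And>z z'. z \<in> ?Z \<Longrightarrow> z' \<in> ?Z \<Longrightarrow> z \<noteq> z' \<Longrightarrow>
        {lo b z..<hi b z} \<inter> {lo b z'..<hi b z'} = {}"
      using IH b by (auto simp: part_def hi_def)
    have lt: "lo b (t, e) < hi b (t, e)" using lo_less_hi e by simp
    have q: "t + prof q b = lo b (t, e)" using e by (simp add: lo_def)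
    show "t + prof q b \<le> a" using q lt le by linarith
    show "(\<Union>z\<in>places len t (e # es). {lo b z..<hi b z}) = {t + prof q b..<a}"
      using U lt le q by (auto simp: ivl_disj_un)
    have disj: "{lo b (t, e)..<hi b (t, e)} \<inter> {lo b z..<hi b z} = {}" if "z \<in> ?Z" for z
    proof -
      have "{lo b z..<hi b z} \<subseteq> {hi b (t, e)..<a}" using U that by blast
      then show ?thesis by auto
    qed
    show "\<forall>z\<in>places len t (e # es). \<forall>z'\<in>places len t (e # es). z \<noteq> z' \<longrightarrow>
        {lo b z..<hi b z} \<inter> {lo b z'..<hi b z'} = {}"
      using D disj by (simp add: Int_commute) blast
  qed
qed

text \<open>In band 0 the tile covering \<open>t\<close> begins exactly at \<open>t\<close>. Its
  left contour is forced to be \<open>q\<close>; removing it leaves a region of the same kind whose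
  left contour is the right contour of that tile.\<close>

lemma part_obtain_path:
  assumes "part Z q t a" "q < S"
  shows "\<exists>es. epath E src tgt q es \<and> t + sum_list (map len es) = a \<and> Z = places len t es"
proof -
  \<comment> \<open>Each tile uses up a length of at least \<open>2 * \<delta>\<close>, so
    \<open>n\<close> bounds the number of tiles and serves for the induction.\<close>
  obtain n :: nat where "a - t < real n * (2 * \<delta>)"
    using \<delta>_pos reals_Archimedean3[of "2 * \<delta>"] by auto
  then show ?thesis
    using assms
  proof (induction n arbitrary: Z q t)
    case 0
    then have "t + prof q 0 \<le> a" using S_pos unfolding part_def by blast
    then show ?case using 0 by simp
  next
    case (Suc n)
    have Z: "Z \<subseteq> UNIV \<times> E" using Suc.prems by (simp add: part_def)
    have ta: "t + prof q b \<le> a" if "b < S" for b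
      using Suc.prems that by (simp add: part_def)
    have U: "(\<Union>z\<in>Z. {lo b z..<hi b z}) = {t + prof q b..<a}" if "b < S" for b
      using Suc.prems that by (simp add: part_def)
    have D: "{lo b z..<hi b z} \<inter> {lo b z'..<hi b z'} = {}"
      if "b < S" "z \<in> Z" "z' \<in> Z" "z \<noteq> z'" for b z z'
      using Suc.prems(2) that by (simp add: part_def)
    have zE: "snd z \<in> E" if "z \<in> Z" for z using Z that by auto
    have ge: "t + prof q b \<le> lo b z \<and> hi b z \<le> a" if "b < S" "z \<in> Z" for b z
    proof -
      have "{lo b z..<hi b z} \<subseteq> {t + prof q b..<a}" using U[OF that(1)] that by blast
      then show ?thesis using lo_less_hi[OF zE[OF that(2)], of b] by (simp add: atLeastLessThan_subset_iff)
    qed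
    show ?case
    proof (cases "t < a")
      case False
      then have t: "t = a" using ta[OF S_pos] by simp
      have "Z = {}"
      proof (rule ccontr)
        assume "Z \<noteq> {}"
        then obtain z where z: "z \<in> Z" by blast
        show False using ge[OF S_pos z] lo_less_hi[OF zE[OF z], of 0] t by simp
      qed
      moreover have "q = 0"
      proof (rule ccontr)
        assume "q \<noteq> 0"
        then have "prof q q = \<delta>" by (simp add: prof_def)
        then show False using ta[OF \<open>q < S\<close>] t \<delta>_pos by simp
      qed
      ultimately show ?thesis using t by (intro exI[of _ "[]"]) simp
    next
      case True
      have "t \<in> {t + prof q 0..<a}" using True by simp
      then obtain z where z: "z \<in> Z" "t \<in> {lo 0 z..<hi 0 z}" using U[OF S_pos] by blast
      define e where "e = snd z"
      have zt: "z = (t, e)"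
        using z ge[OF S_pos z(1)] by (cases z) (auto simp: e_def lo_def)
      have e: "e \<in> E" using zE[OF z(1)] by (simp add: e_def)
      have src: "src e = q"
      proof (rule prof_inj)
        show "src e < S" "q < S" using states[OF e] Suc.prems by auto
        fix b assume b: "b < S"
        have le: "prof q b \<le> prof (src e) b" using ge[OF b z(1)] zt by (simp add: lo_def)
        show "prof (src e) b = prof q b"
        proof (rule ccontr)
          assume ne: "prof (src e) b \<noteq> prof q b"
          then have p: "prof q b = 0" "prof (src e) b = \<delta>"
            using le \<delta>_pos by (auto simp: prof_def split: if_splits)
          \<comment> \<open>A tooth of the tile where \<open>q\<close> has none leaves a notch at
            \<open>t\<close>. The tile filling it would also start at \<open>t\<close> and so
            overlap the first one in band 0.\<close>
          have "t \<in> {t + prof q b..<a}" using p True by simp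
          then obtain z' where z': "z' \<in> Z" "t \<in> {lo b z'..<hi b z'}" using U[OF b] by blast
          have "z' \<noteq> z" using z' zt p \<delta>_pos by (auto simp: lo_def)
          have "fst z' = t"
            using z' ge[OF S_pos z'(1)] prof_bounds[of "src (snd z')" b]
            by (auto simp: lo_def)
          then have "t \<in> {lo 0 z'..<hi 0 z'}"
            using lo_less_hi[OF zE[OF z'(1)], of 0] by (auto simp: lo_def)
          then show False using D[OF S_pos z'(1) z(1) \<open>z' \<noteq> z\<close>] z(2) by blast
        qed
      qed
      let ?Z = "Z - {z}"
      have "part ?Z (tgt e) (t + len e) a"
        unfolding part_def
      proof (intro conjI allI impI)
        show "?Z \<subseteq> UNIV \<times> E" using Z by blast
        fix b assume b: "b < S"
        have h: "t + len e + prof (tgt e) b = hi b z" by (simp add: hi_def zt)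
        have l: "t + prof q b = lo b z" by (simp add: lo_def zt src)
        show "t + len e + prof (tgt e) b \<le> a" using ge[OF b z(1)] h by simp
        have "(\<Union>z\<in>?Z. {lo b z..<hi b z}) = {t + prof q b..<a} - {lo b z..<hi b z}"
          using U[OF b] D[OF b] z(1) by blast
        also have "\<dots> = {hi b z..<a}" using l lo_less_hi[OF zE[OF z(1)], of b] by auto
        finally show "(\<Union>z\<in>?Z. {lo b z..<hi b z}) = {t + len e + prof (tgt e) b..<a}"
          using h by simp
        show "\<forall>z1\<in>?Z. \<forall>z2\<in>?Z. z1 \<noteq> z2 \<longrightarrow>
            {lo b z1..<hi b z1} \<inter> {lo b z2..<hi b z2} = {}"
          using D[OF b] by blast
      qed
      moreover have "a - (t + len e) < real n * (2 * \<delta>)"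
        using Suc.prems(1) len_ge[OF e] by (simp add: algebra_simps)
      ultimately obtain es where es: "epath E src tgt (tgt e) es"
        "t + len e + sum_list (map len es) = a" "?Z = places len (t + len e) es"
        using Suc.IH[of "t + len e" ?Z "tgt e"] states[OF e] by auto
      have "Z = places len t (e # es)" using es(3) z(1) zt by auto
      then show ?thesis
        using es e src by (intro exI[of _ "e # es"]) (simp add: add.assoc)
    qed
  qed
qed

section \<open>Correspondence between tilings, placements and paths\<close>

lemma places_ge:
  assumes "epath E src tgt q es" "z \<in> places len t es"
  shows "t \<le> fst z"
  using assms
proof (induction es arbitrary: q t)
  case (Cons e es)
  have "0 \<le> len e" using len_ge[of e] \<delta>_pos Cons.prems by auto
  then show ?case using Cons by fastforce
qed simp

text \<open>Lengths are positive, so the entry at position \<open>t\<close> belongs to the first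
  edge and to no later one.\<close>

lemma places_inj:
  assumes "epath E src tgt q es" "epath E src tgt q' es'" "places len t es = places len t es'"
  shows "es = es'"
  using assms
proof (induction es arbitrary: q q' t es')
  case Nil
  then show ?case by (cases es') auto
next
  case (Cons e es)
  then obtain e' es2 where es': "es' = e' # es2" by (cases es') auto
  have E: "e \<in> E" "e' \<in> E" using Cons.prems es' by auto
  have out: "(t, x) \<notin> places len (t + len e) es" "(t, x) \<notin> places len (t + len e') es2" for x
    using places_ge[of "tgt e" es "(t, x)" "t + len e"] places_ge[of "tgt e'" es2 "(t, x)" "t + len e'"]
      Cons.prems es' len_ge[OF E(1)] len_ge[OF E(2)] \<delta>_pos by auto
  have "(t, e) \<in> places len t es'" using Cons.prems(3) by auto
  then have "e = e'" using out es' by auto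
  moreover have "places len (t + len e) es = places len (t + len e') es2"
    using Cons.prems(3) es' out \<open>e = e'\<close> by (auto simp: set_eq_iff) metis+
  ultimately show ?case using Cons.IH[of "tgt e" "tgt e'" es2 "t + len e"] Cons.prems es' by auto
qed

lemma open_band_point:
  assumes "b < S"
  obtains y where "real b / real S < y" "y < (real b + 1) / real S" "0 < y" "y < 1"
proof
  let ?y = "(real b + 1 / 2) / real S"
  show "real b / real S < ?y" "?y < (real b + 1) / real S" "0 < ?y" "?y < 1"
    using S_pos assms by (auto simp: divide_strict_right_mono)
qed

text \<open>Band 0 carries no tooth and gives position and length; the other bands then give the two
  contours.\<close>

lemma placed_inj:
  assumes "snd z \<in> E" "snd z' \<in> E" "placed z = placed z'"
  shows "z = z'"
proof -
  have eq: "lo b z = lo b z' \<and> hi b z = hi b z'" if b: "b < S" for b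
  proof -
    obtain y where y: "real b / real S < y" "y < (real b + 1) / real S"
      using open_band_point[OF b] by blast
    have "x \<in> {lo b z..hi b z} \<longleftrightarrow> x \<in> {lo b z'..hi b z'}" for x
      using assms(3) bars_iff_open_band[OF b y, of x]
      unfolding placed_def atLeastAtMost_iff by metis
    then have "{lo b z..hi b z} = {lo b z'..hi b z'}" by blast
    then show ?thesis using lo_less_hi[OF assms(1), of b] by (simp add: Icc_eq_Icc)
  qed
  have x: "fst z = fst z'" and l: "len (snd z) = len (snd z')"
    using eq[OF S_pos] by (auto simp: lo_def hi_def)
  have "src (snd z) = src (snd z')"
    using eq x states assms by (intro prof_inj) (auto simp: lo_def)
  moreover have "tgt (snd z) = tgt (snd z')"
    using eq x l states assms by (intro prof_inj) (auto simp: hi_def)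
  ultimately have "snd z = snd z'" using l inj_edges assms(1,2) by (auto dest: inj_onD)
  then show ?thesis using x by (simp add: prod_eq_iff)
qed

text \<open>Disjointness in band 0 keeps positions at least \<open>2 * \<delta>\<close> apart, so
  each cell of that width contains at most one. Finiteness is what allows taking a leftmost bar and
  a closed union of tiles.\<close>

lemma finite_disjoint_placements:
  assumes "Z \<subseteq> UNIV \<times> E" "\<And>z. z \<in> Z \<Longrightarrow> 0 \<le> fst z \<and> fst z \<le> a"
    and D: "\<And>z z'. z \<in> Z \<Longrightarrow> z' \<in> Z \<Longrightarrow> z \<noteq> z' \<Longrightarrow>
      {lo 0 z..<hi 0 z} \<inter> {lo 0 z'..<hi 0 z'} = {}"
  shows "finite Z"
proof -
  let ?f = "\<lambda>z. \<lfloor>fst z / (2 * \<delta>)\<rfloor>"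
  have "inj_on ?f Z"
  proof (rule inj_onI, rule ccontr)
    fix z z' assume z: "z \<in> Z" "z' \<in> Z" "?f z = ?f z'" "z \<noteq> z'"
    have "\<bar>fst z / (2 * \<delta>) - fst z' / (2 * \<delta>)\<bar> < 1" using z(3) by linarith
    then have "\<bar>(fst z - fst z') / (2 * \<delta>)\<bar> < 1" by (simp add: diff_divide_distrib)
    then have "\<bar>fst z - fst z'\<bar> < 2 * \<delta>" using \<delta>_pos by (simp add: abs_divide)
    moreover have "2 * \<delta> \<le> len (snd z)" "2 * \<delta> \<le> len (snd z')" using len_ge assms(1) z by auto
    ultimately have "max (fst z) (fst z') \<in> {lo 0 z..<hi 0 z} \<inter> {lo 0 z'..<hi 0 z'}"
      using \<delta>_pos by (auto simp: lo_def hi_def)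
    then show False using D[OF z(1,2,4)] by blast
  qed
  moreover have "?f ` Z \<subseteq> {0..\<lfloor>a / (2 * \<delta>)\<rfloor>}"
    using assms(2) \<delta>_pos by (auto intro!: floor_mono divide_right_mono)
  ultimately show ?thesis using finite_imageD finite_subset by blast
qed

lemma tiling_part:
  assumes X: "is_tiling tiles a X" and a: "a \<ge> 0"
  obtains Z where "part Z 0 0 a" "X = placed ` Z"
proof -
  define Z where "Z = {z. snd z \<in> E \<and> placed z \<in> X}"
  have zE: "snd z \<in> E" if "z \<in> Z" for z using that by (simp add: Z_def)
  have UX: "\<Union>X = rect a" using X by (simp add: is_tiling_def)
  have "Q \<in> placed ` Z" if Q: "Q \<in> X" for Q
  proof -
    have "\<exists>P\<in>tiles. \<exists>v. Q = (+) v ` P" using X Q by (simp add: is_tiling_def)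
    then obtain e v where e: "e \<in> E" "Q = (+) v ` tile e"
      by (auto simp: tiles_def)
    have "(lo 0 (0, e), 0) \<in> tile e"
      using S_pos lo_less_hi[of "(0, e)" 0] e
      unfolding tile_def placed_def bars_iff by (intro exI[of _ 0]) simp
    moreover have "(lo (S - 1) (0, e), 1) \<in> tile e"
      using S_pos lo_less_hi[of "(0, e)" "S - 1"] e
      unfolding tile_def placed_def bars_iff by (intro exI[of _ "S - 1"]) (simp add: of_nat_diff)
    ultimately have "v + (lo 0 (0, e), 0) \<in> rect a" "v + (lo (S - 1) (0, e), 1) \<in> rect a"
      using UX Q e(2) by blast+
    \<comment> \<open>The tile reaches both height 0 and height 1 and still has to fit, so there is
      no room for a vertical shift.\<close>
    then have "snd v = 0" by (cases v) (auto simp: rect_def split: if_splits)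
    then have "Q = placed (fst v, e)" using e translate_tile[of "fst v" e] by (cases v) simp
    then show ?thesis using Q e by (auto simp: Z_def)
  qed
  then have XZ: "X = placed ` Z" by (auto simp: Z_def)
  have closed_iff: "(\<exists>z\<in>Z. lo b z \<le> x \<and> x \<le> hi b z) \<longleftrightarrow> a \<noteq> 0 \<and> 0 \<le> x \<and> x \<le> a" if b: "b < S" for b x
  proof -
    obtain y where y: "real b / real S < y" "y < (real b + 1) / real S" "0 < y" "y < 1"
      using open_band_point[OF b] by blast
    have "(\<exists>z\<in>Z. lo b z \<le> x \<and> x \<le> hi b z) \<longleftrightarrow> (x, y) \<in> \<Union>X"
      unfolding XZ using bars_iff_open_band[OF b y(1,2)] by (auto simp: placed_def)
    then show ?thesis using UX y by (auto simp: rect_def)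
  qed
  have D: "{lo b z..<hi b z} \<inter> {lo b z'..<hi b z'} = {}"
    if b: "b < S" and z: "z \<in> Z" "z' \<in> Z" "z \<noteq> z'" for b z z'
  proof (rule ccontr)
    assume "{lo b z..<hi b z} \<inter> {lo b z'..<hi b z'} \<noteq> {}"
    then obtain w where "w \<in> {lo b z..<hi b z}" "w \<in> {lo b z'..<hi b z'}" by blast
    then obtain x where x: "w < x" "x < hi b z" "x < hi b z'" "lo b z < x" "lo b z' < x"
      using dense[of w "min (hi b z) (hi b z')"] by auto
    obtain y where y: "real b / real S < y" "y < (real b + 1) / real S"
      using open_band_point[OF b] by blast
    have "(x, y) \<in> interior (placed z)" "(x, y) \<in> interior (placed z')"
      using interior_bars_superset[OF b, of "\<lambda>b. lo b z" "\<lambda>b. hi b z"]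
        interior_bars_superset[OF b, of "\<lambda>b. lo b z'" "\<lambda>b. hi b z'"] x y
      by (auto simp: placed_def)
    moreover have "placed z \<noteq> placed z'" using placed_inj[OF zE zE] z by blast
    moreover have "placed z \<in> X" "placed z' \<in> X" using z by (auto simp: Z_def)
    ultimately show False
      using X unfolding is_tiling_def pairwise_def by blast
  qed
  have bd: "0 \<le> lo b z \<and> hi b z \<le> a" if "b < S" "z \<in> Z" for b z
    using closed_iff[OF that(1), of "lo b z"] closed_iff[OF that(1), of "hi b z"]
      lo_less_hi[OF zE[OF that(2)], of b] that(2) by (meson less_imp_le order_refl)
  have fin: "finite Z"
  proof (rule finite_disjoint_placements)
    show "Z \<subseteq> UNIV \<times> E" using zE by auto
    show "0 \<le> fst z \<and> fst z \<le> a" if "z \<in> Z" for z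
      using bd[OF S_pos that] lo_less_hi[OF zE[OF that], of 0] by (simp add: lo_def)
  qed (use D S_pos in auto)
  have "part Z 0 0 a"
    unfolding part_def
  proof (intro conjI allI impI)
    show "Z \<subseteq> UNIV \<times> E" using zE by auto
    fix b assume b: "b < S"
    show "0 + prof 0 b \<le> a" using a by simp
    show "\<forall>z\<in>Z. \<forall>z'\<in>Z. z \<noteq> z' \<longrightarrow> {lo b z..<hi b z} \<inter> {lo b z'..<hi b z'} = {}"
      using D[OF b] by blast
    show "(\<Union>z\<in>Z. {lo b z..<hi b z}) = {0 + prof 0 b..<a}"
    proof
      show "(\<Union>z\<in>Z. {lo b z..<hi b z}) \<subseteq> {0 + prof 0 b..<a}"
        using bd[OF b] by fastforce
      show "{0 + prof 0 b..<a} \<subseteq> (\<Union>z\<in>Z. {lo b z..<hi b z})"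
      proof (rule subsetI, rule ccontr)
        fix x assume x: "x \<in> {0 + prof 0 b..<a}" and n: "x \<notin> (\<Union>z\<in>Z. {lo b z..<hi b z})"
        \<comment> \<open>To the right of an uncovered \<open>x\<close> there is a gap before the
          next left end. A point \<open>w\<close> in it lies in a closed bar, which must begin at or
          before \<open>x\<close> and end after it, so it covers \<open>x\<close> after all.\<close>
        let ?M = "insert a (lo b ` {z \<in> Z. x < lo b z})"
        have finM: "finite ?M" using fin by simp
        have "x < Min ?M" using x finM by (subst Min_gr_iff) auto
        then obtain w where w: "x < w" "w < Min ?M" using dense by blast
        have "Min ?M \<le> a" using finM by (intro Min_le) auto
        then obtain z where z: "z \<in> Z" "lo b z \<le> w" "w \<le> hi b z"
          using closed_iff[OF b, of w] w x by auto
        show False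
        proof (cases "x < lo b z")
          case True
          then have "Min ?M \<le> lo b z" using finM z(1) by (intro Min_le) auto
          then show False using w z by linarith
        next
          case False
          then show False using n z w by auto
        qed
      qed
    qed
  qed
  then show ?thesis using that XZ by blast
qed

lemma part_tiling:
  assumes P: "part Z 0 0 a" and a: "a \<ge> 0"
  shows "is_tiling tiles a (placed ` Z)"
proof -
  have zE: "snd z \<in> E" if "z \<in> Z" for z using P that by (auto simp: part_def)
  have U: "(\<Union>z\<in>Z. {lo b z..<hi b z}) = {0..<a}" if "b < S" for b
    using P that by (simp add: part_def)
  have D: "{lo b z..<hi b z} \<inter> {lo b z'..<hi b z'} = {}"
    if "b < S" "z \<in> Z" "z' \<in> Z" "z \<noteq> z'" for b z z'
    using P that by (simp add: part_def)
  have bd: "0 \<le> lo b z \<and> hi b z \<le> a" if "b < S" "z \<in> Z" for b z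
  proof -
    have "{lo b z..<hi b z} \<subseteq> {0..<a}" using U[OF that(1)] that by blast
    then show ?thesis using lo_less_hi[OF zE[OF that(2)], of b] by (simp add: atLeastLessThan_subset_iff)
  qed
  have fin: "finite Z"
  proof (rule finite_disjoint_placements)
    show "Z \<subseteq> UNIV \<times> E" using zE by auto
    show "0 \<le> fst z \<and> fst z \<le> a" if "z \<in> Z" for z
      using bd[OF S_pos that] lo_less_hi[OF zE[OF that], of 0] by (simp add: lo_def)
  qed (use D S_pos in auto)
  show ?thesis
    unfolding is_tiling_def
  proof (intro conjI)
    show "\<forall>Q\<in>placed ` Z. \<exists>P\<in>tiles. \<exists>v. Q = (+) v ` P"
    proof
      fix Q assume "Q \<in> placed ` Z"
      then obtain z where z: "z \<in> Z" "Q = placed z" by blast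
      then have "Q = (+) (fst z, 0) ` tile (snd z)" by (simp add: translate_tile)
      then show "\<exists>P\<in>tiles. \<exists>v. Q = (+) v ` P" using zE[OF z(1)] unfolding tiles_def by blast
    qed
    have I: "interior (placed z) \<inter> interior (placed z') = {}" if z: "z \<in> Z" "z' \<in> Z" "z \<noteq> z'" for z z'
    proof (rule ccontr)
      assume "interior (placed z) \<inter> interior (placed z') \<noteq> {}"
      then obtain x y where xy: "(x, y) \<in> interior (placed z) \<inter> interior (placed z')"
        by (metis ex_in_conv surj_pair)
      obtain A B where AB: "open A" "open B" "x \<in> A" "y \<in> B"
        "A \<times> B \<subseteq> interior (placed z) \<inter> interior (placed z')"
        using open_prod_elim[OF open_Int[OF open_interior open_interior] xy]
        by (metis mem_Sigma_iff)
      have AB': "A \<times> B \<subseteq> placed z \<inter> placed z'"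
        using AB(5) interior_subset[of "placed z"] interior_subset[of "placed z'"] by blast
      \<comment> \<open>The common interior point may lie on a band boundary. An open set of heights
        is infinite and hence contains one off the finite grid.\<close>
      let ?G = "(\<lambda>b. real b / real S) ` {..S}"
      have "infinite B"
        using AB(2,4) finite_imp_not_open[of B] by auto
      then have "\<exists>y'. y' \<in> B - ?G"
        using infinite_imp_nonempty[of "B - ?G"] by auto
      then obtain y' where y': "y' \<in> B" "y' \<notin> ?G" by blast
      have "0 \<le> y'" "y' \<le> 1"
        using bars_height_range[of x y' S "\<lambda>b. lo b z" "\<lambda>b. hi b z"] AB' AB(3) y'(1)
        by (auto simp: placed_def)
      then obtain b where b: "b < S" "real b / real S \<le> y'" "y' \<le> (real b + 1) / real S"
        using band_exists[OF S_pos] by metis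
      have "y' \<noteq> real b / real S" "y' \<noteq> real (Suc b) / real S"
        using y'(2) b(1) by (metis atMost_iff imageI less_imp_le, metis Suc_leI atMost_iff imageI)
      then have b': "real b / real S < y'" "y' < (real b + 1) / real S" using b by (auto simp: add.commute)
      obtain r where r: "r > 0" "ball x r \<subseteq> A" using AB(1,3) open_contains_ball by blast
      define x' where "x' = x + r / 2"
      have x': "x' \<in> A" "x < x'" using r by (auto simp: x'_def dist_real_def subset_iff)
      have "(w, y') \<in> placed z" "(w, y') \<in> placed z'" if "w \<in> A" for w
        using AB' y'(1) that by auto
      then have "lo b z \<le> x \<and> x' \<le> hi b z" "lo b z' \<le> x \<and> x' \<le> hi b z'"
        using bars_iff_open_band[OF b(1) b'] AB(3) x'(1) by (auto simp: placed_def)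
      then have "x \<in> {lo b z..<hi b z} \<inter> {lo b z'..<hi b z'}" using x'(2) by auto
      then show False using D[OF b(1) z] by blast
    qed
    show "pairwise (\<lambda>Q Q'. interior Q \<inter> interior Q' = {}) (placed ` Z)"
    proof (rule pairwiseI)
      fix Q Q' assume "Q \<in> placed ` Z" "Q' \<in> placed ` Z" "Q \<noteq> Q'"
      then obtain z z' where "z \<in> Z" "z' \<in> Z" "Q = placed z" "Q' = placed z'" "z \<noteq> z'"
        by blast
      then show "interior Q \<inter> interior Q' = {}" using I by simp
    qed
    show "\<Union> (placed ` Z) = rect a"
    proof (cases "a = 0")
      case True
      have "Z = {}"
      proof (rule ccontr)
        assume "Z \<noteq> {}"
        then obtain z where z: "z \<in> Z" by blast
        show False using bd[OF S_pos z] lo_less_hi[OF zE[OF z], of 0] True by simp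
      qed
      then show ?thesis using True by (simp add: rect_def)
    next
      case False
      \<comment> \<open>The half-open intervals miss the right edge of the rectangle; it is supplied
        by closing a finite union of closed tiles.\<close>
      have "closed (\<Union> (placed ` Z))"
        using fin by (intro closed_Union) (auto simp: placed_def compact_bars compact_imp_closed)
      moreover have "{0..<a} \<times> {0..1} \<subseteq> \<Union> (placed ` Z)"
      proof clarify
        fix x y :: real assume xy: "x \<in> {0..<a}" "y \<in> {0..1}"
        obtain b where b: "b < S" "real b / real S \<le> y" "y \<le> (real b + 1) / real S"
          using band_exists[OF S_pos, of y] xy by auto
        obtain z where "z \<in> Z" "x \<in> {lo b z..<hi b z}" using U[OF b(1)] xy by blast
        then show "(x, y) \<in> \<Union> (placed ` Z)"
          using b by (auto simp: placed_def bars_iff intro!: bexI[of _ z] exI[of _ b])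
      qed
      ultimately have "closure ({0..<a} \<times> {0..1}) \<subseteq> \<Union> (placed ` Z)"
        by (rule closure_minimal[rotated])
      then have "rect a \<subseteq> \<Union> (placed ` Z)"
        using False a by (simp add: rect_def closure_Times)
      moreover have "\<Union> (placed ` Z) \<subseteq> rect a"
      proof clarify
        fix x y z assume z: "(x, y) \<in> placed z" "z \<in> Z"
        then obtain b where "b < S" "lo b z \<le> x" "x \<le> hi b z" by (auto simp: placed_def bars_iff)
        then show "(x, y) \<in> rect a"
          using bd[of b z] z bars_height_range[of x y] False by (fastforce simp: rect_def placed_def)
      qed
      ultimately show ?thesis by blast
    qed
  qed
qed

lemma card_tilings:
  assumes "a \<ge> 0"
  shows "card {X. is_tiling tiles a X} =
    card {es. epath E src tgt 0 es \<and> sum_list (map len es) = a}"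
proof -
  let ?P = "{es. epath E src tgt 0 es \<and> sum_list (map len es) = a}"
  let ?f = "\<lambda>es. placed ` places len 0 es"
  have "bij_betw ?f ?P {X. is_tiling tiles a X}"
    unfolding bij_betw_def
  proof
    show "inj_on ?f ?P"
    proof (rule inj_onI)
      fix es es' assume es: "es \<in> ?P" "es' \<in> ?P" "?f es = ?f es'"
      have "places len 0 es \<subseteq> UNIV \<times> E" "places len 0 es' \<subseteq> UNIV \<times> E"
        using part_places[of 0 es 0 a] part_places[of 0 es' 0 a] es by (auto simp: part_def)
      moreover have "inj_on placed (UNIV \<times> E)" using placed_inj by (auto intro!: inj_onI)
      ultimately have "places len 0 es = places len 0 es'"
        using es(3) by (simp add: inj_on_image_eq_iff)
      then show "es = es'" using places_inj es by blast
    qed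
    show "?f ` ?P = {X. is_tiling tiles a X}"
    proof
      show "?f ` ?P \<subseteq> {X. is_tiling tiles a X}"
        using part_places[of 0 _ 0 a] part_tiling assms by auto
      show "{X. is_tiling tiles a X} \<subseteq> ?f ` ?P"
      proof
        fix X assume "X \<in> {X. is_tiling tiles a X}"
        then obtain Z where Z: "part Z 0 0 a" "X = placed ` Z" using tiling_part assms by blast
        then obtain es where "epath E src tgt 0 es" "0 + sum_list (map len es) = a"
          "Z = places len 0 es"
          using part_obtain_path[OF Z(1) S_pos] by blast
        then show "X \<in> ?f ` ?P" using Z by auto
      qed
    qed
  qed
  then show ?thesis by (simp add: bij_betw_same_card)
qed

end

section \<open>Integer polynomials as lengths\<close>

definition rpoly :: "int poly \<Rightarrow> real \<Rightarrow> real" where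
  "rpoly q t = poly (map_poly real_of_int q) t"

lemma rpoly_0 [simp]: "rpoly 0 t = 0"
  by (simp add: rpoly_def)

lemma rpoly_add [simp]: "rpoly (p + q) t = rpoly p t + rpoly q t"
proof -
  have "map_poly real_of_int (p + q) = map_poly real_of_int p + map_poly real_of_int q"
    by (rule poly_eqI) (simp add: coeff_map_poly)
  then show ?thesis by (simp add: rpoly_def)
qed

lemma rpoly_uminus [simp]: "rpoly (- p) t = - rpoly p t"
  using rpoly_add[of p "- p" t] by simp

lemma rpoly_pCons [simp]: "rpoly (pCons a p) t = a + t * rpoly p t"
  by (cases "a = 0 \<and> p = 0") (auto simp: rpoly_def map_poly_pCons)

lemma rpoly_sum_list: "rpoly (sum_list ps) t = sum_list (map (\<lambda>p. rpoly p t) ps)"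
  by (induction ps) auto

text \<open>Countably many nonzero integer polynomials with finitely many roots each cannot exhaust
  an interval.\<close>

lemma obtain_transcendental:
  fixes d :: real
  assumes "d > 0"
  obtains t where "0 < t" "t < d" "\<And>q. rpoly q t = 0 \<Longrightarrow> q = 0"
proof -
  have "inj (coeffs :: int poly \<Rightarrow> _)" by (rule injI) (simp add: coeffs_eq_iff)
  then have "countable (UNIV :: int poly set)"
    using countableI' by (metis countableI_type countable_image_inj_on inj_on_subset subset_UNIV)
  moreover have "finite {t. rpoly q t = 0}" if "q \<noteq> 0" for q
  proof -
    have "map_poly real_of_int q \<noteq> 0" using that by (simp add: map_poly_eq_0_iff)
    then show ?thesis unfolding rpoly_def by (rule poly_roots_finite)
  qed
  ultimately have "countable (\<Union>q\<in>{q. q \<noteq> 0}. {t. rpoly q t = 0})"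
    by (intro countable_UN) (auto intro: countable_subset countable_finite)
  then have "\<not> {0<..<d} \<subseteq> (\<Union>q\<in>{q. q \<noteq> 0}. {t. rpoly q t = 0})"
    using uncountable_open_interval[of 0 d] assms countable_subset by blast
  then obtain t where "t \<in> {0<..<d}" "t \<notin> (\<Union>q\<in>{q. q \<noteq> 0}. {t. rpoly q t = 0})"
    by blast
  then show ?thesis using that[of t] by auto
qed

lemma finite_common_lower_bound:
  fixes f :: "'e \<Rightarrow> real"
  assumes "finite E" "\<And>e. e \<in> E \<Longrightarrow> f e > 0"
  obtains d where "d > 0" "\<And>e. e \<in> E \<Longrightarrow> d \<le> f e"
proof
  show "Min (insert 1 (f ` E)) > 0" using assms by (subst Min_gr_iff) auto
  show "Min (insert 1 (f ` E)) \<le> f e" if "e \<in> E" for e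
    using assms that by (intro Min_le) auto
qed

fun halves :: "'e list \<Rightarrow> ('e \<times> bool) list" where
  "halves [] = []"
| "halves (e # es) = (e, False) # (e, True) # halves es"

lemma halves_inj: "halves es = halves es' \<Longrightarrow> es = es'"
  by (induction es arbitrary: es') (metis halves.elims list.distinct(1) list.inject Pair_inject)+

text \<open>Parallel edges of equal length would yield the same tile. Cutting each edge in half at a
  middle state of its own tells them apart, and since no other edge passes through that state the
  halves always occur in pairs.\<close>

lemma tile_set_of_coloured_edges:
  fixes E :: "'e set" and src tgt :: "'e \<Rightarrow> nat" and len :: "'e \<Rightarrow> real"
  assumes fin: "finite E" and pos: "\<And>e. e \<in> E \<Longrightarrow> len e > 0"
  obtains T where "tall_tile_set T"
    "\<And>a. a \<ge> 0 \<Longrightarrow> card {X. is_tiling T a X} =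
      card {es. epath E src tgt 0 es \<and> sum_list (map len es) = a}"
proof -
  obtain g :: "'e \<Rightarrow> nat" where g: "inj_on g E"
    using fin finite_imp_inj_to_nat_seg by metis
  obtain m where m: "\<And>e. e \<in> E \<Longrightarrow> src e \<le> m \<and> tgt e \<le> m"
  proof
    show "src e \<le> Max (src ` E \<union> tgt ` E) \<and> tgt e \<le> Max (src ` E \<union> tgt ` E)" if "e \<in> E" for e
      using fin that by (auto intro!: Max_ge)
  qed
  obtain M where M: "\<And>e. e \<in> E \<Longrightarrow> g e \<le> M"
  proof
    show "g e \<le> Max (g ` E)" if "e \<in> E" for e using fin that by (auto intro!: Max_ge)
  qed
  obtain d where d: "d > 0" "\<And>e. e \<in> E \<Longrightarrow> d \<le> len e"
    using finite_common_lower_bound[OF fin, of len] pos by blast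
  define mid where "mid e = Suc (m + g e)" for e
  define E' :: "('e \<times> bool) set" where "E' = E \<times> UNIV"
  define src' where "src' p = (if snd p then mid (fst p) else src (fst p))" for p
  define tgt' where "tgt' p = (if snd p then tgt (fst p) else mid (fst p))" for p
  define len' where "len' p = len (fst p) / 2" for p :: "'e \<times> bool"
  have mid_inj: "e = e'" if "e \<in> E" "e' \<in> E" "mid e = mid e'" for e e'
    using that g by (auto simp: mid_def dest: inj_onD)
  have mid_gt: "mid e > m" for e by (simp add: mid_def)
  \<comment> \<open>Half edges have length at least \<open>d / 2\<close>, which is twice the tooth
    width \<open>d / 4\<close>. Middle states are numbered from \<open>m + 1\<close> to at most
    \<open>m + M + 1\<close>.\<close>
  interpret tile_edges E' src' tgt' len' "m + M + 2" "d / 4"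
  proof
    show "finite E'" using fin by (simp add: E'_def)
    show "src' e < m + M + 2 \<and> tgt' e < m + M + 2" if "e \<in> E'" for e
      using that m[of "fst e"] M[of "fst e"] by (auto simp: E'_def src'_def tgt'_def mid_def)
    show "2 * (d / 4) \<le> len' e" if "e \<in> E'" for e
      using that d(2)[of "fst e"] by (auto simp: E'_def len'_def)
    show "inj_on (\<lambda>e. (src' e, tgt' e, len' e)) E'"
    proof (rule inj_onI)
      fix p p' assume p: "p \<in> E'" "p' \<in> E'"
        "(src' p, tgt' p, len' p) = (src' p', tgt' p', len' p')"
      have E: "fst p \<in> E" "fst p' \<in> E" using p by (auto simp: E'_def)
      have "snd p = snd p'"
        using p(3) m[OF E(1)] m[OF E(2)] mid_gt[of "fst p"] mid_gt[of "fst p'"]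
        by (auto simp: src'_def tgt'_def split: if_splits)
      moreover have "fst p = fst p'"
        using p(3) mid_inj[OF E] \<open>snd p = snd p'\<close> by (auto simp: src'_def tgt'_def split: if_splits)
      ultimately show "p = p'" by (simp add: prod_eq_iff)
    qed
  qed (use d in auto)
  have path_halves: "epath E' src' tgt' q (halves es) \<longleftrightarrow> epath E src tgt q es" for q es
    by (induction es arbitrary: q) (auto simp: E'_def src'_def tgt'_def)
  have obtain_halves: "\<exists>es. p = halves es" if "epath E' src' tgt' q p" "q \<le> m" for q p
    using that
  proof (induction p arbitrary: q rule: length_induct)
    case (1 p)
    show ?case
    proof (cases p)
      case Nil
      then show ?thesis by (intro exI[of _ "[]"]) simp
    next
      case (Cons a p1)
      have a: "fst a \<in> E" "src' a = q" "epath E' src' tgt' (tgt' a) p1"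
        using 1(2) Cons by (auto simp: E'_def)
      have sa: "\<not> snd a" using a(2) 1(3) mid_gt[of "fst a"] by (auto simp: src'_def)
      then have t: "tgt' a = mid (fst a)" by (simp add: tgt'_def)
      then obtain b p2 where p1: "p1 = b # p2" using a(3) mid_gt[of "fst a"] by (cases p1) auto
      have b: "fst b \<in> E" "src' b = mid (fst a)" "epath E' src' tgt' (tgt' b) p2"
        using a(3) p1 t by (auto simp: E'_def)
      have sb: "snd b" using b(2) m[OF b(1)] mid_gt[of "fst a"] by (auto simp: src'_def split: if_splits)
      then have "fst b = fst a" using b mid_inj[OF b(1) a(1)] by (simp add: src'_def)
      have "tgt' b \<le> m" using sb m[OF b(1)] by (simp add: tgt'_def)
      moreover have "length p2 < length p" using Cons p1 by simp
      ultimately obtain es where "p2 = halves es" using 1(1) b(3) by blast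
      then have "p = halves (fst a # es)"
        using Cons p1 sa sb \<open>fst b = fst a\<close> by (cases a, cases b) auto
      then show ?thesis by blast
    qed
  qed
  have sum_halves: "sum_list (map len' (halves es)) = sum_list (map len es)" for es
    by (induction es) (auto simp: len'_def)
  have "card {p. epath E' src' tgt' 0 p \<and> sum_list (map len' p) = a} =
      card {es. epath E src tgt 0 es \<and> sum_list (map len es) = a}" for a
  proof -
    have "{p. epath E' src' tgt' 0 p \<and> sum_list (map len' p) = a} =
        halves ` {es. epath E src tgt 0 es \<and> sum_list (map len es) = a}"
      using obtain_halves[of 0] by (force simp: path_halves sum_halves)
    then show ?thesis
      by (simp add: card_image inj_on_def halves_inj)
  qed
  then show ?thesis using that[OF tall_tiles] card_tilings by simp
qed

text \<open>Evaluating at a small transcendental number turns polynomial lengths into real ones without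
  losing information. The coefficient of degree \<open>1\<close> in the total is what \<open>\<epsilon>\<close> accounts for.\<close>

theorem tile_count_of_polynomial_lengths:
  fixes E :: "'e set" and src tgt :: "'e \<Rightarrow> nat" and len :: "'e \<Rightarrow> int poly"
  assumes fin: "finite E" and pos: "\<And>e. e \<in> E \<Longrightarrow> coeff (len e) 0 > 0"
  shows "\<exists>f\<in>tile_counting_functions. \<forall>n.
    f n = card {es. epath E src tgt 0 es \<and> sum_list (map len es) = [:int n, 1:]}"
proof -
  \<comment> \<open>Near 0 the positive constant coefficient dominates, so all lengths become
    positive reals.\<close>
  have "\<forall>\<^sub>F t in at 0. rpoly (len e) t > 0" if "e \<in> E" for e
  proof (rule order_tendstoD)
    show "((\<lambda>t. rpoly (len e) t) \<longlongrightarrow> rpoly (len e) 0) (at 0)"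
      unfolding rpoly_def using isCont_def poly_isCont by blast
    show "0 < rpoly (len e) 0"
      using pos[OF that] by (simp add: rpoly_def poly_0_coeff_0 coeff_map_poly)
  qed
  then have "\<forall>\<^sub>F t in at 0. \<forall>e\<in>E. rpoly (len e) t > 0"
    using fin by (simp add: eventually_ball_finite)
  then obtain d where d: "d > 0" "\<And>t. t \<noteq> 0 \<Longrightarrow> dist t 0 < d \<Longrightarrow> \<forall>e\<in>E. rpoly (len e) t > 0"
    by (auto simp: eventually_at)
  obtain t where t: "0 < t" "t < d" "\<And>q. rpoly q t = 0 \<Longrightarrow> q = 0"
    using obtain_transcendental[OF d(1)] by blast
  have "rpoly (len e) t > 0" if "e \<in> E" for e using d(2)[of t] t that by auto
  then obtain T where T: "tall_tile_set T"
    "\<And>a. a \<ge> 0 \<Longrightarrow> card {X. is_tiling T a X} =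
      card {es. epath E src tgt 0 es \<and> sum_list (map (\<lambda>e. rpoly (len e) t) es) = a}"
    using tile_set_of_coloured_edges[OF fin, of "\<lambda>e. rpoly (len e) t" src tgt] by blast
  have "sum_list (map (\<lambda>e. rpoly (len e) t) es) = real n + t \<longleftrightarrow>
      sum_list (map len es) = [:int n, 1:]" for es n
  proof
    assume "sum_list (map (\<lambda>e. rpoly (len e) t) es) = real n + t"
    then have "rpoly (sum_list (map len es) + - [:int n, 1:]) t = 0"
      unfolding rpoly_add rpoly_uminus rpoly_sum_list by (simp add: comp_def)
    then have "sum_list (map len es) + - [:int n, 1:] = 0" using t(3) by blast
    then show "sum_list (map len es) = [:int n, 1:]"
      by (simp only: add_uminus_conv_diff right_minus_eq)
  next
    assume s: "sum_list (map len es) = [:int n, 1:]"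
    have "sum_list (map (\<lambda>e. rpoly (len e) t) es) = rpoly (sum_list (map len es)) t"
      by (simp add: rpoly_sum_list comp_def)
    then show "sum_list (map (\<lambda>e. rpoly (len e) t) es) = real n + t" using s by simp
  qed
  then have "tile_count T t n =
      card {es. epath E src tgt 0 es \<and> sum_list (map len es) = [:int n, 1:]}" for n
    using T(2)[of "real n + t"] t(1) by (simp add: tile_count_def)
  moreover have "tile_count T t \<in> tile_counting_functions"
    unfolding tile_counting_functions_def
    using T(1) t(1) by (intro CollectI exI[of _ T] exI[of _ t]) auto
  ultimately show ?thesis by blast
qed

section \<open>Group rings as weighted multisets\<close>

text \<open>The product is convolution. With \<open>int poly\<close> as exponents these are Laurent
  polynomials in variables \<open>x_0, x_1, ...\<close>: coefficient \<open>i\<close> of the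
  exponent is the power of \<open>x_i\<close>, and \<open>lookup P 0\<close> is the constant
  term.\<close>

type_synonym 'a gr = "'a \<Rightarrow>\<^sub>0 real"

abbreviation lookup :: "'a gr \<Rightarrow> 'a \<Rightarrow> real" where "lookup \<equiv> Poly_Mapping.lookup"
abbreviation keys :: "'a gr \<Rightarrow> 'a set" where "keys \<equiv> Poly_Mapping.keys"
abbreviation single :: "'a \<Rightarrow> real \<Rightarrow> 'a gr" where "single \<equiv> Poly_Mapping.single"

definition lin :: "('a \<Rightarrow> real) \<Rightarrow> 'a gr \<Rightarrow> real" where
  "lin f P = (\<Sum>x\<in>keys P. lookup P x * f x)"

definition mass :: "'a gr \<Rightarrow> real" where
  "mass P = lin (\<lambda>_. 1) P"

definition nonneg :: "'a gr \<Rightarrow> bool" where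
  "nonneg P \<longleftrightarrow> (\<forall>x. 0 \<le> lookup P x)"

definition integral_gr :: "'a gr \<Rightarrow> bool" where
  "integral_gr P \<longleftrightarrow> (\<forall>x. lookup P x \<in> \<int>)"

lemma lin_superset:
  assumes "finite A" "keys P \<subseteq> A"
  shows "lin f P = (\<Sum>x\<in>A. lookup P x * f x)"
  unfolding lin_def
  by (rule sum.mono_neutral_left) (use assms in \<open>auto simp: in_keys_iff\<close>)

lemma lin_0 [simp]: "lin f 0 = 0"
  by (simp add: lin_def)

lemma lin_single [simp]: "lin f (single x a) = a * f x"
  by (cases "a = 0") (simp_all add: lin_def)

lemma lin_one [simp]: "lin f (1 :: 'a::monoid_add gr) = f 0"
  using lin_single[of f 0 1] by simp

lemma lin_add [simp]: "lin f (P + Q) = lin f P + lin f Q"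
proof -
  let ?A = "keys P \<union> keys Q"
  have "lin f (P + Q) = (\<Sum>x\<in>?A. lookup (P + Q) x * f x)"
    by (rule lin_superset) (auto dest: Poly_Mapping.keys_add[THEN subsetD])
  also have "\<dots> = (\<Sum>x\<in>?A. lookup P x * f x) + (\<Sum>x\<in>?A. lookup Q x * f x)"
    by (simp add: lookup_add algebra_simps sum.distrib)
  finally show ?thesis
    by (simp add: lin_superset[of ?A P] lin_superset[of ?A Q])
qed

lemma lin_uminus [simp]: "lin f (- P) = - lin f P"
  using lin_add[of f P "- P"] by (simp del: lin_add)

lemma lin_diff [simp]: "lin f (P - Q) = lin f P - lin f Q"
  using lin_add[of f P "- Q"] by (simp del: lin_add)

lemma lin_sum: "lin f (sum P I) = (\<Sum>i\<in>I. lin f (P i))"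
  by (induction I rule: infinite_finite_induct) auto

lemma lin_fun_add: "lin (\<lambda>x. f x + g x) P = lin f P + lin g P"
  by (simp add: lin_def algebra_simps sum.distrib)

lemma lin_fun_cmult: "lin (\<lambda>x. c * f x) P = c * lin f P"
  by (simp add: lin_def sum_distrib_left algebra_simps)

lemma lin_fun_sum: "lin (\<lambda>x. \<Sum>i\<in>I. f i x) P = (\<Sum>i\<in>I. lin (f i) P)"
  unfolding lin_def by (simp add: sum_distrib_left sum.swap[of _ _ "keys P"])

lemma lin_cong: "(\<And>x. x \<in> keys P \<Longrightarrow> f x = g x) \<Longrightarrow> lin f P = lin g P"
  by (simp add: lin_def)

lemma lookup_eq_lin: "lookup P z = lin (\<lambda>x. if x = z then 1 else 0) P"
proof -
  have "lin (\<lambda>x. if x = z then 1 else 0) P = (\<Sum>x\<in>insert z (keys P). lookup P x * (if x = z then 1 else 0))"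
    by (rule lin_superset) auto
  then show ?thesis by (simp add: sum.delta if_distrib cong: if_cong)
qed

lemma gr_decompose: "P = (\<Sum>x\<in>keys P. single x (lookup P x))"
proof (rule poly_mapping_eqI)
  fix z
  have "lookup (\<Sum>x\<in>keys P. single x (lookup P x)) z =
      (\<Sum>x\<in>keys P. if x = z then lookup P x else 0)"
    by (simp add: lookup_sum lookup_single when_def)
  also have "\<dots> = lookup P z" by (simp add: in_keys_iff)
  finally show "lookup P z = lookup (\<Sum>x\<in>keys P. single x (lookup P x)) z" by simp
qed

lemma lin_times_single:
  fixes P :: "'a::monoid_add gr"
  shows "lin f (P * single y b) = b * lin (\<lambda>x. f (x + y)) P"
proof -
  have "P * single y b = (\<Sum>x\<in>keys P. single x (lookup P x)) * single y b"
    using gr_decompose[of P] by simp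
  also have "lin f \<dots> = (\<Sum>x\<in>keys P. lookup P x * b * f (x + y))"
    by (simp add: sum_distrib_right mult_single lin_sum)
  finally show ?thesis by (simp add: lin_def sum_distrib_left algebra_simps)
qed

text \<open>Fubini for the convolution. Mass, sign and integrality of products are all read off from
  it.\<close>

lemma lin_mult:
  fixes P Q :: "'a::monoid_add gr"
  shows "lin f (P * Q) = lin (\<lambda>x. lin (\<lambda>y. f (x + y)) Q) P"
proof -
  have "P * Q = P * (\<Sum>y\<in>keys Q. single y (lookup Q y))"
    using gr_decompose[of Q] by simp
  then have "lin f (P * Q) = (\<Sum>y\<in>keys Q. lookup Q y * lin (\<lambda>x. f (x + y)) P)"
    by (simp add: sum_distrib_left lin_sum lin_times_single)
  also have "\<dots> = lin (\<lambda>x. lin (\<lambda>y. f (x + y)) Q) P"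
    unfolding lin_def[of _ Q] lin_fun_sum by (simp add: lin_fun_cmult)
  finally show ?thesis .
qed

lemma lookup_times_single:
  fixes P :: "'a::ab_group_add gr"
  shows "lookup (P * single y b) z = b * lookup P (z - y)"
proof -
  have "(\<lambda>x. if x + y = z then 1 else 0 :: real) = (\<lambda>x. if x = z - y then 1 else 0)"
    by (auto simp: eq_diff_eq)
  then show ?thesis by (simp only: lookup_eq_lin lin_times_single)
qed

lemma mass_simps [simp]:
  "mass 0 = 0" "mass (P + Q) = mass P + mass Q" "mass (P - Q) = mass P - mass Q"
  "mass (single x a) = a"
  by (simp_all add: mass_def)

lemma mass_one [simp]: "mass (1 :: 'a::monoid_add gr) = 1"
  by (simp add: mass_def)

lemma mass_mult [simp]: "mass (P * Q :: 'a::monoid_add gr) = mass P * mass Q"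
  by (simp add: mass_def lin_mult) (simp add: lin_def sum_distrib_right)

lemma mass_power [simp]: "mass (P ^ n :: 'a::monoid_add gr) = mass P ^ n"
  by (induction n) auto

lemma lin_nonneg:
  assumes "nonneg P" "\<And>x. x \<in> keys P \<Longrightarrow> 0 \<le> f x"
  shows "0 \<le> lin f P"
  using assms by (auto simp: lin_def nonneg_def intro!: sum_nonneg)

lemma lin_mono:
  assumes "nonneg P" "\<And>x. x \<in> keys P \<Longrightarrow> f x \<le> g x"
  shows "lin f P \<le> lin g P"
  using assms by (auto simp: lin_def nonneg_def intro!: sum_mono mult_left_mono)

lemma lin_le_mass:
  assumes "nonneg P" "\<And>x. x \<in> keys P \<Longrightarrow> f x \<le> 1"
  shows "lin f P \<le> mass P"
  unfolding mass_def using assms by (rule lin_mono)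

lemma nonneg_intros:
  "nonneg 0" "nonneg P \<Longrightarrow> nonneg Q \<Longrightarrow> nonneg (P + Q)" "0 \<le> a \<Longrightarrow> nonneg (single x a)"
  by (auto simp: nonneg_def lookup_add lookup_single when_def)

lemma nonneg_one [simp]: "nonneg (1 :: 'a::monoid_add gr)"
  by (auto simp: nonneg_def lookup_one when_def)

lemma nonneg_mult:
  fixes P Q :: "'a::monoid_add gr"
  assumes "nonneg P" "nonneg Q"
  shows "nonneg (P * Q)"
  unfolding nonneg_def lookup_eq_lin lin_mult using assms by (auto intro!: lin_nonneg)

lemma nonneg_power: "nonneg (P :: 'a::monoid_add gr) \<Longrightarrow> nonneg (P ^ n)"
  by (induction n) (auto intro: nonneg_mult)

lemma integral_gr_intros:
  "integral_gr 0" "integral_gr P \<Longrightarrow> integral_gr Q \<Longrightarrow> integral_gr (P + Q)"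
  "integral_gr P \<Longrightarrow> integral_gr Q \<Longrightarrow> integral_gr (P - Q)"
  "a \<in> \<int> \<Longrightarrow> integral_gr (single x a)"
  by (auto simp: integral_gr_def lookup_add lookup_minus lookup_single when_def)

lemma integral_gr_one [simp]: "integral_gr (1 :: 'a::monoid_add gr)"
  by (auto simp: integral_gr_def lookup_one when_def)

lemma integral_gr_mult:
  fixes P Q :: "'a::monoid_add gr"
  assumes "integral_gr P" "integral_gr Q"
  shows "integral_gr (P * Q)"
  unfolding integral_gr_def lookup_eq_lin lin_mult using assms
  by (auto simp: lin_def integral_gr_def intro!: Ints_sum Ints_mult)

lemma integral_gr_power: "integral_gr (P :: 'a::monoid_add gr) \<Longrightarrow> integral_gr (P ^ n)"
  by (induction n) (auto intro: integral_gr_mult)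

lemma keys_mult_subset:
  fixes P Q :: "'a::monoid_add gr"
  assumes "keys P \<subseteq> W" "keys Q \<subseteq> W" "\<And>x y. x \<in> W \<Longrightarrow> y \<in> W \<Longrightarrow> x + y \<in> W"
  shows "keys (P * Q) \<subseteq> W"
proof
  fix z assume "z \<in> keys (P * Q)"
  then obtain x y where "x \<in> keys P" "y \<in> keys Q" "z = x + y"
    using keys_mult[of P Q] by blast
  then show "z \<in> W" using assms by blast
qed

lemma keys_power_subset:
  fixes P :: "'a::monoid_add gr"
  assumes "keys P \<subseteq> A" "0 \<in> A" "\<And>x y. x \<in> A \<Longrightarrow> y \<in> A \<Longrightarrow> x + y \<in> A"
  shows "keys (P ^ n) \<subseteq> A"
proof (induction n)
  case (Suc n)
  then show ?case
    using keys_mult[of P "P ^ n"] assms by fastforce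
qed (use assms in auto)

section \<open>Words over a weighted alphabet\<close>

definition letters :: "'a gr \<Rightarrow> ('a \<times> nat) set" where
  "letters P = (SIGMA x:keys P. {..<nat \<lfloor>lookup P x\<rfloor>})"

lemma finite_letters [simp]: "finite (letters P)"
  by (simp add: letters_def)

lemma sum_letters:
  assumes "nonneg P" "integral_gr P"
  shows "(\<Sum>u\<in>letters P. f (fst u)) = lin f P"
proof -
  have "real (nat \<lfloor>lookup P x\<rfloor>) = lookup P x" for x
    using assms by (auto simp: nonneg_def integral_gr_def elim!: Ints_cases)
  moreover have "(\<Sum>u\<in>letters P. f (fst u)) =
      (\<Sum>x\<in>keys P. \<Sum>i\<in>{..<nat \<lfloor>lookup P x\<rfloor>}. f x)"
    unfolding letters_def by (subst sum.Sigma) (auto simp: case_prod_unfold)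
  ultimately show ?thesis by (simp add: lin_def)
qed

text \<open>An integer coefficient is represented by that many distinguishable copies of its
  exponent, so expanding a power without collecting terms lists each word once.\<close>

lemma sum_words:
  fixes P :: "'a::comm_monoid_add gr"
  assumes "nonneg P" "integral_gr P"
  shows "(\<Sum>w\<in>{w. set w \<subseteq> letters P \<and> length w = k}. f (sum_list (map fst w))) = lin f (P ^ k)"
proof (induction k arbitrary: f)
  case 0
  have "{w. set w \<subseteq> letters P \<and> length w = 0} = {[]}" by auto
  then show ?case by simp
next
  case (Suc k)
  let ?W = "{w. set w \<subseteq> letters P \<and> length w = k}"
  have "{w. set w \<subseteq> letters P \<and> length w = Suc k} = (\<lambda>(u, w). u # w) ` (letters P \<times> ?W)"
    by (auto simp: length_Suc_conv image_iff)
  moreover have "inj_on (\<lambda>(u, w). u # w) (letters P \<times> ?W)" by (auto simp: inj_on_def)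
  ultimately have "(\<Sum>w\<in>{w. set w \<subseteq> letters P \<and> length w = Suc k}. f (sum_list (map fst w))) =
      (\<Sum>(u, w)\<in>letters P \<times> ?W. f (fst u + sum_list (map fst w)))"
    by (simp add: sum.reindex case_prod_unfold)
  also have "\<dots> = (\<Sum>u\<in>letters P. \<Sum>w\<in>?W. f (fst u + sum_list (map fst w)))"
    by (simp add: sum.cartesian_product)
  also have "\<dots> = (\<Sum>u\<in>letters P. lin (\<lambda>x. f (fst u + x)) (P ^ k))"
    using Suc.IH[of "\<lambda>x. f (_ + x)"] by simp
  also have "\<dots> = lin (\<lambda>u. lin (\<lambda>x. f (u + x)) (P ^ k)) P"
    using sum_letters[OF assms, of "\<lambda>u. lin (\<lambda>x. f (u + x)) (P ^ k)"] by simp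
  finally show ?case by (simp add: lin_mult)
qed

section \<open>Counting paths through chains of loops\<close>

datatype 'l chain_edge = Start nat 'l | Loop nat nat 'l | Step nat nat

text \<open>Component \<open>i\<close> is a chain: one letter of \<open>U i\<close>, any number of
  letters of \<open>V i\<close>, then compensating loops of displacement \<open>y i\<close>, then
  filler loops, then back to state 0. The map \<open>\<pi> i\<close> selects what is recorded of a
  displacement, and \<open>o' i\<close> is a fixed offset.\<close>

locale chain_components =
  fixes I :: nat and U V :: "nat \<Rightarrow> int poly gr" and \<pi> :: "nat \<Rightarrow> int poly \<Rightarrow> int poly"
    and o' y :: "nat \<Rightarrow> int poly" and L M c :: nat
  assumes U: "\<And>i. i < I \<Longrightarrow> nonneg (U i) \<and> integral_gr (U i)"
    and V: "\<And>i. i < I \<Longrightarrow> nonneg (V i) \<and> integral_gr (V i)"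
    and \<pi>_add: "\<And>i p q. \<pi> i (p + q) = \<pi> i p + \<pi> i q"
    and y: "\<And>i. y i \<noteq> 0"
    and L: "L > 0" and M: "M > 0"
begin

text \<open>Compensating and filler loops come in \<open>c\<close> colours each. Both have length 1,
  so every division of a remaining length \<open>R\<close> among them has the same number
  \<open>c ^ R\<close> of colourings.\<close>

definition loops :: "nat \<Rightarrow> nat \<Rightarrow> (int poly \<times> nat) set" where
  "loops i j = (if j = 0 then letters (V i) else {0} \<times> {..<c})"

definition edges :: "(int poly \<times> nat) chain_edge set" where
  "edges = (\<Union>i<I. Start i ` letters (U i) \<union> (\<Union>j<3. Loop i j ` loops i j \<union> {Step i j}))"

fun src :: "(int poly \<times> nat) chain_edge \<Rightarrow> nat" where
  "src (Start i u) = 0"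
| "src (Loop i j l) = Suc (3 * i + j)"
| "src (Step i j) = Suc (3 * i + j)"

fun tgt :: "(int poly \<times> nat) chain_edge \<Rightarrow> nat" where
  "tgt (Start i u) = Suc (3 * i)"
| "tgt (Loop i j l) = Suc (3 * i + j)"
| "tgt (Step i j) = (if j < 2 then Suc (Suc (3 * i + j)) else 0)"

text \<open>Degree 0 holds the length, degree 1 counts the components entered, and displacements
  occupy the degrees from 2 on. A total of \<open>[:int n, 1:]\<close> thus means one component,
  length \<open>n\<close> and cancelled displacement.\<close>

fun len :: "(int poly \<times> nat) chain_edge \<Rightarrow> int poly" where
  "len (Start i u) = pCons (int L) (pCons 1 (\<pi> i (fst u) + o' i))"
| "len (Loop i j l) = (if j = 0 then pCons (int M) (pCons 0 (\<pi> i (fst l)))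
     else if j = 1 then pCons 1 (pCons 0 (y i)) else [:1:])"
| "len (Step i j) = [:1:]"

fun is_start :: "(int poly \<times> nat) chain_edge \<Rightarrow> bool" where
  "is_start (Start i u) = True"
| "is_start _ = False"

definition word :: "nat \<Rightarrow> int poly \<times> nat \<Rightarrow> (int poly \<times> nat) list \<Rightarrow> (int poly \<times> nat) list \<Rightarrow>
    (int poly \<times> nat) list \<Rightarrow> (int poly \<times> nat) chain_edge list" where
  "word i u w v f = Start i u # map (Loop i 0) w @ Step i 0 # map (Loop i 1) v @ Step i 1 #
     map (Loop i 2) f @ [Step i 2]"

lemma \<pi>_0 [simp]: "\<pi> i 0 = 0"
  using \<pi>_add[of i 0 0] by simp

lemma finite_edges: "finite edges"
  by (auto simp: edges_def loops_def)

lemma len_pos: "e \<in> edges \<Longrightarrow> coeff (len e) 0 > 0"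
  using L M by (auto simp: edges_def)

lemma edges_iff:
  "Start i u \<in> edges \<longleftrightarrow> i < I \<and> u \<in> letters (U i)"
  "Loop i j l \<in> edges \<longleftrightarrow> i < I \<and> j < 3 \<and> l \<in> loops i j"
  "Step i j \<in> edges \<longleftrightarrow> i < I \<and> j < 3"
  by (auto simp: edges_def)

lemma marker_count: "coeff (sum_list (map len es)) 1 = int (length (filter is_start es))"
proof (induction es)
  case (Cons e es)
  have "coeff (len e) 1 = (if is_start e then 1 else 0)" by (cases e) auto
  then show ?case using Cons by simp
qed simp

lemma state_inj: "j < 3 \<Longrightarrow> j' < 3 \<Longrightarrow> 3 * i + j = 3 * i' + j' \<longleftrightarrow> i = i' \<and> j = (j'::nat)"
  by presburger

lemma path_phase:
  assumes "epath edges src tgt (Suc (3 * i + j)) es" "j < 3" "filter is_start es = []"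
  shows "\<exists>w es'. es = map (Loop i j) w @ Step i j # es' \<and> set w \<subseteq> loops i j \<and>
    epath edges src tgt (tgt (Step i j)) es' \<and> filter is_start es' = []"
  using assms
proof (induction es)
  case (Cons e es)
  show ?case
  proof (cases e)
    case (Start i' u)
    then show ?thesis using Cons.prems by simp
  next
    case (Loop i' j' l)
    then have ij: "i' = i" "j' = j"
      using Cons.prems state_inj[of j' j i' i] by (auto simp: edges_iff)
    then obtain w es' where "es = map (Loop i j) w @ Step i j # es'" "set w \<subseteq> loops i j"
      "epath edges src tgt (tgt (Step i j)) es'" "filter is_start es' = []"
      using Cons Loop by auto
    then show ?thesis
      using Loop ij Cons.prems by (intro exI[of _ "l # w"] exI[of _ es']) (auto simp: edges_iff)
  next
    case (Step i' j')
    then have "i' = i" "j' = j"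
      using Cons.prems state_inj[of j' j i' i] by (auto simp: edges_iff)
    then show ?thesis
      using Step Cons.prems by (intro exI[of _ "[]"] exI[of _ es]) auto
  qed
qed simp

lemma path_loops:
  assumes "i < I" "j < 3" "set w \<subseteq> loops i j"
  shows "epath edges src tgt (Suc (3 * i + j)) (map (Loop i j) w @ Step i j # es) \<longleftrightarrow>
    epath edges src tgt (tgt (Step i j)) es"
  using assms(3) by (induction w) (use assms in \<open>auto simp: edges_iff\<close>)

lemma path_word:
  assumes "i < I" "u \<in> letters (U i)" "set w \<subseteq> loops i 0" "set v \<subseteq> loops i 1" "set f \<subseteq> loops i 2"
  shows "epath edges src tgt 0 (word i u w v f)"
  using path_loops[OF assms(1) _ assms(3)] path_loops[OF assms(1) _ assms(4)]
    path_loops[OF assms(1) _ assms(5), of "[]"] assms(1,2)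
  by (simp add: word_def edges_iff numeral_2_eq_2)

lemma path_is_word:
  assumes "epath edges src tgt 0 es" "length (filter is_start es) = 1"
  shows "\<exists>i u w v f. es = word i u w v f \<and> i < I \<and> u \<in> letters (U i) \<and>
    set w \<subseteq> loops i 0 \<and> set v \<subseteq> loops i 1 \<and> set f \<subseteq> loops i 2"
proof -
  have start: "\<exists>i u. e = Start i u \<and> i < I \<and> u \<in> letters (U i)" if "e \<in> edges" "src e = 0" for e
    using that by (cases e) (auto simp: edges_iff)
  obtain e es1 where es: "es = e # es1" using assms(2) by (cases es) auto
  then obtain i u where e: "e = Start i u" "i < I" "u \<in> letters (U i)"
    using assms(1) start[of e] by auto
  have 1: "epath edges src tgt (Suc (3 * i + 0)) es1" "filter is_start es1 = []"
    using assms es e by auto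
  obtain w es2 where 2: "es1 = map (Loop i 0) w @ Step i 0 # es2" "set w \<subseteq> loops i 0"
    "epath edges src tgt (tgt (Step i 0)) es2" "filter is_start es2 = []"
    using path_phase[OF 1(1) _ 1(2)] by auto
  have "epath edges src tgt (Suc (3 * i + 1)) es2" using 2 by simp
  from path_phase[OF this _ 2(4)] obtain v es3 where 3: "es2 = map (Loop i 1) v @ Step i 1 # es3"
    "set v \<subseteq> loops i 1" "epath edges src tgt (tgt (Step i 1)) es3" "filter is_start es3 = []"
    by auto
  have "epath edges src tgt (Suc (3 * i + 2)) es3" using 3 by (simp add: numeral_2_eq_2)
  from path_phase[OF this _ 3(4)] obtain f es4 where 4: "es3 = map (Loop i 2) f @ Step i 2 # es4"
    "set f \<subseteq> loops i 2" "epath edges src tgt (tgt (Step i 2)) es4" "filter is_start es4 = []"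
    by auto
  have "es4 = []"
  proof (cases es4)
    case (Cons e' es5)
    then have "is_start e'" using 4(3) start[of e'] by auto
    then show ?thesis using 4(4) Cons by simp
  qed
  then show ?thesis
    using es e 2 3 4 by (intro exI[of _ i] exI[of _ u] exI[of _ w] exI[of _ v] exI[of _ f])
      (simp add: word_def)
qed

lemma append_loops_inj:
  assumes "map (Loop i j) w @ Step i j # es = map (Loop i j) w' @ Step i j # es'"
  shows "w = w' \<and> es = es'"
  using assms
proof (induction w arbitrary: w')
  case Nil
  then show ?case by (cases w') auto
next
  case (Cons a w)
  then show ?case by (cases w') auto
qed

lemma word_inj:
  assumes "word i u w v f = word i' u' w' v' f'"
  shows "i = i' \<and> u = u' \<and> w = w' \<and> v = v' \<and> f = f'"
proof -
  have "i = i'" "u = u'" using assms by (auto simp: word_def)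
  then show ?thesis
    using assms append_loops_inj[of i 0] append_loops_inj[of i 1] append_loops_inj[of i 2 f "[]" f' "[]"]
    unfolding word_def by (metis list.inject)
qed

lemma len_loops:
  "sum_list (map len (map (Loop i 0) w)) =
    pCons (int (M * length w)) (pCons 0 (\<pi> i (sum_list (map fst w))))"
  "sum_list (map len (map (Loop i 1) w)) = pCons (int (length w)) (pCons 0 (of_nat (length w) * y i))"
  "sum_list (map len (map (Loop i 2) w)) = [:int (length w):]"
  by (induction w) (auto simp: \<pi>_add algebra_simps one_pCons)

lemma len_word:
  "sum_list (map len (word i u w v f)) =
    pCons (int (L + M * length w + length v + length f + 3))
      (pCons 1 (\<pi> i (fst u + sum_list (map fst w)) + o' i + of_nat (length v) * y i))"
proof -
  have "sum_list (map len (word i u w v f)) = len (Start i u) +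
      sum_list (map len (map (Loop i 0) w)) + [:1:] + sum_list (map len (map (Loop i 1) v)) + [:1:] +
      sum_list (map len (map (Loop i 2) f)) + [:1:]"
    unfolding word_def by (simp only: list.map map_append sum_list.Cons sum_list_append len.simps
      sum_list.Nil add.assoc)
  also have "\<dots> = pCons (int (L + M * length w + length v + length f + 3))
      (pCons 1 (\<pi> i (fst u + sum_list (map fst w)) + o' i + of_nat (length v) * y i))"
    unfolding len_loops len.simps by (simp add: \<pi>_add add_ac)
  finally show ?thesis .
qed

text \<open>\<open>R\<close> is the length left over for the last two phases, hence a bound on the
  number of compensating loops.\<close>

definition closes :: "nat \<Rightarrow> nat \<Rightarrow> int poly \<Rightarrow> bool" where
  "closes i R x \<longleftrightarrow> (\<exists>s\<le>R. \<pi> i x + o' i + of_nat s * y i = 0)"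

definition tails :: "nat \<Rightarrow> nat \<Rightarrow> int poly \<Rightarrow> ((int poly \<times> nat) list \<times> (int poly \<times> nat) list) set" where
  "tails i R x = {(v, f). set v \<subseteq> {0} \<times> {..<c} \<and> set f \<subseteq> {0} \<times> {..<c} \<and>
     length v + length f = R \<and> \<pi> i x + o' i + of_nat (length v) * y i = 0}"

text \<open>As \<open>y i\<close> is nonzero, at most one number of compensating loops cancels the
  displacement; all remaining length is filler.\<close>

lemma tails_card:
  "finite (tails i R x)" "card (tails i R x) = (if closes i R x then c ^ R else 0)"
proof -
  let ?C = "{0 :: int poly} \<times> {..<c}"
  let ?W = "\<lambda>k. {w. set w \<subseteq> ?C \<and> length w = k}"
  have fin: "finite (?W k)" and card: "card (?W k) = c ^ k" for k
    by (simp_all add: finite_lists_length_eq card_lists_length_eq)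
  have "finite (tails i R x) \<and> card (tails i R x) = (if closes i R x then c ^ R else 0)"
  proof (cases "closes i R x")
    case True
    then obtain s where s: "s \<le> R" "\<pi> i x + o' i + of_nat s * y i = 0" by (auto simp: closes_def)
    have uniq: "s' = s" if "\<pi> i x + o' i + of_nat s' * y i = 0" for s'
    proof -
      have "of_nat s' * y i = of_nat s * y i" using s(2) that by (metis add_left_imp_eq)
      then show ?thesis using y[of i] by simp
    qed
    have "tails i R x = ?W s \<times> ?W (R - s)"
    proof (intro equalityI subsetI)
      fix p assume p: "p \<in> tails i R x"
      then have "length (fst p) = s" using uniq by (auto simp: tails_def)
      then show "p \<in> ?W s \<times> ?W (R - s)" using p by (auto simp: tails_def)
    next
      fix p assume "p \<in> ?W s \<times> ?W (R - s)"
      then show "p \<in> tails i R x" using s by (cases p) (simp add: tails_def)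
    qed
    then show ?thesis
      using fin card True s(1) by (simp add: card_cartesian_product flip: power_add)
  next
    case False
    then have "tails i R x = {}" by (auto simp: tails_def closes_def)
    then show ?thesis using False by simp
  qed
  then show "finite (tails i R x)" "card (tails i R x) = (if closes i R x then c ^ R else 0)" by auto
qed

definition heads :: "nat \<Rightarrow> nat \<Rightarrow> ((int poly \<times> nat) \<times> (int poly \<times> nat) list) set" where
  "heads i k = letters (U i) \<times> {w. set w \<subseteq> letters (V i) \<and> length w = k}"

definition disp :: "(int poly \<times> nat) \<times> (int poly \<times> nat) list \<Rightarrow> int poly" where
  "disp uw = fst (fst uw) + sum_list (map fst (snd uw))"

lemma finite_heads: "finite (heads i k)"
  by (simp add: heads_def finite_lists_length_eq)

lemma sum_heads:
  assumes "i < I"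
  shows "(\<Sum>uw\<in>heads i k. g (disp uw)) = lin g (U i * V i ^ k)"
proof -
  have "(\<Sum>uw\<in>heads i k. g (disp uw)) =
      (\<Sum>u\<in>letters (U i). \<Sum>w\<in>{w. set w \<subseteq> letters (V i) \<and> length w = k}. g (fst u + sum_list (map fst w)))"
    by (simp add: heads_def disp_def sum.cartesian_product case_prod_unfold)
  also have "\<dots> = (\<Sum>u\<in>letters (U i). lin (\<lambda>x. g (fst u + x)) (V i ^ k))"
    using sum_words[of "V i" "\<lambda>x. g (_ + x)" k] V[OF assms] by simp
  also have "\<dots> = lin (\<lambda>u. lin (\<lambda>x. g (u + x)) (V i ^ k)) (U i)"
    using sum_letters[of "U i" "\<lambda>u. lin (\<lambda>x. g (u + x)) (V i ^ k)"] U[OF assms] by simp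
  finally show ?thesis by (simp add: lin_mult)
qed

text \<open>The fixed cost of a path is \<open>L\<close> for the start and 1 for each of the three
  steps. What remains of \<open>N\<close> after \<open>k\<close> letters of \<open>V i\<close>
  yields the power of \<open>c\<close>.\<close>

lemma path_count:
  assumes n: "n = N + L + 3"
  shows "real (card {es. epath edges src tgt 0 es \<and> sum_list (map len es) = [:int n, 1:]}) =
    (\<Sum>i<I. \<Sum>k\<in>{k. M * k \<le> N}. real c ^ (N - M * k) *
      lin (\<lambda>x. if closes i (N - M * k) x then 1 else 0) (U i * V i ^ k))"
proof -
  let ?K = "{k. M * k \<le> N}"
  have "k \<le> M * k" for k using M by simp
  then have "?K \<subseteq> {..N}" using le_trans by blast
  then have finK: "finite ?K" using finite_subset by blast
  define Q where "Q = (SIGMA i:{..<I}. SIGMA k:?K. SIGMA uw:heads i k. tails i (N - M * k) (disp uw))"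
  define F where "F = (\<lambda>(i :: nat, k :: nat, uw, vf). word i (fst uw) (snd uw) (fst vf) (snd vf))"
  have injF: "inj_on F Q"
  proof (rule inj_onI)
    fix q q' assume q: "q \<in> Q" "q' \<in> Q" "F q = F q'"
    obtain i k uw vf where q1: "q = (i, k, uw, vf)" by (rule prod_cases4)
    obtain i' k' uw' vf' where q2: "q' = (i', k', uw', vf')" by (rule prod_cases4)
    have "i = i'" "uw = uw'" "vf = vf'"
      using word_inj[of i "fst uw" "snd uw" "fst vf" "snd vf"] q(3) q1 q2
      by (auto simp: F_def prod_eq_iff)
    moreover have "k = k'" using q q1 q2 \<open>uw = uw'\<close> by (auto simp: Q_def heads_def)
    ultimately show "q = q'" using q1 q2 by simp
  qed
  have "{es. epath edges src tgt 0 es \<and> sum_list (map len es) = [:int n, 1:]} = F ` Q"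
  proof (intro equalityI subsetI)
    fix es assume es: "es \<in> {es. epath edges src tgt 0 es \<and> sum_list (map len es) = [:int n, 1:]}"
    then have "length (filter is_start es) = 1" using marker_count[of es] by simp
    then obtain i u w v f where w: "es = word i u w v f" "i < I" "u \<in> letters (U i)"
      "set w \<subseteq> loops i 0" "set v \<subseteq> loops i 1" "set f \<subseteq> loops i 2"
      using path_is_word es by blast
    have "pCons (int (L + M * length w + length v + length f + 3))
        (pCons 1 (\<pi> i (fst u + sum_list (map fst w)) + o' i + of_nat (length v) * y i)) =
        [:int n, 1:]"
      using es w(1) len_word[of i u w v f] by simp
    then have sum: "L + M * length w + length v + length f + 3 = n"
      and "\<pi> i (disp (u, w)) + o' i + of_nat (length v) * y i = 0"
      unfolding pCons_eq_iff of_nat_eq_iff by (auto simp: disp_def)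
    moreover have "M * length w \<le> N" using sum n by linarith
    moreover have "length v + length f = N - M * length w" using sum n by linarith
    ultimately have "(i, length w, (u, w), (v, f)) \<in> Q"
      using w by (auto simp: Q_def heads_def tails_def loops_def)
    then show "es \<in> F ` Q"
      using w(1) by (intro image_eqI[of _ F "(i, length w, (u, w), (v, f))"]) (simp_all add: F_def)
  next
    fix es assume "es \<in> F ` Q"
    then obtain i k u w v f where q: "(i, k, (u, w), (v, f)) \<in> Q" "es = word i u w v f"
      by (auto simp: F_def)
    have "L + M * length w + length v + length f + 3 = n"
      "\<pi> i (fst u + sum_list (map fst w)) + o' i + of_nat (length v) * y i = 0"
      using q(1) n by (auto simp: Q_def heads_def tails_def disp_def)
    then have "sum_list (map len es) = [:int n, 1:]"
      using len_word[of i u w v f] q(2) by simp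
    moreover have "epath edges src tgt 0 es"
      unfolding q(2) using q(1)
      by (intro path_word) (auto simp: Q_def heads_def tails_def loops_def)
    ultimately show "es \<in> {es. epath edges src tgt 0 es \<and> sum_list (map len es) = [:int n, 1:]}"
      by simp
  qed
  then have "real (card {es. epath edges src tgt 0 es \<and> sum_list (map len es) = [:int n, 1:]}) =
      real (card Q)"
    using card_image[OF injF] by simp
  also have "\<dots> = (\<Sum>i<I. \<Sum>k\<in>?K. \<Sum>uw\<in>heads i k. real (card (tails i (N - M * k) (disp uw))))"
    unfolding Q_def using finK finite_heads tails_card(1) by (simp add: finite_SigmaI)
  also have "\<dots> = (\<Sum>i<I. \<Sum>k\<in>?K. \<Sum>uw\<in>heads i k. real c ^ (N - M * k) *
      (if closes i (N - M * k) (disp uw) then 1 else 0))"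
    by (intro sum.cong refl) (simp add: tails_card(2))
  also have "\<dots> = (\<Sum>i<I. \<Sum>k\<in>?K. real c ^ (N - M * k) *
      lin (\<lambda>x. if closes i (N - M * k) x then 1 else 0) (U i * V i ^ k))"
  proof (intro sum.cong refl)
    fix i k assume "i \<in> {..<I}" "k \<in> ?K"
    then show "(\<Sum>uw\<in>heads i k. real c ^ (N - M * k) *
        (if closes i (N - M * k) (disp uw) then 1 else 0)) =
        real c ^ (N - M * k) * lin (\<lambda>x. if closes i (N - M * k) x then 1 else 0) (U i * V i ^ k)"
      using sum_heads[of i "\<lambda>x. if closes i (N - M * k) x then 1 else 0" k]
      by (simp flip: sum_distrib_left)
  qed
  finally show ?thesis .
qed

end

section \<open>Limits of component counts\<close>

type_synonym component =
  "int poly gr \<times> int poly gr \<times> (int poly \<Rightarrow> int poly) \<times> int poly \<times> int poly"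

fun closed_by :: "component \<Rightarrow> int poly \<Rightarrow> nat \<Rightarrow> bool" where
  "closed_by (U, V, \<pi>, a, y) x s \<longleftrightarrow> \<pi> x + a + of_nat s * y = 0"

fun comp_term :: "component \<Rightarrow> nat \<Rightarrow> real" where
  "comp_term (U, V, \<pi>, a, y) k =
     lin (\<lambda>x. if \<exists>s. closed_by (U, V, \<pi>, a, y) x s then 1 else 0) (U * V ^ k)"

text \<open>The linear bound ensures that the compensating loops needed after \<open>k\<close>
  letters fit into the remaining length once \<open>N\<close> is large enough, so that each term
  eventually reaches \<open>comp_term\<close>.\<close>

fun good_component :: "component \<Rightarrow> bool" where
  "good_component (U, V, \<pi>, a, y) \<longleftrightarrow> nonneg U \<and> integral_gr U \<and> nonneg V \<and> integral_gr V \<and>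
     (\<forall>p q. \<pi> (p + q) = \<pi> p + \<pi> q) \<and> y \<noteq> 0 \<and>
     (\<exists>b. \<forall>k x s. x \<in> keys (U * V ^ k) \<longrightarrow> closed_by (U, V, \<pi>, a, y) x s \<longrightarrow> s \<le> b * (k + 1))"

text \<open>Sandwich between two partial sums: terms with \<open>k < (N - b) div (M + b)\<close>
  already have their full value, and all others are nonnegative and at most
  \<open>t k\<close>.\<close>

lemma truncated_sum_tendsto:
  fixes g :: "nat \<Rightarrow> nat \<Rightarrow> real" and t :: "nat \<Rightarrow> real"
  assumes sums: "t sums A" and M: "M > 0" and t: "\<And>k. 0 \<le> t k"
    and g: "\<And>N k. 0 \<le> g N k" "\<And>N k. g N k \<le> t k"
    and full: "\<And>N k. M * k + b * (k + 1) \<le> N \<Longrightarrow> g N k = t k"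
  shows "(\<lambda>N. \<Sum>k\<in>{k. M * k \<le> N}. g N k) \<longlonglongrightarrow> A"
proof (rule tendsto_sandwich[where f = "\<lambda>N. \<Sum>k<(N - b) div (M + b). t k" and
      h = "\<lambda>N. \<Sum>k<Suc N. t k"])
  have km: "k \<le> M * k" for k using M by simp
  have sub: "{k. M * k \<le> N} \<subseteq> {..<Suc N}" for N
  proof
    fix k assume "k \<in> {k. M * k \<le> N}"
    then show "k \<in> {..<Suc N}" using le_trans[OF km[of k]] by (simp add: less_Suc_eq_le)
  qed
  have fin: "finite {k. M * k \<le> N}" for N using sub finite_subset by blast
  have S: "(\<lambda>n. \<Sum>k<n. t k) \<longlonglongrightarrow> A" using sums by (simp add: sums_def)
  show "(\<lambda>N. \<Sum>k<Suc N. t k) \<longlonglongrightarrow> A" using S by (rule LIMSEQ_Suc)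
  have "(\<Sum>k\<in>{k. M * k \<le> N}. g N k) \<le> (\<Sum>k<Suc N. t k)" for N
  proof -
    have "(\<Sum>k\<in>{k. M * k \<le> N}. g N k) \<le> (\<Sum>k\<in>{k. M * k \<le> N}. t k)" by (intro sum_mono g)
    also have "\<dots> \<le> (\<Sum>k<Suc N. t k)" using sub t by (intro sum_mono2) auto
    finally show ?thesis .
  qed
  then show "\<forall>\<^sub>F N in sequentially. (\<Sum>k\<in>{k. M * k \<le> N}. g N k) \<le> (\<Sum>k<Suc N. t k)" by simp
  let ?K = "\<lambda>N. (N - b) div (M + b)"
  have "filterlim ?K at_top sequentially"
    unfolding filterlim_at_top
  proof
    fix Z
    have "Z \<le> ?K N" if "N \<ge> Z * (M + b) + b" for N
      using that M by (simp add: less_eq_div_iff_mult_less_eq)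
    then show "\<forall>\<^sub>F N in sequentially. Z \<le> ?K N"
      unfolding eventually_sequentially by blast
  qed
  then show "(\<lambda>N. \<Sum>k<?K N. t k) \<longlonglongrightarrow> A" by (rule filterlim_compose[OF S])
  have "(\<Sum>k<?K N. t k) \<le> (\<Sum>k\<in>{k. M * k \<le> N}. g N k)" for N
  proof -
    have *: "M * k + b * (k + 1) \<le> N" if "k < ?K N" for k
    proof -
      have "Suc k * (M + b) \<le> N - b"
        using that M by (metis Suc_leI add_gr_0 less_eq_div_iff_mult_less_eq)
      then have "k * M + M + (k * b + b) \<le> N - b" by (simp add: algebra_simps)
      then show ?thesis using M by (simp add: algebra_simps)
    qed
    have "(\<Sum>k<?K N. t k) = (\<Sum>k<?K N. g N k)" using full[OF *] by simp
    also have "\<dots> \<le> (\<Sum>k\<in>{k. M * k \<le> N}. g N k)"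
      using * fin g(1) by (intro sum_mono2) (auto intro: add_leD1)
    finally show ?thesis .
  qed
  then show "\<forall>\<^sub>F N in sequentially. (\<Sum>k<?K N. t k) \<le> (\<Sum>k\<in>{k. M * k \<le> N}. g N k)" by simp
qed

text \<open>Dividing the path count by \<open>c ^ N\<close> turns the filler weight
  \<open>c ^ (N - M * k)\<close> into \<open>1 / c ^ (M * k)\<close>. The fixed cost
  \<open>L + 3\<close> only scales the limit.\<close>

theorem realize_components:
  fixes cs :: "component list" and v :: "component \<Rightarrow> real"
  assumes c: "c > 0" and M: "M > 0" and L: "L > 0"
    and good: "\<And>C. C \<in> set cs \<Longrightarrow> good_component C"
    and sums: "\<And>C. C \<in> set cs \<Longrightarrow> (\<lambda>k. comp_term C k / real c ^ (M * k)) sums v C"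
  shows "\<exists>f\<in>tile_counting_functions.
    (\<lambda>n. real (f n) / real c ^ n) \<longlonglongrightarrow> sum_list (map v cs) / real c ^ (L + 3)"
proof -
  define I where "I = length cs"
  define U where "U i = fst (cs ! i)" for i
  define V where "V i = fst (snd (cs ! i))" for i
  \<comment> \<open>The locale asks for additivity and a nonzero \<open>y\<close> at every index, so
    harmless values \<open>id\<close> and 1 are used beyond the list.\<close>
  define \<pi> where "\<pi> i = (if i < I then fst (snd (snd (cs ! i))) else id)" for i
  define a where "a i = fst (snd (snd (snd (cs ! i))))" for i
  define y where "y i = (if i < I then snd (snd (snd (snd (cs ! i)))) else 1)" for i
  have cs: "cs ! i = (U i, V i, \<pi> i, a i, y i)" if "i < I" for i
    using that by (simp add: U_def V_def \<pi>_def a_def y_def)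
  have good': "good_component (U i, V i, \<pi> i, a i, y i)" if "i < I" for i
    using good[of "cs ! i"] cs[OF that] that by (metis I_def nth_mem)
  interpret chain_components I U V \<pi> a y L M c
  proof
    show "\<pi> i (p + q) = \<pi> i p + \<pi> i q" for i p q
      using good'[of i] by (cases "i < I") (auto simp: \<pi>_def)
    show "y i \<noteq> 0" for i
      using good'[of i] by (cases "i < I") (auto simp: y_def)
  qed (use good' M L in auto)
  obtain f where f: "f \<in> tile_counting_functions"
    "\<And>n. f n = card {es. epath edges src tgt 0 es \<and> sum_list (map len es) = [:int n, 1:]}"
    using tile_count_of_polynomial_lengths[OF finite_edges, of len src tgt] len_pos by blast
  define g where "g i N k = lin (\<lambda>x. if closes i (N - M * k) x then 1 else 0) (U i * V i ^ k) / real c ^ (M * k)"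
    for i N k
  have f_eq: "real (f (N + L + 3)) / real c ^ N = (\<Sum>i<I. \<Sum>k\<in>{k. M * k \<le> N}. g i N k)" for N
  proof -
    have "real c ^ (N - M * k) * l / real c ^ N = l / real c ^ (M * k)" if "M * k \<le> N" for k l
    proof -
      have "real c ^ N = real c ^ (N - M * k) * real c ^ (M * k)"
        using that by (simp flip: power_add)
      then show ?thesis using c by simp
    qed
    then show ?thesis
      unfolding f(2) path_count[OF refl] sum_divide_distrib g_def
      by (intro sum.cong refl) simp
  qed
  have lim: "(\<lambda>N. \<Sum>k\<in>{k. M * k \<le> N}. g i N k) \<longlonglongrightarrow> v (cs ! i)" if i: "i < I" for i
  proof -
    obtain b where b: "\<And>k x s. x \<in> keys (U i * V i ^ k) \<Longrightarrow>
        closed_by (U i, V i, \<pi> i, a i, y i) x s \<Longrightarrow> s \<le> b * (k + 1)"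
      using good'[OF i] unfolding good_component.simps by metis
    have nn: "nonneg (U i * V i ^ k)" for k
      using U[OF i] V[OF i] by (intro nonneg_mult nonneg_power) auto
    show ?thesis
    proof (rule truncated_sum_tendsto)
      show "(\<lambda>k. comp_term (cs ! i) k / real c ^ (M * k)) sums v (cs ! i)"
        using sums i by (simp add: I_def)
      show "0 < M" by (rule M)
      show "0 \<le> comp_term (cs ! i) k / real c ^ (M * k)" for k
        unfolding cs[OF i] comp_term.simps using nn by (intro divide_nonneg_nonneg lin_nonneg) auto
      show "0 \<le> g i N k" for N k
        unfolding g_def using nn by (intro divide_nonneg_nonneg lin_nonneg) auto
      show "g i N k \<le> comp_term (cs ! i) k / real c ^ (M * k)" for N k
        unfolding g_def cs[OF i] comp_term.simps using nn
        by (intro divide_right_mono lin_mono) (auto simp: closes_def)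
      show "g i N k = comp_term (cs ! i) k / real c ^ (M * k)" if "M * k + b * (k + 1) \<le> N" for N k
      proof -
        have "closes i (N - M * k) x \<longleftrightarrow> (\<exists>s. closed_by (U i, V i, \<pi> i, a i, y i) x s)"
          if x: "x \<in> keys (U i * V i ^ k)" for x
        proof -
          have "s \<le> N - M * k" if "closed_by (U i, V i, \<pi> i, a i, y i) x s" for s
            using b[OF x that] \<open>M * k + b * (k + 1) \<le> N\<close> by linarith
          then show ?thesis by (auto simp: closes_def)
        qed
        then show ?thesis
          unfolding g_def cs[OF i] comp_term.simps by (intro arg_cong2[of _ _ _ _ "(/)"] lin_cong refl) simp
      qed
    qed
  qed
  have "(\<lambda>N. real (f (N + L + 3)) / real c ^ N) \<longlonglongrightarrow> (\<Sum>i<I. v (cs ! i))"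
    unfolding f_eq using lim by (intro tendsto_sum) auto
  then have "(\<lambda>N. real (f (N + L + 3)) / real c ^ N / real c ^ (L + 3)) \<longlonglongrightarrow>
      (\<Sum>i<I. v (cs ! i)) / real c ^ (L + 3)"
    by (intro tendsto_intros) (use c in auto)
  moreover have "(\<Sum>i<I. v (cs ! i)) = sum_list (map v cs)"
    by (simp add: I_def sum_list_sum_nth atLeast0LessThan)
  ultimately have "(\<lambda>N. real (f (N + (L + 3))) / real c ^ (N + (L + 3))) \<longlonglongrightarrow>
      sum_list (map v cs) / real c ^ (L + 3)"
    by (simp add: power_add add.assoc)
  then have "(\<lambda>n. real (f n) / real c ^ n) \<longlonglongrightarrow> sum_list (map v cs) / real c ^ (L + 3)"
    by (rule LIMSEQ_offset)
  then show ?thesis using f(1) by blast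
qed

text \<open>The compensating letters of a balanced component have a displacement in a degree of their own,
  so none of them can occur in a word of total displacement zero.\<close>

definition balanced :: "int poly gr \<Rightarrow> int poly gr \<Rightarrow> component" where
  "balanced U V = (U, V, pCons 0, 0, 1)"

text \<open>Displacements are forgotten, and the nonzero compensating displacement 1 admits only the
  empty compensation, so each word counts exactly once.\<close>

definition unrestricted :: "int poly gr \<Rightarrow> int poly gr \<Rightarrow> component" where
  "unrestricted U V = (U, V, \<lambda>_. 0, 0, 1)"

text \<open>Accepts the words whose displacement has its first nonzero coefficient in degree
  \<open>j\<close> and with sign \<sigma>, where \<open>js = (j, \<sigma>)\<close>. Higher degrees
  are cut off; offset and \<open>s\<close> loops together contribute
  \<open>- \<sigma> * (s + 1)\<close>, which cancels a coefficient of sign \<sigma> but never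
  0.\<close>

definition unbalanced :: "int poly gr \<Rightarrow> int poly gr \<Rightarrow> nat \<times> int \<Rightarrow> component" where
  "unbalanced U V js = (U, V, poly_cutoff (Suc (fst js)), monom (- snd js) (fst js), monom (- snd js) (fst js))"

lemma balanced_closed: "pCons 0 x + 0 + of_nat s * 1 = (0 :: int poly) \<longleftrightarrow> x = 0 \<and> s = 0"
proof -
  have "pCons 0 x + 0 + of_nat s * 1 = pCons (int s) x"
    by (simp add: of_nat_poly)
  then show ?thesis by auto
qed

lemma balanced_good:
  assumes "nonneg U" "integral_gr U" "nonneg V" "integral_gr V"
  shows "good_component (balanced U V)"
  using assms unfolding balanced_def good_component.simps closed_by.simps balanced_closed by auto

lemma balanced_term: "comp_term (balanced U V) k = lookup (U * V ^ k) 0"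
  unfolding balanced_def comp_term.simps closed_by.simps balanced_closed lookup_eq_lin by simp

lemma unrestricted_good:
  assumes "nonneg U" "integral_gr U" "nonneg V" "integral_gr V"
  shows "good_component (unrestricted U V)"
  using assms by (auto simp: unrestricted_def)

lemma unrestricted_term: "comp_term (unrestricted U V) k = mass (U * V ^ k)"
  by (auto simp: unrestricted_def mass_def intro!: lin_cong)

lemma unbalanced_closed:
  assumes "\<sigma> = 1 \<or> \<sigma> = - 1"
  shows "poly_cutoff (Suc j) x + monom (- \<sigma>) j + of_nat s * monom (- \<sigma>) j = 0 \<longleftrightarrow>
    (\<forall>i<j. coeff x i = 0) \<and> \<sigma> * coeff x j = int s + 1"
proof -
  have "monom (- \<sigma>) j + of_nat s * monom (- \<sigma>) j = monom (- \<sigma> * (int s + 1)) j"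
    by (simp add: of_nat_poly smult_monom add_monom algebra_simps)
  then have "poly_cutoff (Suc j) x + monom (- \<sigma>) j + of_nat s * monom (- \<sigma>) j = 0 \<longleftrightarrow>
      (\<forall>i. coeff (poly_cutoff (Suc j) x) i + (if j = i then - \<sigma> * (int s + 1) else 0) = 0)"
    by (simp only: add.assoc poly_eq_iff coeff_add coeff_monom coeff_0)
  also have "\<dots> \<longleftrightarrow> (\<forall>i<j. coeff x i = 0) \<and> coeff x j = \<sigma> * (int s + 1)"
    by (auto simp: coeff_poly_cutoff less_Suc_eq split: if_splits)
  also have "coeff x j = \<sigma> * (int s + 1) \<longleftrightarrow> \<sigma> * coeff x j = int s + 1"
    using assms by auto
  finally show ?thesis .
qed

lemma key_coeff_bound:
  assumes "\<And>x. x \<in> keys U \<Longrightarrow> \<bar>coeff x j\<bar> \<le> b" "\<And>x. x \<in> keys V \<Longrightarrow> \<bar>coeff x j\<bar> \<le> b"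
    "x \<in> keys (U * V ^ k)"
  shows "\<bar>coeff x j\<bar> \<le> (b :: int) * (int k + 1)"
  using assms(3)
proof (induction k arbitrary: x)
  case 0
  then show ?case using assms(1) by simp
next
  case (Suc k)
  then have "x \<in> keys ((U * V ^ k) * V)" by (simp add: mult_ac)
  then obtain p q where "p \<in> keys (U * V ^ k)" "q \<in> keys V" "x = p + q"
    using keys_mult by blast
  then show ?case
    using Suc.IH[of p] assms(2)[of q] by (simp add: algebra_simps)
qed

text \<open>The number of loops is bounded by the size of one coefficient, which grows at most
  linearly with the word length.\<close>

lemma unbalanced_good:
  assumes "nonneg U" "integral_gr U" "nonneg V" "integral_gr V" and \<sigma>: "\<sigma> = 1 \<or> \<sigma> = - 1"
  shows "good_component (unbalanced U V (j, \<sigma>))"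
proof -
  define b where "b = Max (insert 0 ((\<lambda>x. nat \<bar>coeff x j\<bar>) ` (keys U \<union> keys V)))"
  have b: "\<bar>coeff x j\<bar> \<le> int b" if "x \<in> keys U \<union> keys V" for x
  proof -
    have "nat \<bar>coeff x j\<bar> \<le> b" unfolding b_def using that by (intro Max_ge) auto
    then show ?thesis by simp
  qed
  have "s \<le> b * (k + 1)"
    if "x \<in> keys (U * V ^ k)" "closed_by (unbalanced U V (j, \<sigma>)) x s" for k x s
  proof -
    have "\<sigma> * coeff x j = int s + 1"
      using that(2) unbalanced_closed[OF \<sigma>] by (simp add: unbalanced_def)
    then have "int s \<le> \<bar>coeff x j\<bar>" using \<sigma> by auto
    also have "\<dots> \<le> int b * (int k + 1)"
      using that(1) b by (intro key_coeff_bound[of U j "int b" V]) auto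
    finally have "int s \<le> int (b * (k + 1))" by (simp only: of_nat_mult of_nat_add of_nat_1)
    then show ?thesis by (simp only: of_nat_le_iff)
  qed
  moreover have "poly_cutoff (Suc j) (p + q) = poly_cutoff (Suc j) p + poly_cutoff (Suc j) q"
    for p q :: "int poly"
    by (rule poly_eqI) (simp add: coeff_poly_cutoff)
  moreover have "monom (- \<sigma>) j \<noteq> 0" using \<sigma> by auto
  ultimately show ?thesis using assms(1-4) unfolding unbalanced_def by auto
qed

lemma unbalanced_term:
  assumes "\<sigma> = 1 \<or> \<sigma> = - 1"
  shows "comp_term (unbalanced U V (j, \<sigma>)) k =
    lin (\<lambda>x. if (\<forall>i<j. coeff x i = 0) \<and> \<sigma> * coeff x j > 0 then 1 else 0) (U * V ^ k)"
proof -
  have "(\<exists>s. \<sigma> * coeff x j = int s + 1) \<longleftrightarrow> \<sigma> * coeff x j > 0" for x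
  proof
    assume "\<sigma> * coeff x j > 0"
    then show "\<exists>s. \<sigma> * coeff x j = int s + 1"
      by (intro exI[of _ "nat (\<sigma> * coeff x j - 1)"]) simp
  qed auto
  then show ?thesis
    unfolding unbalanced_def comp_term.simps closed_by.simps fst_conv snd_conv unbalanced_closed[OF assms]
    by simp
qed

text \<open>A nonzero displacement has exactly one first nonzero coefficient, with exactly one sign,
  so it is accepted by exactly one of the components.\<close>

lemma sum_unbalanced_terms:
  assumes "\<And>x. x \<in> keys (U * V ^ k) \<Longrightarrow> \<forall>i\<ge>d. coeff x i = 0"
  shows "(\<Sum>js\<in>{..<d} \<times> {1, - 1}. comp_term (unbalanced U V js) k) =
    lin (\<lambda>x. if x \<noteq> 0 then 1 else 0) (U * V ^ k)"
proof -
  let ?P = "\<lambda>x js. (\<forall>i<fst js. coeff x i = 0) \<and> snd js * coeff x (fst js) > (0 :: int)"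
  have "(\<Sum>js\<in>{..<d} \<times> {1, - 1}. comp_term (unbalanced U V js) k) =
      (\<Sum>js\<in>{..<d} \<times> {1, - 1}. lin (\<lambda>x. if ?P x js then 1 else 0) (U * V ^ k))"
    by (intro sum.cong refl) (auto simp: unbalanced_term)
  also have "\<dots> = lin (\<lambda>x. \<Sum>js\<in>{..<d} \<times> {1, - 1}. if ?P x js then 1 else 0) (U * V ^ k)"
    by (simp add: lin_fun_sum)
  also have "\<dots> = lin (\<lambda>x. if x \<noteq> 0 then 1 else 0) (U * V ^ k)"
  proof (rule lin_cong)
    fix x assume "x \<in> keys (U * V ^ k)"
    then have x: "\<forall>i\<ge>d. coeff x i = 0" by (rule assms)
    show "(\<Sum>js\<in>{..<d} \<times> {1, - 1}. if ?P x js then 1 else 0) = (if x \<noteq> 0 then 1 else 0 :: real)"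
    proof (cases "x = 0")
      case False
      define j where "j = (LEAST i. coeff x i \<noteq> 0)"
      have "\<exists>i. coeff x i \<noteq> 0" using False by (auto simp: poly_eq_iff)
      then have j: "coeff x j \<noteq> 0" unfolding j_def by (rule LeastI_ex)
      have j': "coeff x i = 0" if "i < j" for i
        using not_less_Least that unfolding j_def by blast
      have "j < d" using j x not_le by blast
      have "?P x js \<longleftrightarrow> js = (j, sgn (coeff x j))" if "js \<in> {..<d} \<times> {1, - 1}" for js
      proof
        assume P: "?P x js"
        then have "\<not> j < fst js" using j by auto
        moreover have "\<not> fst js < j" using P j' by fastforce
        ultimately have "fst js = j" by simp
        then show "js = (j, sgn (coeff x j))" using P that by (auto simp: sgn_if)
      next
        assume "js = (j, sgn (coeff x j))"
        then show "?P x js" using j j' by (auto simp: sgn_if)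
      qed
      then have "(\<Sum>js\<in>{..<d} \<times> {1, - 1}. if ?P x js then 1 else 0) =
          (\<Sum>js\<in>{..<d} \<times> {1, - 1}. if js = (j, sgn (coeff x j)) then 1 else 0 :: real)"
        by (intro sum.cong refl) simp
      also have "\<dots> = 1" using \<open>j < d\<close> j by (simp add: sgn_if)
      finally show ?thesis using False by simp
    qed simp
  qed
  finally show ?thesis .
qed

section \<open>A regular summation method\<close>

text \<open>The Silverman-Toeplitz theorem for rows of probability weights: weight escapes from
  every fixed index, so only the tail of \<open>S\<close> matters.\<close>

lemma averages_tendsto:
  fixes w :: "nat \<Rightarrow> nat \<Rightarrow> real" and S :: "nat \<Rightarrow> real" and n :: "nat \<Rightarrow> nat"
  assumes S: "S \<longlonglongrightarrow> A" and w0: "\<And>K z. 0 \<le> w K z" and w1: "\<And>K. (\<Sum>z\<le>n K. w K z) = 1"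
    and lim: "\<And>z. (\<lambda>K. w K z) \<longlonglongrightarrow> 0"
  shows "(\<lambda>K. \<Sum>z\<le>n K. w K z * S z) \<longlonglongrightarrow> A"
proof (rule LIMSEQ_I)
  fix e :: real assume e: "e > 0"
  obtain Z where Z: "\<And>z. z \<ge> Z \<Longrightarrow> \<bar>S z - A\<bar> < e / 2"
    using LIMSEQ_D[OF S, of "e / 2"] e by auto
  have "(\<lambda>K. \<Sum>z<Z. w K z * \<bar>S z - A\<bar>) \<longlonglongrightarrow> (\<Sum>z<Z. 0 * \<bar>S z - A\<bar>)"
    by (intro tendsto_intros lim)
  then have "(\<lambda>K. \<Sum>z<Z. w K z * \<bar>S z - A\<bar>) \<longlonglongrightarrow> 0" by simp
  then obtain K0 where K0: "\<And>K. K \<ge> K0 \<Longrightarrow> \<bar>\<Sum>z<Z. w K z * \<bar>S z - A\<bar>\<bar> < e / 2"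
    using LIMSEQ_D[of _ 0 "e / 2"] e by fastforce
  have "\<bar>(\<Sum>z\<le>n K. w K z * S z) - A\<bar> < e" if K: "K \<ge> K0" for K
  proof -
    have "(\<Sum>z\<le>n K. w K z * S z) - A = (\<Sum>z\<le>n K. w K z * S z) - (\<Sum>z\<le>n K. w K z) * A"
      by (simp add: w1)
    also have "\<dots> = (\<Sum>z\<le>n K. w K z * (S z - A))"
      by (simp add: right_diff_distrib sum_subtractf sum_distrib_right)
    also have "\<bar>\<dots>\<bar> \<le> (\<Sum>z\<le>n K. \<bar>w K z * (S z - A)\<bar>)" by (rule sum_abs)
    also have "\<dots> \<le> (\<Sum>z\<le>n K. (if z < Z then w K z * \<bar>S z - A\<bar> else 0) + w K z * (e / 2))"
    proof (intro sum_mono)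
      fix z
      have "w K z * \<bar>S z - A\<bar> \<le> w K z * (e / 2)" if "\<not> z < Z"
        using Z[of z] that w0 by (intro mult_left_mono) auto
      then show "\<bar>w K z * (S z - A)\<bar> \<le> (if z < Z then w K z * \<bar>S z - A\<bar> else 0) + w K z * (e / 2)"
        using w0[of K z] e by (simp add: abs_mult)
    qed
    also have "\<dots> = (\<Sum>z\<in>{..n K} \<inter> {..<Z}. w K z * \<bar>S z - A\<bar>) + e / 2"
      unfolding sum.distrib sum_distrib_right[symmetric] w1
      by (simp add: sum.inter_restrict lessThan_def)
    also have "(\<Sum>z\<in>{..n K} \<inter> {..<Z}. w K z * \<bar>S z - A\<bar>) \<le> (\<Sum>z<Z. w K z * \<bar>S z - A\<bar>)"
      using w0 by (intro sum_mono2) auto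
    also have "\<dots> < e / 2" using K0[OF K] by linarith
    finally show ?thesis by simp
  qed
  then show "\<exists>N. \<forall>K\<ge>N. norm ((\<Sum>z\<le>n K. w K z * S z) - A) < e" by auto
qed

lemma coeff_power_nonneg:
  fixes h :: "real poly"
  assumes "\<And>i. 0 \<le> coeff h i"
  shows "0 \<le> coeff (h ^ K) i"
  by (induction K arbitrary: i) (auto simp: coeff_mult assms intro!: sum_nonneg mult_nonneg_nonneg)

text \<open>A single coefficient is bounded through the value at \<open>1 / 2\<close>, which decays
  geometrically.\<close>

lemma coeff_power_tendsto_0:
  fixes h :: "real poly"
  assumes h: "\<And>i. 0 \<le> coeff h i" and half: "poly h (1 / 2) < 1"
  shows "(\<lambda>K. coeff (h ^ K) z) \<longlonglongrightarrow> 0"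
proof (rule tendsto_sandwich)
  show "\<forall>\<^sub>F K in sequentially. 0 \<le> coeff (h ^ K) z"
    using coeff_power_nonneg[OF h] by simp
  have "coeff (h ^ K) z \<le> 2 ^ z * poly h (1 / 2) ^ K" for K
  proof -
    have "coeff (h ^ K) z * (1 / 2) ^ z \<le> (\<Sum>i\<le>degree (h ^ K). coeff (h ^ K) i * (1 / 2) ^ i)"
    proof (cases "z \<le> degree (h ^ K)")
      case True
      then show ?thesis
        using coeff_power_nonneg[OF h] by (intro member_le_sum) auto
    next
      case False
      then show ?thesis
        using coeff_power_nonneg[OF h] by (auto simp: coeff_eq_0 intro!: sum_nonneg)
    qed
    also have "\<dots> = poly h (1 / 2) ^ K" using poly_altdef[of "h ^ K" "1 / 2"] by simp
    finally show ?thesis by (simp add: power_divide field_simps)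
  qed
  then show "\<forall>\<^sub>F K in sequentially. coeff (h ^ K) z \<le> 2 ^ z * poly h (1 / 2) ^ K" by simp
  have "0 \<le> poly h (1 / 2)" using h by (auto simp: poly_altdef intro!: sum_nonneg)
  then show "(\<lambda>K. 2 ^ z * poly h (1 / 2) ^ K) \<longlonglongrightarrow> 0"
    using half by (intro tendsto_mult_right_zero LIMSEQ_power_zero) auto
qed (rule tendsto_const)

section \<open>Substituting a group ring element into a polynomial\<close>

definition subst_gr :: "'a::comm_monoid_add gr \<Rightarrow> real poly \<Rightarrow> 'a gr" where
  "subst_gr Y q = poly (map_poly (single 0) q) Y"

lemma subst_gr_0 [simp]: "subst_gr Y 0 = 0"
  by (simp add: subst_gr_def)

lemma subst_gr_pCons [simp]: "subst_gr Y (pCons a q) = single 0 a + Y * subst_gr Y q"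
  by (cases "a = 0 \<and> q = 0") (auto simp: subst_gr_def map_poly_pCons)

lemma subst_gr_add [simp]: "subst_gr Y (p + q) = subst_gr Y p + subst_gr Y q"
proof -
  have "map_poly (single (0 :: 'a)) (p + q) = map_poly (single 0) p + map_poly (single 0) q"
    by (rule poly_eqI) (simp add: coeff_map_poly single_add)
  then show ?thesis by (simp add: subst_gr_def)
qed

lemma subst_gr_smult [simp]: "subst_gr Y (smult a p) = single 0 a * subst_gr Y p"
  by (induction p) (auto simp: mult_single algebra_simps)

lemma subst_gr_mult [simp]: "subst_gr Y (p * q) = subst_gr Y p * subst_gr Y q"
  by (induction p) (auto simp: mult_pCons_left algebra_simps)

lemma subst_gr_one [simp]: "subst_gr Y 1 = 1"
  by (simp add: one_pCons)

lemma subst_gr_uminus [simp]: "subst_gr Y (- p) = - subst_gr Y p"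
  using subst_gr_add[of Y p "- p"] by (simp add: eq_neg_iff_add_eq_0 add.commute del: subst_gr_add)

lemma subst_gr_diff [simp]: "subst_gr Y (p - q) = subst_gr Y p - subst_gr Y q"
  using subst_gr_add[of Y p "- q"] by simp

lemma subst_gr_power [simp]: "subst_gr Y (p ^ n) = subst_gr Y p ^ n"
  by (induction n) auto

lemma subst_gr_sum: "subst_gr Y (sum p I) = (\<Sum>i\<in>I. subst_gr Y (p i))"
  by (induction I rule: infinite_finite_induct) auto

lemma lookup_single_0_mult:
  fixes P :: "'a::ab_group_add gr"
  shows "lookup (single 0 a * P) z = a * lookup P z"
  using lookup_times_single[of P 0 a z] by (simp add: mult.commute)

text \<open>Regularity of a summation method: if \<open>1 - h = (1 - y) g\<close> where the coefficients of \<open>h\<close> are a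
  probability distribution, then the \<open>K\<close>-th partial sum of \<open>g + g h + g h\<^sup>2 + \<dots>\<close>, expanded in powers of
  \<open>y\<close>, is the average of the partial sums of \<open>1 + y + y\<^sup>2 + \<dots>\<close> under the \<open>K\<close>-fold convolution of \<open>h\<close>.\<close>

lemma summation_method_regular:
  fixes Y :: "'a::ab_group_add gr" and g :: "real poly"
  defines "h \<equiv> 1 - [:1, - 1:] * g"
  assumes sums: "(\<lambda>m. lookup (Y ^ m) 0) sums A"
    and h0: "\<And>i. 0 \<le> coeff h i" and half: "poly h (1 / 2) < 1"
  shows "(\<lambda>k. lookup (subst_gr Y g * subst_gr Y h ^ k) 0) sums A"
proof -
  define S where "S z = (\<Sum>m<z. lookup (Y ^ m) 0)" for z
  have S: "S \<longlonglongrightarrow> A" using sums by (simp add: sums_def S_def[abs_def])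
  define w where "w K = coeff (h ^ K)" for K
  define n where "n K = degree (h ^ K)" for K
  have w1: "(\<Sum>z\<le>n K. w K z) = 1" for K
  proof -
    have "(\<Sum>z\<le>n K. w K z) = poly (h ^ K) 1" by (simp add: poly_altdef n_def w_def)
    then show ?thesis by (simp add: h_def)
  qed
  have "(\<Sum>k<K. lookup (subst_gr Y g * subst_gr Y h ^ k) 0) = (\<Sum>z\<le>n K. w K z * S z)" for K
  proof -
    let ?x = "[:0, 1:] :: real poly"
    define G where "G = g * (\<Sum>k<K. h ^ k)"
    have "[:1, - 1:] * g = 1 - h" by (simp add: h_def)
    \<comment> \<open>Compare after multiplying by \<open>1 - y\<close>: the left side telescopes to
      \<open>1 - h ^ K\<close>. Since the coefficients of \<open>h ^ K\<close> sum to 1, this is the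
      average of the \<open>1 - y ^ z\<close>, each of which is divisible by
      \<open>1 - y\<close>.\<close>
    then have "[:1, - 1:] * G = (1 - h) * (\<Sum>k<K. h ^ k)"
      by (simp only: G_def mult.assoc[symmetric])
    also have "\<dots> = 1 - h ^ K" by (rule one_diff_power_eq[symmetric])
    also have "h ^ K = (\<Sum>z\<le>n K. smult (w K z) (?x ^ z))"
      using poly_as_sum_of_monoms[of "h ^ K"] by (simp add: n_def w_def monom_altdef)
    also have "1 = (\<Sum>z\<le>n K. smult (w K z) 1)"
      unfolding w1 smult_1_left smult_sum[symmetric] ..
    also have "\<dots> - (\<Sum>z\<le>n K. smult (w K z) (?x ^ z)) = (\<Sum>z\<le>n K. smult (w K z) (1 - ?x ^ z))"
      by (simp add: sum_subtractf smult_diff_right)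
    also have "\<dots> = (\<Sum>z\<le>n K. smult (w K z) ((1 - ?x) * (\<Sum>m<z. ?x ^ m)))"
      by (simp only: one_diff_power_eq)
    also have "1 - ?x = [:1, - 1:]" by (simp add: one_pCons)
    also have "(\<Sum>z\<le>n K. smult (w K z) ([:1, - 1:] * (\<Sum>m<z. ?x ^ m))) =
        [:1, - 1:] * (\<Sum>z\<le>n K. smult (w K z) (\<Sum>m<z. ?x ^ m))"
      by (simp only: sum_distrib_left mult_smult_right)
    finally have G: "G = (\<Sum>z\<le>n K. smult (w K z) (\<Sum>m<z. ?x ^ m))"
      by (subst (asm) mult_left_cancel) auto
    have "(\<Sum>k<K. lookup (subst_gr Y g * subst_gr Y h ^ k) 0) = lookup (subst_gr Y G) 0"
      by (simp add: G_def subst_gr_sum sum_distrib_left lookup_sum)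
    also have "\<dots> = (\<Sum>z\<le>n K. w K z * S z)"
      by (simp add: G subst_gr_sum lookup_sum lookup_single_0_mult S_def)
    finally show ?thesis .
  qed
  moreover have "(\<lambda>K. \<Sum>z\<le>n K. w K z * S z) \<longlonglongrightarrow> A"
    using S _ w1 _
  proof (rule averages_tendsto)
    show "0 \<le> w K z" for K z using coeff_power_nonneg[OF h0] by (simp add: w_def)
    show "(\<lambda>K. w K z) \<longlonglongrightarrow> 0" for z
      using coeff_power_tendsto_0[OF h0 half] by (simp add: w_def)
  qed
  ultimately show ?thesis by (simp add: sums_def)
qed

section \<open>Realizing power series of constant terms\<close>

lemma single_0_power: "single (0 :: 'a::comm_monoid_add) a ^ k = single 0 (a ^ k)"
  by (induction k) (simp_all add: mult_single)

lemma scaled_power: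
  fixes P :: "'a::ab_group_add gr"
  shows "lookup ((single 0 a * P) ^ k) z = a ^ k * lookup (P ^ k) z"
  by (simp add: power_mult_distrib single_0_power lookup_single_0_mult)

theorem realize_nonneg_ratio:
  fixes \<Phi> :: "int poly gr" and c N :: nat and e A :: real
  assumes \<Phi>: "nonneg \<Phi>" "integral_gr \<Phi>" and c: "c > 0" and N: "N > 0"
    and e: "e \<ge> 0" "e \<in> \<int>"
    and sums: "(\<lambda>m. (e / real c ^ N) ^ m * lookup (\<Phi> ^ m) 0) sums A"
  shows "\<exists>f\<in>tile_counting_functions. (\<lambda>n. real (f n) / real c ^ n) \<longlonglongrightarrow> A"
proof -
  \<comment> \<open>The factor \<open>c ^ 4\<close> cancels the scaling \<open>c ^ (L + 3)\<close>
    for \<open>L = 1\<close>.\<close>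
  define U :: "int poly gr" where "U = single 0 (real c ^ 4)"
  define V where "V = single 0 e * \<Phi>"
  have U: "nonneg U" "integral_gr U"
    unfolding U_def by (intro nonneg_intros integral_gr_intros; simp)+
  have V: "nonneg V" "integral_gr V"
    unfolding V_def using \<Phi> e by (intro nonneg_mult integral_gr_mult nonneg_intros integral_gr_intros; simp)+
  have "comp_term (balanced U V) k / real c ^ (N * k) =
      real c ^ 4 * ((e / real c ^ N) ^ k * lookup (\<Phi> ^ k) 0)" for k
    by (simp add: balanced_term U_def V_def lookup_single_0_mult scaled_power power_mult power_divide)
  then have "(\<lambda>k. comp_term (balanced U V) k / real c ^ (N * k)) sums (real c ^ 4 * A)"
    using sums_mult[OF sums, of "real c ^ 4"] by simp
  then show ?thesis
    using realize_components[of c N 1 "[balanced U V]" "\<lambda>_. real c ^ 4 * A"]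
      balanced_good[OF U V] c N by simp
qed

lemma comp_term_bounds:
  assumes "good_component (U, V, \<pi>, a, y)"
  shows "0 \<le> comp_term (U, V, \<pi>, a, y) k" "comp_term (U, V, \<pi>, a, y) k \<le> mass U * mass V ^ k"
proof -
  have nn: "nonneg (U * V ^ k)"
    using assms by (auto intro: nonneg_mult nonneg_power)
  then show "0 \<le> comp_term (U, V, \<pi>, a, y) k"
    unfolding comp_term.simps by (intro lin_nonneg) auto
  have "comp_term (U, V, \<pi>, a, y) k \<le> mass (U * V ^ k)"
    unfolding comp_term.simps by (rule lin_le_mass[OF nn]) simp
  then show "comp_term (U, V, \<pi>, a, y) k \<le> mass U * mass V ^ k"
    by (simp only: mass_mult mass_power)
qed

lemma mass_nonneg: "nonneg P \<Longrightarrow> 0 \<le> mass P"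
  unfolding mass_def by (rule lin_nonneg) auto

lemma comp_term_summable:
  assumes good: "good_component C" and lt: "mass (fst (snd C)) < q"
  shows "summable (\<lambda>k. comp_term C k / q ^ k)"
proof -
  obtain U V \<pi> a y where C: "C = (U, V, \<pi>, a, y)" by (metis prod_cases5)
  have V: "0 \<le> mass V" using good C by (auto intro: mass_nonneg)
  have q: "mass V < q" "0 < q" using lt V C by auto
  have "summable (\<lambda>k. mass U * (mass V / q) ^ k)"
    using V q by (intro summable_mult summable_geometric) simp
  then show ?thesis
  proof (rule summable_comparison_test'[where N = 0])
    fix k
    have "comp_term C k / q ^ k \<le> mass U * mass V ^ k / q ^ k"
      using comp_term_bounds(2)[of U V \<pi> a y k] good C q by (intro divide_right_mono) auto
    moreover have "0 \<le> comp_term C k / q ^ k"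
      using comp_term_bounds(1)[of U V \<pi> a y k] good C q by simp
    ultimately show "norm (comp_term C k / q ^ k) \<le> mass U * (mass V / q) ^ k"
      by (simp add: power_divide)
  qed
qed

lemma sums_sum_list:
  fixes f :: "'b \<Rightarrow> nat \<Rightarrow> real"
  assumes "\<And>C. C \<in> set cs \<Longrightarrow> f C sums v C"
  shows "(\<lambda>k. sum_list (map (\<lambda>C. f C k) cs)) sums sum_list (map v cs)"
  using assms by (induction cs) (auto intro: sums_add)

lemma mass_split: "mass P = lookup P (0 :: int poly) + lin (\<lambda>x. if x \<noteq> 0 then 1 else 0) P"
proof -
  have "(\<lambda>x :: int poly. 1 :: real) = (\<lambda>x. (if x = 0 then 1 else 0) + (if x \<noteq> 0 then 1 else 0))"
    by auto
  then show ?thesis unfolding mass_def lookup_eq_lin lin_fun_add[symmetric] by simp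
qed

theorem realize_negative_ratio:
  fixes \<Phi> :: "int poly gr" and c N d :: nat and e A :: real
  assumes \<Phi>: "nonneg \<Phi>" "integral_gr \<Phi>" and c: "c \<ge> 2"
    and e: "e > 0" "e \<in> \<int>" and ratio: "e * mass \<Phi> \<le> real c ^ N"
    and \<Phi>0: "lookup \<Phi> 0 > 0"
    and deg: "\<And>x i. x \<in> keys \<Phi> \<Longrightarrow> i \<ge> d \<Longrightarrow> coeff x i = 0"
    and sums: "(\<lambda>m. (- (e / real c ^ N)) ^ m * lookup (\<Phi> ^ m) 0) sums A" and A: "A > 0"
  shows "\<exists>f\<in>tile_counting_functions. (\<lambda>n. real (f n) / real c ^ n) \<longlonglongrightarrow> A"
proof -
  \<comment> \<open>All quantities are cleared of the denominator \<open>c ^ N\<close>: with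
    \<open>Y = - (e / C) \<Phi>\<close> one has \<open>C (1 - Y) = Q + B\<close>.\<close>
  define C where "C = real c ^ N"
  define \<kappa> where "\<kappa> = e * lookup \<Phi> 0"
  define Q where "Q = C + \<kappa>"
  define B where "B = single 0 e * (\<Phi> - single 0 (lookup \<Phi> 0))"
  have C: "C > 0" using c by (simp add: C_def)
  have \<kappa>: "\<kappa> > 0" using e \<Phi>0 by (simp add: \<kappa>_def)
  have int: "C \<in> \<int>" "\<kappa> \<in> \<int>" "Q \<in> \<int>"
    using e \<Phi>(2) by (auto simp: C_def \<kappa>_def Q_def integral_gr_def)
  \<comment> \<open>\<open>q = c ^ M\<close> has to exceed \<open>Q\<^sup>2\<close> for
    \<open>H\<close> to be nonnegative. The extra \<open>N + 4\<close> in \<open>M\<close> keeps the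
    final \<open>L\<close> positive.\<close>
  obtain M0 where "Q\<^sup>2 < real c ^ M0" using real_arch_pow[of "real c" "Q\<^sup>2"] c by auto
  moreover define M where "M = M0 + N + 4"
  moreover have "real c ^ M0 \<le> real c ^ (M0 + N + 4)"
    using c by (intro power_increasing) auto
  ultimately have QM: "Q\<^sup>2 < real c ^ M" and MN: "M \<ge> N + 4" "M > 0" by auto
  define q where "q = real c ^ M"
  have q: "q > 0" "Q\<^sup>2 < q" "q \<in> \<int>" using c QM by (auto simp: q_def)
  define H where "H = single 0 (q - Q\<^sup>2) + B * B"
  define B1 where "B1 = mass B"
  define H1 where "H1 = mass H"
  have Beq: "B = single 0 e * \<Phi> - single 0 \<kappa>"
    by (simp add: B_def \<kappa>_def right_diff_distrib mult_single)
  have Bnn: "nonneg B"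
    unfolding nonneg_def B_def lookup_single_0_mult
    using \<Phi>(1) e(1) by (auto simp: lookup_minus lookup_single when_def nonneg_def)
  have Bint: "integral_gr B"
    unfolding B_def using \<Phi>(2) e(2)
    by (intro integral_gr_mult integral_gr_intros) (auto simp: integral_gr_def)
  have Hnn: "nonneg H" unfolding H_def using Bnn q by (intro nonneg_intros nonneg_mult) auto
  have Hint: "integral_gr H"
    unfolding H_def using Bint q int by (intro integral_gr_intros integral_gr_mult) auto
  have B1: "B1 = e * mass \<Phi> - \<kappa>" by (simp add: B1_def Beq)
  have B1nn: "B1 \<ge> 0" unfolding B1_def by (rule mass_nonneg[OF Bnn])
  have B1Q: "B1 < Q" using ratio \<kappa> B1 by (simp add: Q_def C_def)
  have mass_int: "mass P \<in> \<int>" if "integral_gr P" for P :: "int poly gr"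
    unfolding mass_def lin_def using that by (auto simp: integral_gr_def intro!: Ints_sum)
  have B1int: "B1 \<in> \<int>" and H1int: "H1 \<in> \<int>"
    unfolding B1_def H1_def using Bint Hint by (auto intro: mass_int)
  have H1: "q - H1 = Q\<^sup>2 - B1\<^sup>2" by (simp add: H1_def H_def B1_def power2_eq_square)
  have H1nn: "H1 \<ge> 0" unfolding H1_def by (rule mass_nonneg[OF Hnn])
  \<comment> \<open>The difference is a positive integer. The bound 1, rather than mere positivity,
    makes \<open>F\<close> nonnegative below.\<close>
  have gap: "q - H1 \<ge> 1"
  proof -
    have "0 < q - H1" unfolding H1 using B1nn B1Q by (simp add: power_strict_mono)
    moreover have "q - H1 \<in> \<int>" using q H1int by auto
    ultimately show ?thesis by (auto elim!: Ints_cases)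
  qed
  have H1q: "H1 < q" using gap by simp
  \<comment> \<open>The terms of \<open>q / (Q + B) = q (Q - B) / (q - H)\<close>, expanded as a
    geometric series in \<open>H / q\<close>; formally this is \<open>q / C\<close> times
    \<open>1 / (1 - Y)\<close>.\<close>
  define t where "t k = lookup ((single 0 Q - B) * H ^ k) 0 / q ^ k" for k
  define A' where "A' = A * q / C"
  have t_sums: "t sums A'"
  proof -
    define Y where "Y = single 0 (- (e / C)) * \<Phi>"
    \<comment> \<open>As a polynomial in \<open>Y\<close>, \<open>Q - B\<close> is
      \<open>C + 2 * \<kappa> + C * Y\<close>. The factor \<open>C / q\<close> is chosen such that
      \<open>(1 - Y) g = (Q\<^sup>2 - B\<^sup>2) / q\<close>, that is, \<open>h\<close> becomes
      \<open>H / q\<close>.\<close>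
    define g where "g = smult (C / q) [:C + 2 * \<kappa>, C:]"
    define h where "h = 1 - [:1, - 1:] * g"
    have CY: "single 0 C * Y = - (single 0 e * \<Phi>)"
      using C by (simp add: Y_def mult_single single_uminus flip: mult.assoc)
    have "subst_gr Y [:C + 2 * \<kappa>, C:] = single 0 (C + 2 * \<kappa>) + single 0 C * Y"
      by (simp add: mult.commute)
    also have "\<dots> = single 0 Q - B"
      unfolding CY Beq Q_def by (simp add: single_add[symmetric] algebra_simps)
    finally have g: "subst_gr Y g = single 0 (C / q) * (single 0 Q - B)"
      unfolding g_def subst_gr_smult by simp
    have "subst_gr Y h = 1 - (1 - Y) * (single 0 (C / q) * (single 0 Q - B))"
      by (simp add: h_def g algebra_simps)
    also have "\<dots> = single 0 (1 / q) * (single 0 q - (single 0 C - single 0 C * Y) * (single 0 Q - B))"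
    proof -
      have s1: "(1 :: int poly gr) = single 0 (1 / q) * single 0 q" using q(1) by (simp add: mult_single)
      have s2: "single 0 (C / q) = single 0 (1 / q) * single (0 :: int poly) C" by (simp add: mult_single)
      show ?thesis unfolding s2 by (subst s1) (simp add: algebra_simps)
    qed
    also have "single 0 C - single 0 C * Y = single 0 Q + B"
      unfolding CY Beq Q_def by (simp add: single_add algebra_simps)
    also have "single 0 q - (single 0 Q + B) * (single 0 Q - B) = H"
    proof -
      have "single 0 (Q\<^sup>2) = single 0 Q * single (0 :: int poly) Q"
        by (simp add: mult_single power2_eq_square)
      then show ?thesis unfolding H_def single_diff by (simp add: algebra_simps)
    qed
    finally have h: "subst_gr Y h = single 0 (1 / q) * H" .
    have "(\<lambda>m. lookup (Y ^ m) 0) sums A"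
      using sums by (simp add: Y_def scaled_power C_def)
    moreover have "0 \<le> coeff h i" for i
    proof -
      have "h = [:1 - C / q * (C + 2 * \<kappa>), C / q * (2 * \<kappa>), C / q * C:]"
        by (simp add: h_def g_def one_pCons algebra_simps)
      \<comment> \<open>Since \<open>q\<close> exceeds
        \<open>Q\<^sup>2 = C * (C + 2 * \<kappa>) + \<kappa>\<^sup>2\<close>, the constant
        coefficient of \<open>h\<close> is nonnegative.\<close>
      moreover have "C / q * (C + 2 * \<kappa>) \<le> 1"
      proof -
        have "C * (C + 2 * \<kappa>) \<le> Q\<^sup>2" by (simp add: Q_def power2_eq_square algebra_simps)
        then show ?thesis using q by simp
      qed
      ultimately show ?thesis using C \<kappa> q
        by (auto simp: coeff_pCons split: nat.splits)
    qed
    moreover have "poly h (1 / 2) < 1"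
    proof -
      have "0 < poly g (1 / 2)" using C \<kappa> q by (simp add: g_def add_pos_pos)
      then show ?thesis by (simp add: h_def)
    qed
    ultimately have "(\<lambda>k. lookup (subst_gr Y g * subst_gr Y h ^ k) 0) sums A"
      unfolding h_def by (intro summation_method_regular)
    moreover have "lookup (subst_gr Y g * subst_gr Y h ^ k) 0 = C / q * t k" for k
    proof -
      have "subst_gr Y g * subst_gr Y h ^ k =
          single 0 (C / q) * (single 0 ((1 / q) ^ k) * ((single 0 Q - B) * H ^ k))"
        unfolding g h power_mult_distrib single_0_power by (simp only: mult_ac)
      then show ?thesis
        by (simp only: lookup_single_0_mult) (simp add: t_def power_one_over)
    qed
    ultimately have "(\<lambda>k. C / q * t k) sums A" by simp
    then have "(\<lambda>k. q / C * (C / q * t k)) sums (q / C * A)" by (rule sums_mult)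
    then show ?thesis using C q by (simp add: A'_def mult_ac)
  qed
  have A': "A' > 0" using A C q by (simp add: A'_def)
  \<comment> \<open>The subtracted quantity, up to the factor \<open>q ^ J\<close>, is the total
    surplus mass to be counted from index \<open>J\<close> on. It tends to 0, whereas the partial
    sums tend to the positive \<open>A'\<close>.\<close>
  have "(\<lambda>J. (\<Sum>k<J. t k) - B1 * q * (H1 / q) ^ J) \<longlonglongrightarrow> A' - B1 * q * 0"
    using t_sums H1nn H1q q unfolding sums_def
    by (intro tendsto_intros LIMSEQ_power_zero) auto
  then have "\<forall>\<^sub>F J in sequentially. 0 < (\<Sum>k<J. t k) - B1 * q * (H1 / q) ^ J"
    using A' by (intro order_tendstoD(1)[of _ A']) auto
  then obtain J where J: "0 < (\<Sum>k<J. t k) - B1 * q * (H1 / q) ^ J"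
    by (auto simp: eventually_sequentially)
  \<comment> \<open>The first \<open>J\<close> terms minus the later surplus, cleared of
    denominators: a positive integer, used as a constant component.\<close>
  define hJ where "hJ = q ^ J * ((\<Sum>k<J. t k) - B1 * q * (H1 / q) ^ J)"
  have hJpos: "hJ > 0" using J q by (simp add: hJ_def)
  have hJint: "hJ \<in> \<int>"
  proof -
    have "q ^ J * t k \<in> \<int>" if "k < J" for k
    proof -
      have "q ^ J = q ^ (J - k) * q ^ k" using that by (simp flip: power_add)
      then have "q ^ J * t k = q ^ (J - k) * lookup ((single 0 Q - B) * H ^ k) 0"
        using q by (simp add: t_def)
      moreover have "integral_gr ((single 0 Q - B) * H ^ k)"
        using Bint Hint int by (intro integral_gr_mult integral_gr_power integral_gr_intros)
      ultimately show ?thesis using q by (simp add: integral_gr_def)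
    qed
    then have "(\<Sum>k<J. q ^ J * t k) \<in> \<int>" by (intro Ints_sum) auto
    moreover have "hJ = (\<Sum>k<J. q ^ J * t k) - B1 * q * H1 ^ J"
      using q by (simp add: hJ_def right_diff_distrib sum_distrib_left power_divide)
    ultimately show ?thesis
      using B1int H1int q(3) by (auto intro!: Ints_diff Ints_mult Ints_power)
  qed
  \<comment> \<open>Counting nonzero displacements yields \<open>- lookup (B * H ^ n) 0\<close> with
    surplus \<open>B1 * H1 ^ n\<close>. Adding \<open>F\<close> of it gives
    \<open>B1 * (q - H1) * H1 ^ n\<close>, whose geometric series from \<open>J\<close> on has the
    integral value \<open>B1 * q * H1 ^ J\<close> after scaling by \<open>q ^ J\<close>.\<close>
  define F where "F = B1 * (q - H1) - B1"
  have F: "F \<ge> 0" "F \<in> \<int>"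
    using gap B1nn B1int H1int q by (auto simp: F_def mult_le_cancel_left1)
  define ps where "ps = List.product [0..<d] [1, - 1 :: int]"
  \<comment> \<open>In order: the initial terms, the contribution of \<open>Q\<close>, the surplus
    \<open>F\<close>, and the nonzero displacements for \<open>- B\<close>. In the first component
    \<open>0 ^ k\<close> is 1 for \<open>k = 0\<close> only, so it contributes once.\<close>
  define cs where "cs = [balanced (single 0 hJ) 0, balanced (single 0 Q * H ^ J) H,
      unrestricted (single 0 F * H ^ J) H] @ map (unbalanced (B * H ^ J) H) ps"
  define v where "v Co = suminf (\<lambda>k. comp_term Co k / q ^ k)" for Co
  have Qnn: "Q \<ge> 0" using C \<kappa> by (simp add: Q_def)
  have good: "good_component Co \<and> mass (fst (snd Co)) < q" if "Co \<in> set cs" for Co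
  proof -
    have "good_component (balanced (single 0 hJ) 0)"
      using hJpos hJint by (intro balanced_good nonneg_intros integral_gr_intros) auto
    moreover have "good_component (balanced (single 0 Q * H ^ J) H)"
      using Qnn int Hnn Hint
      by (intro balanced_good nonneg_mult nonneg_power integral_gr_mult integral_gr_power
        nonneg_intros integral_gr_intros)
    moreover have "good_component (unrestricted (single 0 F * H ^ J) H)"
      using F Hnn Hint
      by (intro unrestricted_good nonneg_mult nonneg_power integral_gr_mult integral_gr_power
        nonneg_intros integral_gr_intros)
    moreover have "good_component (unbalanced (B * H ^ J) H (j, \<sigma>))" if "\<sigma> = 1 \<or> \<sigma> = - 1" for j \<sigma>
      using that Bnn Bint Hnn Hint
      by (intro unbalanced_good nonneg_mult nonneg_power integral_gr_mult integral_gr_power) auto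
    moreover have "Co = balanced (single 0 hJ) 0 \<or> Co = balanced (single 0 Q * H ^ J) H \<or>
        Co = unrestricted (single 0 F * H ^ J) H \<or>
        (\<exists>j \<sigma>. (\<sigma> = 1 \<or> \<sigma> = - 1) \<and> Co = unbalanced (B * H ^ J) H (j, \<sigma>))"
      using that by (auto simp: cs_def ps_def)
    ultimately have "good_component Co" by blast
    moreover have "fst (snd Co) = 0 \<or> fst (snd Co) = H"
      using that by (auto simp: cs_def balanced_def unrestricted_def unbalanced_def)
    then have "mass (fst (snd Co)) < q" using H1q q by (auto simp: H1_def)
    ultimately show ?thesis by blast
  qed
  have v_sums: "(\<lambda>k. comp_term Co k / q ^ k) sums v Co" if "Co \<in> set cs" for Co
    unfolding v_def using good[OF that] comp_term_summable by (intro summable_sums) blast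
  have "sum_list (map v cs) = q ^ J * A'"
  proof (rule sums_unique2)
    show "(\<lambda>k. sum_list (map (\<lambda>Co. comp_term Co k / q ^ k) cs)) sums sum_list (map v cs)"
      using v_sums by (rule sums_sum_list)
    have "(\<lambda>k. (if k = 0 then hJ else 0) + q ^ J * t (k + J) +
        B1 * (q - H1) * H1 ^ J * (H1 / q) ^ k) sums
        (hJ + q ^ J * (A' - (\<Sum>k<J. t k)) + B1 * (q - H1) * H1 ^ J * (1 / (1 - H1 / q)))"
      using H1nn H1q q
      by (intro sums_add sums_mult sums_single[of 0 "\<lambda>_. hJ"] geometric_sums
        sums_split_initial_segment[OF t_sums]) auto
    moreover have "hJ + q ^ J * (A' - (\<Sum>k<J. t k)) + B1 * (q - H1) * H1 ^ J * (1 / (1 - H1 / q)) =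
        q ^ J * A'"
    proof -
      have "(q - H1) * (1 / (1 - H1 / q)) = q" using H1q q by (simp add: divide_simps)
      then have "B1 * (q - H1) * H1 ^ J * (1 / (1 - H1 / q)) = B1 * H1 ^ J * q"
        by (metis (no_types, lifting) mult.assoc mult.commute)
      moreover have "hJ = q ^ J * (\<Sum>k<J. t k) - B1 * H1 ^ J * q"
        using q by (simp add: hJ_def power_divide right_diff_distrib)
      ultimately show ?thesis by (simp add: algebra_simps)
    qed
    moreover have "sum_list (map (\<lambda>Co. comp_term Co k / q ^ k) cs) =
        (if k = 0 then hJ else 0) + q ^ J * t (k + J) + B1 * (q - H1) * H1 ^ J * (H1 / q) ^ k" for k
    proof -
      \<comment> \<open>All displacements live in the degrees below \<open>d\<close>, so the finite
        list \<open>ps\<close> catches every nonzero one.\<close>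
      let ?W = "{x :: int poly. \<forall>i\<ge>d. coeff x i = 0}"
      have W: "keys \<Phi> \<subseteq> ?W" using deg by auto
      have KB: "keys B \<subseteq> ?W"
      proof
        fix x assume "x \<in> keys B"
        then have "x \<in> keys \<Phi> \<or> x = 0"
          by (auto simp: in_keys_iff B_def lookup_single_0_mult lookup_minus lookup_single when_def split: if_splits)
        then show "x \<in> ?W" using W by auto
      qed
      have "keys (B * B) \<subseteq> ?W" by (rule keys_mult_subset[OF KB KB]) auto
      then have BB: "insert 0 (keys (B * B)) \<subseteq> ?W" by simp
      have "keys H \<subseteq> insert 0 (keys (B * B))"
        unfolding H_def using Poly_Mapping.keys_add[of "single 0 (q - Q\<^sup>2)" "B * B"]
        by (auto simp del: Poly_Mapping.keys_eq_empty split: if_splits)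
      then have KH: "keys H \<subseteq> ?W" using BB by (rule subset_trans)
      have KHn: "keys (H ^ n) \<subseteq> ?W" for n by (rule keys_power_subset[OF KH]) auto
      have "keys (B * H ^ J) \<subseteq> ?W" by (rule keys_mult_subset[OF KB KHn]) auto
      then have K: "keys (B * H ^ J * H ^ k) \<subseteq> ?W" by (rule keys_mult_subset[OF _ KHn]) auto
      have "set ps = {..<d} \<times> {1, - 1}" "distinct ps"
        by (auto simp: ps_def distinct_product)
      then have "sum_list (map (\<lambda>js. comp_term (unbalanced (B * H ^ J) H js) k) ps) =
          (\<Sum>js\<in>{..<d} \<times> {1, - 1}. comp_term (unbalanced (B * H ^ J) H js) k)"
        by (simp add: sum_list_distinct_conv_sum_set)
      also have "\<dots> = lin (\<lambda>x. if x \<noteq> 0 then 1 else 0) (B * H ^ J * H ^ k)"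
        using K by (intro sum_unbalanced_terms) auto
      also have "\<dots> = B1 * H1 ^ (J + k) - lookup (B * H ^ J * H ^ k) 0"
        using mass_split[of "B * H ^ J * H ^ k"] by (simp add: B1_def H1_def power_add)
      finally have unb: "sum_list (map (\<lambda>js. comp_term (unbalanced (B * H ^ J) H js) k) ps) =
          B1 * H1 ^ (J + k) - lookup (B * H ^ (J + k)) 0"
        by (simp add: power_add mult.assoc)
      have bal: "comp_term (balanced (single 0 Q * H ^ J) H) k = lookup (single 0 Q * H ^ (J + k)) 0"
        by (simp add: balanced_term power_add mult.assoc)
      have unr: "comp_term (unrestricted (single 0 F * H ^ J) H) k = F * H1 ^ (J + k)"
        by (simp add: unrestricted_term H1_def power_add)
      have cons: "comp_term (balanced (single 0 hJ) 0) k = (if k = 0 then hJ else 0)"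
        by (simp add: balanced_term power_0_left)
      have "sum_list (map (\<lambda>Co. comp_term Co k / q ^ k) cs) =
          sum_list (map (\<lambda>Co. comp_term Co k) cs) / q ^ k"
        by (simp add: divide_inverse sum_list_mult_const)
      also have "sum_list (map (\<lambda>Co. comp_term Co k) cs) =
          (if k = 0 then hJ else 0) + lookup (single 0 Q * H ^ (J + k)) 0 + F * H1 ^ (J + k) +
          (B1 * H1 ^ (J + k) - lookup (B * H ^ (J + k)) 0)"
        unfolding cs_def using unb by (simp add: bal unr cons comp_def)
      also have "\<dots> = (if k = 0 then hJ else 0) +
          lookup ((single 0 Q - B) * H ^ (J + k)) 0 + B1 * (q - H1) * H1 ^ (J + k)"
        by (simp add: F_def left_diff_distrib lookup_minus)
      also have "\<dots> / q ^ k = (if k = 0 then hJ else 0) + q ^ J * t (k + J) +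
          B1 * (q - H1) * H1 ^ J * (H1 / q) ^ k"
        using q by (simp add: t_def add_divide_distrib power_add power_divide add.commute[of J])
      finally show ?thesis .
    qed
    ultimately show "(\<lambda>k. sum_list (map (\<lambda>Co. comp_term Co k / q ^ k) cs)) sums (q ^ J * A')"
      by simp
  qed
  \<comment> \<open>Chosen so that \<open>c ^ (L + 3) = q ^ J * q / C\<close>, which turns the sum
    \<open>q ^ J * A'\<close> into exactly \<open>A * c ^ (L + 3)\<close>.\<close>
  moreover define L where "L = M + M * J - N - 3"
  have L: "L > 0" "L + 3 + N = M + M * J" using MN by (auto simp: L_def)
  have "q ^ J * A' = A * real c ^ (L + 3)"
  proof -
    have "real c ^ (L + 3) * C = q ^ J * q"
      unfolding C_def q_def power_add[symmetric] L(2) by (simp add: power_add power_mult)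
    then have "real c ^ (L + 3) = q ^ J * q / C" using C by (simp add: eq_divide_eq)
    then show ?thesis by (simp add: A'_def)
  qed
  moreover have "\<exists>f\<in>tile_counting_functions.
      (\<lambda>n. real (f n) / real c ^ n) \<longlonglongrightarrow> sum_list (map v cs) / real c ^ (L + 3)"
  proof (rule realize_components)
    show "(\<lambda>k. comp_term Co k / real c ^ (M * k)) sums v Co" if "Co \<in> set cs" for Co
      using v_sums[OF that] by (simp add: q_def power_mult)
  qed (use c MN L good in auto)
  ultimately show ?thesis using c by simp
qed

section \<open>Hypergeometric terms\<close>

lemma fact_add: "fact (n + k) = (fact n :: real) * (\<Prod>i=1..k. real n + real i)"
proof (induction k)
  case (Suc k)
  have "fact (n + Suc k) = (real n + real (Suc k)) * fact (n + k)" by (simp add: add.assoc)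
  then show ?case using Suc by simp
qed simp

text \<open>The factor \<open>F(l, x)\<close> of the overview; the empty product 1 for
  \<open>l = 0\<close>.\<close>

definition shifted_prod :: "nat \<Rightarrow> real \<Rightarrow> real" where
  "shifted_prod l x = (\<Prod>i=1..l. x + real i / real l)"

lemma shifted_prod_nat:
  assumes "l > 0"
  shows "shifted_prod l (real m) = fact (l * Suc m) / (fact (l * m) * real l ^ l)"
proof -
  have "(\<Prod>i=1..l. real (l * m) + real i) = (\<Prod>i=1..l. real l * (real m + real i / real l))"
    using assms by (intro prod.cong refl) (simp add: field_simps)
  also have "\<dots> = real l ^ l * shifted_prod l (real m)"
    by (simp add: shifted_prod_def prod.distrib)
  finally have "fact (l * m + l) = fact (l * m) * (real l ^ l * shifted_prod l (real m))"
    by (simp only: fact_add)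
  then show ?thesis using assms by (simp add: field_simps)
qed

lemma prod_shifted_prod:
  assumes "l > 0"
  shows "(\<Prod>j<m. shifted_prod l (real j)) = fact (l * m) / real l ^ (l * m)"
  using assms by (induction m) (auto simp: shifted_prod_nat power_add field_simps)

lemma Upsilon_prod: "(\<Prod>a\<in>#Upsilon la. x + a) = (\<Prod>l\<in>#la. shifted_prod l x)"
proof (induction la)
  case empty
  then show ?case by (simp add: Upsilon_def)
next
  case (add l la)
  have "Upsilon (add_mset l la) = image_mset (\<lambda>j. real j / real l) (mset_set {1..l}) + Upsilon la"
    by (simp add: Upsilon_def)
  moreover have "(\<Prod>i\<in>#mset_set {1..l}. x + real i / real l) = shifted_prod l x"
    unfolding shifted_prod_def by (rule prod_unfold_prod_mset[symmetric])
  ultimately show ?case using add by (simp add: multiset.map_comp comp_def)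
qed

lemma size_Upsilon: "size (Upsilon la) = \<Sum>\<^sub># la"
  by (induction la) (auto simp: Upsilon_def)

definition fact_prod :: "nat multiset \<Rightarrow> nat \<Rightarrow> real" where
  "fact_prod la m = (\<Prod>l\<in>#la. fact (l * m) / real l ^ (l * m))"

lemma fact_prod_pos:
  assumes "0 \<notin># la"
  shows "fact_prod la m > 0"
  using assms by (induction la) (auto simp: fact_prod_def)

lemma prod_Upsilon:
  assumes "0 \<notin># la"
  shows "(\<Prod>j<m. \<Prod>a\<in>#Upsilon la. real j + a) = fact_prod la m"
  unfolding Upsilon_prod using assms
  by (induction la) (auto simp: fact_prod_def prod.distrib prod_shifted_prod)

lemma hypergeom_term_eq:
  assumes "0 \<notin># mu" "0 \<notin># nu"
  shows "hypergeom_term (Upsilon mu) (Upsilon nu) r m = r ^ m * (fact_prod mu m / fact_prod nu m)"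
  unfolding hypergeom_term_def prod_dividef prod.distrib prod_Upsilon[OF assms(1)] prod_Upsilon[OF assms(2)]
  by simp

section \<open>Ratios of consecutive terms: limit and monotonicity\<close>

lemma prod_mset_shift_ratio:
  fixes as :: "real multiset"
  shows "(\<lambda>m. (\<Prod>a\<in>#as. real m + a) / (real m + 1) ^ size as) \<longlonglongrightarrow> 1"
proof (induction as)
  case (add a as)
  have "(\<lambda>m. (real m + a) / (real m + 1)) \<longlonglongrightarrow> 1"
    by real_asymp
  from tendsto_mult[OF this add] show ?case
    by (simp add: field_simps)
qed simp

lemma fact_prod_Suc:
  assumes "0 \<notin># la"
  shows "fact_prod la (Suc m) = fact_prod la m * (\<Prod>a\<in>#Upsilon la. real m + a)"
  using prod_Upsilon[OF assms, of "Suc m"] prod_Upsilon[OF assms, of m] by simp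

text \<open>Numerator and denominator consist of equally many factors, each asymptotic to
  \<open>m\<close>. The consecutive ratio of the hypergeometric terms therefore tends to
  \<open>r\<close>.\<close>

lemma fact_prod_ratio_tendsto:
  assumes "0 \<notin># mu" "0 \<notin># nu" "\<Sum>\<^sub># mu = \<Sum>\<^sub># nu"
  shows "(\<lambda>m. (fact_prod mu (Suc m) / fact_prod nu (Suc m)) / (fact_prod mu m / fact_prod nu m)) \<longlonglongrightarrow> 1"
proof -
  have "(\<lambda>m. ((\<Prod>a\<in>#Upsilon mu. real m + a) / (real m + 1) ^ size (Upsilon mu)) /
      ((\<Prod>a\<in>#Upsilon nu. real m + a) / (real m + 1) ^ size (Upsilon nu))) \<longlonglongrightarrow> 1 / 1"
    by (intro tendsto_divide prod_mset_shift_ratio) simp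
  moreover have "((\<Prod>a\<in>#Upsilon mu. real m + a) / (real m + 1) ^ size (Upsilon mu)) /
      ((\<Prod>a\<in>#Upsilon nu. real m + a) / (real m + 1) ^ size (Upsilon nu)) =
      (fact_prod mu (Suc m) / fact_prod nu (Suc m)) / (fact_prod mu m / fact_prod nu m)" for m
  proof -
    have "real m + 1 \<noteq> 0" by simp
    then show ?thesis
      using fact_prod_pos[OF assms(1), of m] fact_prod_pos[OF assms(2), of m] assms(3)
      by (simp add: fact_prod_Suc assms size_Upsilon)
  qed
  ultimately show ?thesis by simp
qed

text \<open>The weights \<open>s ^ k / k!\<close> of a Poisson distribution with integer mean
  \<open>s\<close> peak at \<open>k = s\<close>: passing from one index to the other only trades
  factors \<open>s\<close> for factors on the favourable side of \<open>s\<close>.\<close>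

lemma poisson_mode:
  fixes s k :: nat
  shows "fact s * real s ^ k \<le> fact k * real s ^ s"
proof (cases "k \<le> s")
  case True
  then have "fact k * real s ^ s = fact k * real s ^ (s - k) * real s ^ k"
    by (simp flip: power_add)
  moreover have "(fact s :: real) \<le> fact k * real s ^ (s - k)"
  proof -
    have "(fact (k + (s - k)) :: real) = fact k * (\<Prod>i=1..s - k. real k + real i)" by (rule fact_add)
    also have "\<dots> \<le> fact k * (\<Prod>i=1..s - k. real s)"
      using True by (intro mult_left_mono prod_mono) (auto simp: of_nat_diff)
    finally show ?thesis using True by simp
  qed
  then have "fact s * real s ^ k \<le> fact k * real s ^ (s - k) * real s ^ k"
    by (intro mult_right_mono) auto
  ultimately show ?thesis by simp
next
  case False
  then have "real s ^ k = real s ^ (k - s) * real s ^ s"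
    by (simp flip: power_add)
  moreover have "fact s * real s ^ (k - s) \<le> fact k"
  proof -
    have "fact s * real s ^ (k - s) = fact s * (\<Prod>i=1..k - s. real s)" by simp
    also have "\<dots> \<le> fact s * (\<Prod>i=1..k - s. real s + real i)"
      by (intro mult_left_mono prod_mono) auto
    also have "\<dots> = fact (s + (k - s))" by (rule fact_add[symmetric])
    finally show ?thesis using False by simp
  qed
  then have "fact s * real s ^ (k - s) * real s ^ s \<le> fact k * real s ^ s"
    by (intro mult_right_mono) auto
  ultimately show ?thesis by (simp add: mult.assoc)
qed

text \<open>A binomial distribution with integer mean \<open>x * a\<close> peaks there. It is the
  law of one of two independent Poisson variables with means \<open>x * a\<close> and
  \<open>x * b\<close> given their sum, so two Poisson bounds multiply to the claim.\<close>

lemma binomial_mode: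
  fixes a b x k :: nat
  assumes "k \<le> x * (a + b)"
  shows "real ((x * (a + b)) choose k) * real a ^ k * real b ^ (x * (a + b) - k) \<le>
    real ((x * (a + b)) choose (x * a)) * real a ^ (x * a) * real b ^ (x * b)"
proof (cases "x = 0")
  case True
  then show ?thesis using assms by simp
next
  case False
  define N where "N = x * (a + b)"
  define k' where "k' = N - k"
  have k: "k + k' = N" "k \<le> N" using assms by (auto simp: N_def k'_def)
  have N: "x * a + x * b = N" by (simp add: N_def algebra_simps)
  have "(fact (x * a) * real (x * a) ^ k) * (fact (x * b) * real (x * b) ^ k') \<le>
      (fact k * real (x * a) ^ (x * a)) * (fact k' * real (x * b) ^ (x * b))"
    by (intro mult_mono poisson_mode) auto
  then have "real x ^ N * (fact (x * a) * fact (x * b) * (real a ^ k * real b ^ k')) \<le>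
      real x ^ N * (fact k * fact k' * (real a ^ (x * a) * real b ^ (x * b)))"
  proof -
    have "real x ^ N = real x ^ k * real x ^ k'" "real x ^ N = real x ^ (x * a) * real x ^ (x * b)"
      using k(1) N by (simp_all flip: power_add)
    then show ?thesis
      using \<open>(fact (x * a) * real (x * a) ^ k) * _ \<le> _\<close>
      by (simp only: of_nat_mult power_mult_distrib mult_ac)
  qed
  then have main: "fact (x * a) * fact (x * b) * (real a ^ k * real b ^ k') \<le>
      fact k * fact k' * (real a ^ (x * a) * real b ^ (x * b))"
    using False by simp
  have c1: "real (N choose k) = fact N / (fact k * fact k')"
    using binomial_fact[OF k(2)] by (simp add: k'_def)
  have c2: "real (N choose (x * a)) = fact N / (fact (x * a) * fact (x * b))"
    using binomial_fact[of "x * a" N] N by (metis add_diff_cancel_left' le_add1)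
  define w :: real where "w = fact N / (fact k * fact k' * (fact (x * a) * fact (x * b)))"
  have "w * (fact (x * a) * fact (x * b) * (real a ^ k * real b ^ k')) \<le>
      w * (fact k * fact k' * (real a ^ (x * a) * real b ^ (x * b)))"
    using main by (intro mult_left_mono) (auto simp: w_def)
  moreover have "w * (fact (x * a) * fact (x * b) * l) = fact N / (fact k * fact k') * l" for l
    by (simp add: w_def)
  moreover have "w * (fact k * fact k' * l) = fact N / (fact (x * a) * fact (x * b)) * l" for l
    by (simp add: w_def)
  ultimately show ?thesis
    unfolding N_def[symmetric] k'_def[symmetric] c1 c2 mult.assoc by simp
qed

text \<open>Equivalently, the probability of exactly the expected number of successes in
  \<open>x * (a + b)\<close> trials of success probability \<open>a / (a + b)\<close> does not
  increase with \<open>x\<close>. Condition on the number \<open>k\<close> of successes in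
  \<open>a + b\<close> additional trials (Vandermonde) and bound each conditional probability by the
  mode.\<close>

lemma shifted_prod_add:
  assumes "a > 0" "b > 0"
  shows "shifted_prod (a + b) (real x) \<le> shifted_prod a (real x) * shifted_prod b (real x)"
proof -
  define N where "N = x * (a + b)"
  define K where "K = Suc x * a"
  have N: "N = x * a + x * b" and N': "N + (a + b) = Suc x * a + Suc x * b"
    by (simp_all add: N_def algebra_simps)
  define R where "R = real (N choose (x * a)) * real a ^ (x * a) * real b ^ (x * b)"
  have "real ((N + (a + b)) choose K) * real a ^ K * real b ^ (Suc x * b) =
      (\<Sum>k\<le>K. real ((a + b) choose k) * real (N choose (K - k)) * (real a ^ K * real b ^ (Suc x * b)))"
    by (simp add: vandermonde[of "a + b" N K, symmetric] add.commute[of N] sum_distrib_right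
      mult.assoc)
  also have "\<dots> \<le> (\<Sum>k\<le>K. real ((a + b) choose k) * real a ^ k * real b ^ (a + b - k) * R)"
  proof (intro sum_mono)
    fix k assume k: "k \<in> {..K}"
    show "real ((a + b) choose k) * real (N choose (K - k)) * (real a ^ K * real b ^ (Suc x * b)) \<le>
      real ((a + b) choose k) * real a ^ k * real b ^ (a + b - k) * R"
    proof (cases "k \<le> a + b \<and> K - k \<le> N")
      case True
      have "real a ^ K = real a ^ k * real a ^ (K - k)"
        using k by (simp flip: power_add)
      moreover have "Suc x * b = (a + b - k) + (N - (K - k))"
        using True k N' unfolding K_def[symmetric] by (simp only: atMost_iff) linarith
      then have "real b ^ (Suc x * b) = real b ^ (a + b - k) * real b ^ (N - (K - k))"
        by (simp only: power_add)
      moreover have "real (N choose (K - k)) * real a ^ (K - k) * real b ^ (N - (K - k)) \<le> R"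
        unfolding R_def N_def using True by (intro binomial_mode) (simp add: N_def)
      then have "real ((a + b) choose k) * real a ^ k * real b ^ (a + b - k) *
          (real (N choose (K - k)) * real a ^ (K - k) * real b ^ (N - (K - k))) \<le>
          real ((a + b) choose k) * real a ^ k * real b ^ (a + b - k) * R"
        by (intro mult_left_mono) auto
      ultimately show ?thesis by (simp only: mult_ac)
    next
      case False
      then have "real ((a + b) choose k) * real (N choose (K - k)) = 0" by (auto simp: binomial_eq_0)
      then show ?thesis by (simp only: mult_zero_left) (simp add: R_def)
    qed
  qed
  also have "\<dots> = (\<Sum>k\<le>K. real ((a + b) choose k) * real a ^ k * real b ^ (a + b - k)) * R"
    by (simp add: sum_distrib_right)
  also have "\<dots> \<le> (real a + real b) ^ (a + b) * R"
  proof (rule mult_right_mono)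
    have "(\<Sum>k\<le>K. real ((a + b) choose k) * real a ^ k * real b ^ (a + b - k)) \<le>
        (\<Sum>k\<le>max K (a + b). real ((a + b) choose k) * real a ^ k * real b ^ (a + b - k))"
      by (intro sum_mono2) auto
    also have "\<dots> = (\<Sum>k\<le>a + b. real ((a + b) choose k) * real a ^ k * real b ^ (a + b - k))"
      by (intro sum.mono_neutral_right) (auto simp: binomial_eq_0)
    also have "\<dots> = (real a + real b) ^ (a + b)" by (simp add: binomial_ring)
    finally show "(\<Sum>k\<le>K. real ((a + b) choose k) * real a ^ k * real b ^ (a + b - k)) \<le>
      (real a + real b) ^ (a + b)" .
  qed (simp add: R_def)
  finally have main: "real ((N + (a + b)) choose K) * real a ^ K * real b ^ (Suc x * b) \<le>
      real (a + b) ^ (a + b) * R"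
    by simp
  have c1: "real ((N + (a + b)) choose K) = fact ((a + b) * Suc x) / (fact (a * Suc x) * fact (b * Suc x))"
  proof -
    have "K \<le> N + (a + b)" "N + (a + b) - K = b * Suc x" "N + (a + b) = (a + b) * Suc x" "K = a * Suc x"
      using N' by (simp_all add: K_def algebra_simps)
    then show ?thesis using binomial_fact[of K "N + (a + b)"] by metis
  qed
  have c2: "real (N choose (x * a)) = fact ((a + b) * x) / (fact (a * x) * fact (b * x))"
  proof -
    have "a * x \<le> N" "N - a * x = b * x" "N = (a + b) * x" "x * a = a * x"
      using N by (simp_all add: algebra_simps)
    then show ?thesis using binomial_fact[of "a * x" N] by metis
  qed
  have e1: "real a ^ K = real a ^ (x * a) * real a ^ a" "real b ^ (Suc x * b) = real b ^ (x * b) * real b ^ b"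
    by (simp_all add: K_def power_add mult.commute)
  have "(real a ^ (x * a) * real b ^ (x * b)) *
      (fact ((a + b) * Suc x) / (fact (a * Suc x) * fact (b * Suc x)) * (real a ^ a * real b ^ b)) \<le>
      (real a ^ (x * a) * real b ^ (x * b)) *
      (real (a + b) ^ (a + b) * (fact ((a + b) * x) / (fact (a * x) * fact (b * x))))"
    using main unfolding R_def c1 c2 e1 by (simp only: mult_ac)
  then have "fact ((a + b) * Suc x) / (fact (a * Suc x) * fact (b * Suc x)) * (real a ^ a * real b ^ b) \<le>
      real (a + b) ^ (a + b) * (fact ((a + b) * x) / (fact (a * x) * fact (b * x)))"
    using assms by (subst (asm) mult_le_cancel_left_pos) auto
  then show ?thesis
    using assms unfolding shifted_prod_nat[OF assms(1)] shifted_prod_nat[OF assms(2)]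
      shifted_prod_nat[OF add_pos_pos[OF assms]]
    by (simp add: divide_simps mult_ac del: mult_Suc_right)
qed

lemma shifted_prod_sum_list:
  "shifted_prod (sum_list as) (real x) \<le> (\<Prod>a\<leftarrow>as. shifted_prod a (real x))"
proof (induction as)
  case (Cons a as)
  have nn: "0 \<le> shifted_prod a (real x)" for a by (auto simp: shifted_prod_def intro!: prod_nonneg)
  show ?case
  proof (cases "a = 0")
    case True
    then show ?thesis using Cons by (simp add: shifted_prod_def)
  next
    case a: False
    show ?thesis
    proof (cases "sum_list as = 0")
      case True
      then have "1 \<le> (\<Prod>a\<leftarrow>as. shifted_prod a (real x))"
        using Cons by (simp only: shifted_prod_def) simp
      from mult_left_mono[OF this nn[of a]] show ?thesis
        by (simp only: list.map sum_list.Cons prod_list.Cons True add_0_right mult_1_right)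
    next
      case False
      then have "shifted_prod (a + sum_list as) (real x) \<le>
          shifted_prod a (real x) * shifted_prod (sum_list as) (real x)"
        using a by (intro shifted_prod_add) (simp_all only: neq0_conv)
      also have "\<dots> \<le> shifted_prod a (real x) * (\<Prod>a\<leftarrow>as. shifted_prod a (real x))"
        using Cons nn by (intro mult_left_mono) auto
      finally show ?thesis by simp
    qed
  qed
qed (simp add: shifted_prod_def)

section \<open>Hypergeometric terms as constant terms\<close>

text \<open>A window of variables: exponents in which only the variables numbered \<open>d\<close>
  up to \<open>d' - 1\<close> occur. Different blocks get disjoint windows.\<close>

definition degs_in :: "nat \<Rightarrow> nat \<Rightarrow> int poly set" where
  "degs_in d d' = {x. \<forall>i. i < d \<or> i \<ge> d' \<longrightarrow> coeff x i = 0}"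

lemma degs_in_simps [simp]:
  "0 \<in> degs_in d d'" "x \<in> degs_in d d' \<Longrightarrow> y \<in> degs_in d d' \<Longrightarrow> x + y \<in> degs_in d d'"
  "x \<in> degs_in d d' \<Longrightarrow> - x \<in> degs_in d d'"
  by (auto simp: degs_in_def)

lemma degs_in_mono:
  assumes "x \<in> degs_in d d'" "e \<le> d" "d' \<le> e'"
  shows "x \<in> degs_in e e'"
  unfolding degs_in_def
proof (intro CollectI allI impI)
  fix i assume "i < e \<or> e' \<le> i"
  then have "i < d \<or> d' \<le> i" using assms(2,3) by linarith
  then show "coeff x i = 0" using assms(1) by (auto simp: degs_in_def)
qed

lemma degs_in_mult:
  "keys P \<subseteq> degs_in d d' \<Longrightarrow> keys Q \<subseteq> degs_in d d' \<Longrightarrow> keys (P * Q) \<subseteq> degs_in d d'"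
  by (rule keys_mult_subset) simp_all

lemma degs_in_power: "keys P \<subseteq> degs_in d d' \<Longrightarrow> keys (P ^ n) \<subseteq> degs_in d d'"
  by (rule keys_power_subset) simp_all

text \<open>The linear form \<open>a_1 x_d + a_2 x_(d+1) + ...\<close>, where
  \<open>monom 1 i\<close> encodes the variable \<open>x_i\<close>.\<close>

fun linear_form :: "nat \<Rightarrow> nat list \<Rightarrow> int poly gr" where
  "linear_form d [] = 0"
| "linear_form d (a # as) = single (monom 1 d) (real a) + linear_form (Suc d) as"

fun exponent :: "nat \<Rightarrow> nat list \<Rightarrow> int poly" where
  "exponent d [] = 0"
| "exponent d (k # ks) = monom (int k) d + exponent (Suc d) ks"

lemma exponent_degs_in: "exponent d ks \<in> degs_in d (d + length ks)"
proof (induction ks arbitrary: d)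
  case (Cons k ks)
  then have "exponent (Suc d) ks \<in> degs_in d (d + length (k # ks))"
    using degs_in_mono[OF Cons[of "Suc d"]] by simp
  moreover have "monom (int k) d \<in> degs_in d (d + length (k # ks))" by (auto simp: degs_in_def)
  ultimately show ?case by simp
qed simp

lemma linear_form_degs_in: "keys (linear_form d as) \<subseteq> degs_in d (d + length as)"
proof (induction as arbitrary: d)
  case (Cons a as)
  have "keys (linear_form (Suc d) as) \<subseteq> degs_in d (d + length (a # as))"
    using Cons[of "Suc d"] degs_in_mono[of _ "Suc d" "Suc d + length as" d "d + length (a # as)"] by auto
  moreover have "monom 1 d \<in> degs_in d (d + length (a # as))" by (auto simp: degs_in_def)
  moreover have "keys (linear_form d (a # as)) \<subseteq> insert (monom 1 d) (keys (linear_form (Suc d) as))"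
    using Poly_Mapping.keys_add[of "single (monom 1 d) (real a)" "linear_form (Suc d) as"]
    by (auto split: if_splits)
  ultimately show ?case by blast
qed simp

lemma linear_form_props:
  "nonneg (linear_form d as)" "integral_gr (linear_form d as)" "mass (linear_form d as) = real (sum_list as)"
  by (induction as arbitrary: d) (simp_all add: nonneg_intros integral_gr_intros)

lemma exponent_map_mult: "exponent d (map ((*) m) ks) = of_nat m * exponent d ks"
proof (induction ks arbitrary: d)
  case (Cons k ks)
  then show ?case by (simp add: of_nat_poly smult_monom smult_add_right)
qed simp

lemma monom_power: "single (monom 1 d :: int poly) a ^ i = single (monom (int i) d) (a ^ i)"
proof (induction i)
  case (Suc i)
  then show ?case by (simp add: mult_single add_monom)
qed simp

text \<open>The multinomial theorem, obtained by splitting off the first variable with the binomial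
  theorem.\<close>

lemma multinomial_coeff:
  assumes "length ks = length as" "sum_list ks = N"
  shows "lookup (linear_form d as ^ N) (exponent d ks) =
    fact N * (\<Prod>(a, k)\<leftarrow>zip as ks. real a ^ k / fact k)"
  using assms
proof (induction as arbitrary: d N ks)
  case Nil
  then show ?case by simp
next
  case (Cons a as)
  obtain k ks' where ks: "ks = k # ks'" using Cons.prems by (cases ks) auto
  have N: "k \<le> N" "sum_list ks' = N - k" and len: "length ks' = length as"
    using Cons.prems ks by auto
  let ?W = "linear_form (Suc d) as" and ?T = "exponent (Suc d) ks'"
  have summand: "lookup (of_nat (N choose i) * single (monom 1 d) (real a) ^ i * ?W ^ (N - i)) (exponent d ks) =
      (if i = k then real (N choose k) * real a ^ k * lookup (?W ^ (N - k)) ?T else 0)" for i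
  proof -
    have "of_nat (N choose i) * single (monom 1 d) (real a) ^ i * ?W ^ (N - i) =
        ?W ^ (N - i) * single (monom (int i) d) (real (N choose i) * real a ^ i)"
      by (simp add: monom_power mult_single mult.commute flip: single_of_nat)
    then have eq: "lookup (of_nat (N choose i) * single (monom 1 d) (real a) ^ i * ?W ^ (N - i)) (exponent d ks) =
        real (N choose i) * real a ^ i * lookup (?W ^ (N - i)) (exponent d ks - monom (int i) d)"
      by (simp only: lookup_times_single)
    show ?thesis
    proof (cases "i = k")
      case True
      then show ?thesis using eq ks by simp
    next
      case False
      \<comment> \<open>For the wrong power of the variable \<open>x_d\<close> an occurrence of it
        is left over, but the remaining linear form contains later variables only.\<close>
      have "coeff ?T d = 0" using exponent_degs_in[of "Suc d" ks'] by (auto simp: degs_in_def)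
      then have "coeff (exponent d ks - monom (int i) d) d \<noteq> 0" using False ks by simp
      then have "exponent d ks - monom (int i) d \<notin> degs_in (Suc d) (Suc d + length as)"
        by (auto simp: degs_in_def)
      then have "exponent d ks - monom (int i) d \<notin> keys (?W ^ (N - i))"
        using degs_in_power[OF linear_form_degs_in, of "Suc d" as "N - i"] by blast
      then show ?thesis using eq False by (simp add: in_keys_iff)
    qed
  qed
  have "lookup (linear_form d (a # as) ^ N) (exponent d ks) =
      (\<Sum>i\<le>N. lookup (of_nat (N choose i) * single (monom 1 d) (real a) ^ i * ?W ^ (N - i)) (exponent d ks))"
    by (simp add: binomial_ring lookup_sum)
  also have "\<dots> = real (N choose k) * real a ^ k * lookup (?W ^ (N - k)) ?T"
    unfolding summand using N(1) by simp
  also have "lookup (?W ^ (N - k)) ?T = fact (N - k) * (\<Prod>(a, k)\<leftarrow>zip as ks'. real a ^ k / fact k)"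
    using Cons.IH[OF len N(2)] .
  also have "real (N choose k) = fact N / (fact k * fact (N - k))"
    using N(1) by (rule binomial_fact)
  finally show ?case by (simp add: ks field_simps)
qed

text \<open>The Laurent polynomial \<open>(\<Sum> a_i x_i) ^ s / \<Prod> x_i ^ a_i\<close> with
  \<open>s = \<Sum> a_i\<close>. A word over its letters has exponent 0 exactly when each outcome
  occurs as often as expected.\<close>

definition block :: "nat \<Rightarrow> nat list \<Rightarrow> int poly gr" where
  "block d as = linear_form d as ^ sum_list as * single (- exponent d as) 1"

lemma block_props:
  "nonneg (block d as)" "integral_gr (block d as)" "mass (block d as) = real (sum_list as) ^ sum_list as"
  by (simp_all add: block_def linear_form_props nonneg_mult integral_gr_mult nonneg_power
    integral_gr_power nonneg_intros integral_gr_intros)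

lemma block_degs_in: "keys (block d as) \<subseteq> degs_in d (d + length as)"
  unfolding block_def using exponent_degs_in[of d as]
  by (intro degs_in_mult degs_in_power linear_form_degs_in) simp

lemma block_power: "lookup (block d as ^ m) 0 =
    fact (sum_list as * m) * (\<Prod>a\<leftarrow>as. real a ^ (a * m) / fact (a * m))"
proof -
  have s: "single (- exponent d as) (1 :: real) ^ m = single (- exponent d (map ((*) m) as)) 1"
  proof (induction m)
    case 0
    have "exponent d (map ((*) 0) as) = 0"
      using exponent_map_mult[of d 0 as] by (simp only: of_nat_0 mult_zero_left)
    then show ?case by (simp only: power_0 minus_zero single_one)
  next
    case (Suc m)
    have "- exponent d as + - exponent d (map ((*) m) as) = - exponent d (map ((*) (Suc m)) as)"
      unfolding exponent_map_mult by (simp add: algebra_simps)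
    then show ?case by (simp only: power_Suc Suc mult_single mult_1_right)
  qed
  have "lookup (block d as ^ m) 0 = lookup (linear_form d as ^ (sum_list as * m)) (exponent d (map ((*) m) as))"
    unfolding block_def power_mult_distrib s lookup_times_single by (simp add: power_mult)
  also have "\<dots> = fact (sum_list as * m) * (\<Prod>(a, k)\<leftarrow>zip as (map ((*) m) as). real a ^ k / fact k)"
    by (intro multinomial_coeff) (simp_all add: sum_list_const_mult mult.commute)
  also have "zip as (map ((*) m) as) = map (\<lambda>a. (a, m * a)) as"
    by (induction as) auto
  finally show ?thesis by (simp add: comp_def mult.commute)
qed

text \<open>An exponent from one window can only be cancelled by one from a disjoint window if both
  are 0.\<close>

lemma lookup_mult_0_disjoint:
  assumes "keys P \<subseteq> degs_in d e" "keys Q \<subseteq> degs_in e d'"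
  shows "lookup (P * Q) 0 = lookup P 0 * lookup Q 0"
proof -
  have "lookup (P * Q) 0 = lin (\<lambda>x. lookup Q (- x)) P"
  proof -
    have "(\<lambda>y. if x + y = 0 then 1 else 0 :: real) = (\<lambda>y. if y = - x then 1 else 0)" for x :: "int poly"
      by (auto simp: eq_neg_iff_add_eq_0 add.commute)
    then show ?thesis by (simp only: lookup_eq_lin[of "P * Q"] lin_mult lookup_eq_lin[of Q])
  qed
  also have "\<dots> = lin (\<lambda>x. lookup Q 0 * (if x = 0 then 1 else 0)) P"
  proof (rule lin_cong)
    fix x assume x: "x \<in> keys P"
    show "lookup Q (- x) = lookup Q 0 * (if x = 0 then 1 else 0)"
    proof (cases "x = 0 \<or> - x \<notin> keys Q")
      case True
      then show ?thesis by (auto simp: in_keys_iff)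
    next
      case False
      then have "x \<in> degs_in d e" "- x \<in> degs_in e d'" using x assms by auto
      then have "coeff x i = 0" for i by (cases "i < e") (auto simp: degs_in_def)
      then show ?thesis using False by (auto simp: poly_eq_iff)
    qed
  qed
  also have "\<dots> = lookup Q 0 * lookup P 0" by (simp add: lin_fun_cmult lookup_eq_lin)
  finally show ?thesis by simp
qed

fun block_product :: "nat \<Rightarrow> nat list list \<Rightarrow> int poly gr" where
  "block_product d [] = 1"
| "block_product d (as # bs) = block d as * block_product (d + length as) bs"

lemma block_product_props:
  "nonneg (block_product d bs)" "integral_gr (block_product d bs)"
  "mass (block_product d bs) = (\<Prod>as\<leftarrow>bs. real (sum_list as) ^ sum_list as)"
  by (induction bs arbitrary: d) (simp_all add: block_props nonneg_mult integral_gr_mult)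

lemma block_product_degs_in: "keys (block_product d bs) \<subseteq> degs_in d (d + length (concat bs))"
proof (induction bs arbitrary: d)
  case (Cons as bs)
  let ?e = "d + length (concat (as # bs))"
  have "keys (block d as) \<subseteq> degs_in d ?e"
    using block_degs_in[of d as] degs_in_mono[of _ d "d + length as" d ?e] by auto
  moreover have "keys (block_product (d + length as) bs) \<subseteq> degs_in d ?e"
    using Cons[of "d + length as"] degs_in_mono[of _ "d + length as" "d + length as + length (concat bs)" d ?e]
    by auto
  ultimately show ?case unfolding block_product.simps by (rule degs_in_mult)
qed simp

lemma block_product_power:
  "lookup (block_product d bs ^ m) 0 =
    (\<Prod>as\<leftarrow>bs. fact (sum_list as * m) * (\<Prod>a\<leftarrow>as. real a ^ (a * m) / fact (a * m)))"
proof (induction bs arbitrary: d)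
  case (Cons as bs)
  have "lookup (block_product d (as # bs) ^ m) 0 =
      lookup (block d as ^ m * block_product (d + length as) bs ^ m) 0"
    by (simp add: power_mult_distrib)
  also have "\<dots> = lookup (block d as ^ m) 0 * lookup (block_product (d + length as) bs ^ m) 0"
    by (rule lookup_mult_0_disjoint[OF degs_in_power[OF block_degs_in] degs_in_power[OF block_product_degs_in]])
  finally show ?case by (simp add: Cons block_power)
qed simp

section \<open>Refinements as lists of blocks\<close>

lemma refinement_lists:
  assumes "is_refinement nu mu"
  obtains bs :: "nat list list" where "nu = mset (concat bs)" "mu = mset (map sum_list bs)"
proof -
  have "\<exists>bl. \<Sum>\<^sub># bl = nu \<and> image_mset sum_mset bl = mu"
    using assms by (simp only: is_refinement_def)
  then obtain bl where bl: "\<Sum>\<^sub># bl = nu" "image_mset sum_mset bl = mu" by blast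
  obtain L where L: "mset L = bl" using ex_mset by blast
  define f :: "nat multiset \<Rightarrow> nat list" where "f b = (SOME l. mset l = b)" for b
  have f: "mset (f b) = b" for b unfolding f_def by (rule someI_ex) (rule ex_mset)
  have "mset (concat (map f K)) = \<Sum>\<^sub># (mset K)" for K by (induction K) (auto simp: f)
  moreover have "sum_list (f b) = sum_mset b" for b
    using sum_mset_sum_list[of "f b"] by (simp add: f)
  then have "mset (map sum_list (map f K)) = image_mset sum_mset (mset K)" for K
    by (induction K) auto
  ultimately have "nu = mset (concat (map f L))" "mu = mset (map sum_list (map f L))"
    using L bl by metis+
  then show ?thesis by (rule that)
qed

lemma fact_prod_lists:
  assumes "0 \<notin> set (concat bs)"
  shows "fact_prod (mset (map sum_list bs)) m / fact_prod (mset (concat bs)) m =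
    lookup (block_product d bs ^ m) 0 / mass (block_product d bs) ^ m"
proof -
  have conc: "fact_prod (mset as) m = (\<Prod>a\<leftarrow>as. fact (a * m) / real a ^ (a * m))" for as
    by (induction as) (auto simp: fact_prod_def)
  have inv: "(\<Prod>a\<leftarrow>as. real a ^ (a * m) / fact (a * m)) = 1 / fact_prod (mset as) m"
    if "0 \<notin> set as" for as
    using that by (induction as) (auto simp: fact_prod_def)
  have app: "fact_prod (M + M') m = fact_prod M m * fact_prod M' m" for M M'
    by (simp add: fact_prod_def)
  show ?thesis
    unfolding block_product_power block_product_props(3) using assms
  proof (induction bs)
    case Nil
    then show ?case by (simp add: fact_prod_def)
  next
    case (Cons as bs)
    have "fact_prod (mset (map sum_list (as # bs))) m =
        fact (sum_list as * m) / real (sum_list as) ^ (sum_list as * m) * fact_prod (mset (map sum_list bs)) m"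
      by (simp add: fact_prod_def)
    then have "fact_prod (mset (map sum_list (as # bs))) m / fact_prod (mset (concat (as # bs))) m =
        (fact (sum_list as * m) * (1 / fact_prod (mset as) m)) / real (sum_list as) ^ (sum_list as * m) *
        (fact_prod (mset (map sum_list bs)) m / fact_prod (mset (concat bs)) m)"
      by (simp add: app)
    also have "1 / fact_prod (mset as) m = (\<Prod>a\<leftarrow>as. real a ^ (a * m) / fact (a * m))"
      using inv[of as] Cons.prems by simp
    also have "fact_prod (mset (map sum_list bs)) m / fact_prod (mset (concat bs)) m =
        (\<Prod>as\<leftarrow>bs. fact (sum_list as * m) * (\<Prod>a\<leftarrow>as. real a ^ (a * m) / fact (a * m))) /
        (\<Prod>as\<leftarrow>bs. real (sum_list as) ^ sum_list as) ^ m"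
      using Cons by simp
    finally show ?case
      by (simp add: power_mult power_mult_distrib)
  qed
qed

lemma prod_list_mono_nonneg:
  fixes f g :: "'b \<Rightarrow> real"
  assumes "\<And>x. x \<in> set xs \<Longrightarrow> 0 \<le> f x \<and> f x \<le> g x"
  shows "0 \<le> (\<Prod>x\<leftarrow>xs. f x) \<and> (\<Prod>x\<leftarrow>xs. f x) \<le> (\<Prod>x\<leftarrow>xs. g x)"
  using assms
proof (induction xs)
  case (Cons x xs)
  have x: "0 \<le> f x" "f x \<le> g x" using Cons.prems[of x] by auto
  have "0 \<le> (\<Prod>x\<leftarrow>xs. f x) \<and> (\<Prod>x\<leftarrow>xs. f x) \<le> (\<Prod>x\<leftarrow>xs. g x)"
    by (rule Cons.IH) (rule Cons.prems, simp)
  then show ?case using x by (auto intro!: mult_mono)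
qed simp

text \<open>The quotient of consecutive values is a quotient of shifted products, at most 1 block by
  block. This is what brings Leibniz' criterion into play for negative \<open>r\<close>.\<close>

lemma fact_prod_ratio_decreasing:
  assumes "is_refinement nu mu" "0 \<notin># mu" "0 \<notin># nu"
  shows "fact_prod mu (Suc m) / fact_prod nu (Suc m) \<le> fact_prod mu m / fact_prod nu m"
proof -
  obtain bs where bs: "nu = mset (concat bs)" "mu = mset (map sum_list bs)"
    using refinement_lists[OF assms(1)] .
  have "(\<Prod>l\<in>#mu. shifted_prod l (real m)) = (\<Prod>as\<leftarrow>bs. shifted_prod (sum_list as) (real m))"
    unfolding bs(2) by (simp add: prod_mset_prod_list comp_def flip: mset_map)
  also have "\<dots> \<le> (\<Prod>as\<leftarrow>bs. \<Prod>a\<leftarrow>as. shifted_prod a (real m))"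
  proof (rule prod_list_mono_nonneg[THEN conjunct2])
    have "0 \<le> shifted_prod l (real m)" for l by (auto simp: shifted_prod_def intro!: prod_nonneg)
    then show "0 \<le> shifted_prod (sum_list as) (real m) \<and>
        shifted_prod (sum_list as) (real m) \<le> (\<Prod>a\<leftarrow>as. shifted_prod a (real m))" for as
      using shifted_prod_sum_list by blast
  qed
  also have "\<dots> = (\<Prod>l\<in>#nu. shifted_prod l (real m))"
  proof -
    have "(\<Prod>l\<in>#mset (concat K). shifted_prod l (real m)) = (\<Prod>as\<leftarrow>K. \<Prod>a\<leftarrow>as. shifted_prod a (real m))" for K
      by (induction K) (auto simp: prod_mset_prod_list simp flip: mset_map)
    then show ?thesis by (simp add: bs(1))
  qed
  finally have le: "(\<Prod>l\<in>#mu. shifted_prod l (real m)) \<le> (\<Prod>l\<in>#nu. shifted_prod l (real m))" .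
  have pos: "0 < (\<Prod>l\<in>#nu. shifted_prod l (real m))"
    using fact_prod_pos[OF assms(3), of m] fact_prod_pos[OF assms(3), of "Suc m"]
    by (simp add: fact_prod_Suc[OF assms(3)] Upsilon_prod zero_less_mult_iff)
  have "fact_prod mu (Suc m) / fact_prod nu (Suc m) = fact_prod mu m / fact_prod nu m *
      ((\<Prod>l\<in>#mu. shifted_prod l (real m)) / (\<Prod>l\<in>#nu. shifted_prod l (real m)))"
    by (simp add: fact_prod_Suc assms Upsilon_prod)
  also have "\<dots> \<le> fact_prod mu m / fact_prod nu m * 1"
    using le pos fact_prod_pos[OF assms(2), of m] fact_prod_pos[OF assms(3), of m]
    by (intro mult_left_mono) auto
  finally show ?thesis by simp
qed

section \<open>The theorem\<close>

text \<open>Prime factors are removed one at a time, each at the cost of one further factor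
  \<open>c\<close>. It lets a power of \<open>c\<close> clear all denominators.\<close>

lemma dvd_power_if_common_primes:
  fixes x c :: nat
  assumes "x > 0" "\<And>q. prime q \<Longrightarrow> q dvd x \<Longrightarrow> q dvd c"
  shows "\<exists>N. x dvd c ^ N"
  using assms
proof (induction x rule: less_induct)
  case (less x)
  show ?case
  proof (cases "x = 1")
    case True
    then show ?thesis by simp
  next
    case False
    then obtain q where q: "prime q" "q dvd x" using prime_factor_nat by blast
    then obtain y where y: "x = q * y" by blast
    have "y < x" "y > 0" using y less.prems(1) prime_gt_1_nat[OF q(1)] by auto
    then obtain N where "y dvd c ^ N" using less.IH[of y] less.prems(2) y by auto
    then have "x dvd c ^ Suc N" using less.prems(2)[OF q] y by (simp add: mult_dvd_mono)
    then show ?thesis by blast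
  qed
qed

text \<open>Among the words of exponent 0 are those that use the letter 0 only.\<close>

lemma lookup_power_0_ge:
  fixes P :: "int poly gr"
  assumes "nonneg P"
  shows "lookup P 0 ^ m \<le> lookup (P ^ m) 0"
proof (induction m)
  case (Suc m)
  have "lookup P 0 * lookup (P ^ m) 0 = lin (\<lambda>x. lookup (P ^ m) 0 * (if x = 0 then 1 else 0)) P"
    by (simp only: lin_fun_cmult lookup_eq_lin[of P, symmetric] mult.commute)
  also have "\<dots> \<le> lin (\<lambda>x. lin (\<lambda>y. if x + y = 0 then 1 else 0) (P ^ m)) P"
  proof (rule lin_mono[OF assms])
    fix x
    show "lookup (P ^ m) 0 * (if x = 0 then 1 else 0) \<le> lin (\<lambda>y. if x + y = 0 then 1 else 0) (P ^ m)"
      using assms by (auto simp: lookup_eq_lin intro!: lin_nonneg nonneg_power)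
  qed
  also have "\<dots> = lookup (P ^ Suc m) 0" by (simp add: lookup_eq_lin lin_mult)
  finally have "lookup P 0 * lookup (P ^ m) 0 \<le> lookup (P ^ Suc m) 0" .
  moreover have "lookup P 0 * lookup P 0 ^ m \<le> lookup P 0 * lookup (P ^ m) 0"
    using Suc assms by (intro mult_left_mono) (auto simp: nonneg_def)
  ultimately show ?case by simp
qed simp

lemma not_tendsto_0_if_eventually_increasing:
  fixes a :: "nat \<Rightarrow> real"
  assumes "(\<lambda>m. a (Suc m) / a m) \<longlonglongrightarrow> l" "l > 1" "\<And>m. a m > 0"
  shows "\<not> a \<longlonglongrightarrow> 0"
proof
  assume lim: "a \<longlonglongrightarrow> 0"
  obtain m0 where m0: "\<And>m. m \<ge> m0 \<Longrightarrow> 1 < a (Suc m) / a m"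
    using order_tendstoD(1)[OF assms(1,2)] unfolding eventually_sequentially by blast
  have "a m0 \<le> a m" if "m \<ge> m0" for m
    using that
  proof (induction m rule: dec_induct)
    case (step m)
    then have "a m < a (Suc m)" using m0[of m] assms(3)[of m] by (simp add: less_divide_eq)
    then show ?case using step by linarith
  qed simp
  then have "a m0 \<le> 0"
    by (intro LIMSEQ_le_const[OF lim]) blast
  then show False using assms(3)[of m0] by simp
qed

text \<open>By Leibniz the sum is at least its partial sum \<open>a 0 - a 1\<close>.\<close>

lemma alternating_sum_pos:
  fixes a :: "nat \<Rightarrow> real"
  assumes "a \<longlonglongrightarrow> 0" "\<And>m. a (Suc m) \<le> a m" "a 1 < a 0" "\<And>m. a m > 0"
  shows "0 < suminf (\<lambda>m. (- 1) ^ m * a m)"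
proof -
  have "monoseq a" using assms(2) by (intro mono_SucI2) auto
  then have "\<forall>n. suminf (\<lambda>m. (- 1) ^ m * a m) \<in>
      {\<Sum>i<2 * n. (- 1) ^ i * a i..\<Sum>i<2 * n + 1. (- 1) ^ i * a i}"
    using summable_Leibniz(2)[OF assms(1)] assms(4)[of 0] by simp
  from spec[OF this, of 1] have "(\<Sum>i<2 * 1. (- 1) ^ i * a i) \<le> suminf (\<lambda>m. (- 1) ^ m * a m)"
    by (simp only: atLeastAtMost_iff)
  then show ?thesis using assms(3) by (simp add: numeral_2_eq_2)
qed

lemma asymp_equiv_of_limit:
  assumes "(\<lambda>n. real (f n) / real c ^ n) \<longlonglongrightarrow> A" "A \<noteq> 0"
  shows "(\<lambda>n. real (f n)) \<sim>[at_top] (\<lambda>n. A * real c ^ n)"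
proof (rule asymp_equivI')
  have "(\<lambda>n. real (f n) / real c ^ n / A) \<longlonglongrightarrow> A / A"
    using assms by (intro tendsto_intros)
  then show "(\<lambda>n. real (f n) / (A * real c ^ n)) \<longlonglongrightarrow> 1"
    using assms(2) by (simp add: mult.commute)
qed

text \<open>Serves the case \<open>c = 0\<close>, where \<open>A * c ^ n\<close> vanishes for
  \<open>n > 0\<close>. With no tiles at all, only the empty region has a tiling.\<close>

lemma eventually_zero_tile_count:
  "\<exists>f\<in>tile_counting_functions. \<forall>n>0. f n = 0"
proof
  show "tile_count {} 0 \<in> tile_counting_functions"
    unfolding tile_counting_functions_def tall_tile_set_def by blast
  have "{X. is_tiling {} (real n + 0) X} = {}" if "n > 0" for n
  proof -
    have "(0, 0) \<in> rect (real n + 0)" using that by (simp add: rect_def)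
    then show ?thesis by (auto simp: is_tiling_def)
  qed
  then show "\<forall>n>0. tile_count {} 0 n = 0" by (simp add: tile_count_def)
qed

theorem theorem4p10:
  fixes p c :: nat and mu nu :: "nat multiset" and r1 r2 :: int and r A :: real
  assumes "p > 0"
    and "is_partition mu p"
    and "is_partition nu p"
    and "is_refinement nu mu"
    and "r2 \<noteq> 0"
    and "r = of_int r1 / of_int r2"
    and "summable (hypergeom_term (Upsilon mu) (Upsilon nu) r)"
    and "A = hypergeom (Upsilon mu) (Upsilon nu) r"
    and "\<And>q :: nat. prime q \<Longrightarrow> int q dvd int (\<Prod>\<^sub># mu) * r2 \<Longrightarrow> q dvd c"
  shows "\<exists>f\<in>tile_counting_functions. (\<lambda>n. real (f n)) \<sim>[at_top] (\<lambda>n. A * real c ^ n)"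
proof (cases "c = 0")
  case True
  obtain f where "f \<in> tile_counting_functions" "\<forall>n>0. f n = 0"
    using eventually_zero_tile_count by blast
  moreover from this True have "(\<lambda>n. real (f n)) \<sim>[at_top] (\<lambda>n. A * real c ^ n)"
    by (intro asymp_equiv_refl_ev eventually_at_top_linorderI[of 1]) auto
  ultimately show ?thesis by blast
next
  case False
  have mu: "0 \<notin># mu" and nu: "0 \<notin># nu" and sums_eq: "\<Sum>\<^sub># mu = \<Sum>\<^sub># nu"
    using assms(2,3) by (auto simp: is_partition_def)
  obtain bs where bs: "nu = mset (concat bs)" "mu = mset (map sum_list bs)"
    using refinement_lists[OF assms(4)] .
  define \<Phi> where "\<Phi> = block_product 0 bs"
  define D where "D = (\<Prod>as\<leftarrow>bs. sum_list as ^ sum_list as)"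
  define P where "P m = fact_prod mu m / fact_prod nu m" for m
  have mass: "mass \<Phi> = real D"
    unfolding \<Phi>_def D_def block_product_props(3) by (induction bs) auto
  have \<Phi>: "nonneg \<Phi>" "integral_gr \<Phi>" by (simp_all add: \<Phi>_def block_product_props)
  have P: "P m = lookup (\<Phi> ^ m) 0 / real D ^ m" for m
    using fact_prod_lists[of bs m 0] nu unfolding P_def bs \<Phi>_def[symmetric] mass by simp
  have hterm: "hypergeom_term (Upsilon mu) (Upsilon nu) r m = r ^ m * P m" for m
    using hypergeom_term_eq[OF mu nu] by (simp add: P_def)
  have Ppos: "P m > 0" for m using fact_prod_pos[OF mu] fact_prod_pos[OF nu] by (simp add: P_def)
  have P0: "P 0 = 1" by (simp add: P)
  have A_sums: "(\<lambda>m. r ^ m * P m) sums A"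
    using assms(7,8) summable_sums unfolding hypergeom_def hterm[abs_def] by blast
  have parts: "sum_list as dvd \<Prod>\<^sub># mu \<and> sum_list as > 0" if "as \<in> set bs" for as
  proof -
    have "sum_list as \<in># mu" using that by (simp add: bs)
    then show ?thesis using mu by (auto intro: dvd_prod_mset gr0I)
  qed
  have Dpos: "D > 0"
  proof -
    have "(\<Prod>as\<leftarrow>K. sum_list as ^ sum_list as) > 0" if "\<forall>as\<in>set K. sum_list as > 0" for K :: "nat list list"
      using that by (induction K) auto
    then show ?thesis using parts by (simp add: D_def)
  qed
  have D_primes: "q dvd \<Prod>\<^sub># mu" if q: "prime q" "q dvd D" for q
  proof -
    have "\<exists>as\<in>set K. q dvd sum_list as" if "q dvd (\<Prod>as\<leftarrow>K. sum_list as ^ sum_list as)" for K :: "nat list list"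
      using that q(1) by (induction K) (auto simp: prime_dvd_mult_iff dest: prime_dvd_power)
    then show ?thesis using q(2) parts unfolding D_def by (meson dvd_trans)
  qed
  have "\<exists>N. D * nat \<bar>r2\<bar> dvd c ^ N"
  proof (rule dvd_power_if_common_primes)
    show "0 < D * nat \<bar>r2\<bar>" using Dpos assms(5) by simp
    fix q :: nat assume q: "prime q" "q dvd D * nat \<bar>r2\<bar>"
    then have "q dvd D \<or> q dvd nat \<bar>r2\<bar>" by (simp add: prime_dvd_mult_iff)
    then have "int q dvd int (\<Prod>\<^sub># mu) * r2"
    proof
      assume "q dvd D"
      then show ?thesis using D_primes q(1) by (intro dvd_mult2) simp
    next
      assume "q dvd nat \<bar>r2\<bar>"
      then have "int q dvd r2" by (simp add: nat_dvd_iff flip: int_dvd_int_iff)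
      then show ?thesis by simp
    qed
    then show "q dvd c" using assms(9) q(1) by blast
  qed
  then obtain N0 where "D * nat \<bar>r2\<bar> dvd c ^ N0" by blast
  \<comment> \<open>One more factor \<open>c\<close> makes the exponent \<open>N\<close> positive,
    since each letter has to have positive length.\<close>
  then have "D * nat \<bar>r2\<bar> dvd c ^ Suc N0" by simp
  then obtain k where k: "c ^ Suc N0 = D * nat \<bar>r2\<bar> * k" by blast
  define N where "N = Suc N0"
  \<comment> \<open>The cofactor \<open>k\<close> rewrites the ratio as
    \<open>\<bar>r\<bar> / D = e / c ^ N\<close> with an integer \<open>e\<close>.\<close>
  define e where "e = of_int \<bar>r1\<bar> * real k"
  have cN: "real c ^ N = real D * of_int \<bar>r2\<bar> * real k"
  proof -
    have "real (c ^ N) = real (D * nat \<bar>r2\<bar> * k)" using k by (simp only: N_def)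
    then show ?thesis by simp
  qed
  have kpos: "real k > 0" using cN False Dpos by (cases "k = 0") auto
  have e: "e / real c ^ N = \<bar>r\<bar> / real D" "e \<in> \<int>" "e \<ge> 0"
    using kpos assms(5,6) unfolding cN by (auto simp: e_def abs_divide)
  show ?thesis
  proof (cases "r \<ge> 0")
    case True
    then have "(e / real c ^ N) ^ m * lookup (\<Phi> ^ m) 0 = r ^ m * P m" for m
      by (simp add: e(1) P power_divide)
    then have "(\<lambda>m. (e / real c ^ N) ^ m * lookup (\<Phi> ^ m) 0) sums A" using A_sums by simp
    then obtain f where f: "f \<in> tile_counting_functions" "(\<lambda>n. real (f n) / real c ^ n) \<longlonglongrightarrow> A"
      using realize_nonneg_ratio[OF \<Phi>, of c N e A] e(2,3) False by (auto simp: N_def)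
    \<comment> \<open>The term for \<open>m = 0\<close> is 1, so \<open>A\<close> is nonzero, as
      needed to pass from the limit to asymptotic equivalence.\<close>
    have "(\<Sum>m\<in>{0}. r ^ m * P m) \<le> A"
      unfolding sums_unique[OF A_sums] using A_sums True Ppos
      by (intro sum_le_suminf) (auto simp: sums_iff less_imp_le)
    then have "A \<noteq> 0" using P0 by simp
    then show ?thesis using asymp_equiv_of_limit f by blast
  next
    case r: False
    define \<rho> where "\<rho> = \<bar>r\<bar>"
    define a where "a m = \<rho> ^ m * P m" for m
    have \<rho>: "r = - \<rho>" "\<rho> > 0" using r by (auto simp: \<rho>_def)
    have a_pos: "a m > 0" for m using \<rho> Ppos by (simp add: a_def)
    have alt: "r ^ m * P m = (- 1) ^ m * a m" for m
      unfolding a_def \<rho>(1) by (subst power_minus) simp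
    have "(\<lambda>m. \<bar>r ^ m * P m\<bar>) \<longlonglongrightarrow> 0"
      using A_sums sums_summable summable_LIMSEQ_zero tendsto_rabs_zero by blast
    then have a_lim: "a \<longlonglongrightarrow> 0"
      unfolding alt abs_mult power_abs using a_pos by (simp add: less_imp_le)
    \<comment> \<open>The terms of a convergent series tend to 0, whereas their absolute values have
      consecutive ratios tending to \<rho>.\<close>
    have \<rho>1: "\<rho> \<le> 1"
    proof (rule ccontr)
      assume "\<not> \<rho> \<le> 1"
      moreover have "(\<lambda>m. \<rho> * (P (Suc m) / P m)) \<longlonglongrightarrow> \<rho> * 1"
        unfolding P_def by (intro tendsto_mult tendsto_const fact_prod_ratio_tendsto mu nu sums_eq)
      then have "(\<lambda>m. a (Suc m) / a m) \<longlonglongrightarrow> \<rho>" using \<rho> by (simp add: a_def)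
      ultimately show False
        using not_tendsto_0_if_eventually_increasing[of a \<rho>] a_pos a_lim by auto
    qed
    have P_dec: "P (Suc m) \<le> P m" for m
      unfolding P_def by (rule fact_prod_ratio_decreasing[OF assms(4) mu nu])
    have a_dec: "a (Suc m) \<le> a m" for m
    proof -
      have "\<rho> ^ m * (\<rho> * P (Suc m)) \<le> \<rho> ^ m * (1 * P m)"
        using \<rho> \<rho>1 P_dec Ppos by (intro mult_left_mono mult_mono) (auto simp: less_imp_le)
      then show ?thesis by (simp add: a_def mult_ac)
    qed
    have not_ge_1: "\<not> (\<forall>m. a m \<ge> 1)"
      using LIMSEQ_le_const[OF a_lim, of 1] by auto
    \<comment> \<open>Equality would force \<rho> to be 1 and all mass of \<Phi> to sit at exponent
      0; then no term drops below 1 in absolute value, against convergence.\<close>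
    have "a 1 < a 0"
    proof (rule ccontr)
      assume "\<not> a 1 < a 0"
      then have "\<rho> * P 1 = 1" using a_dec[of 0] P0 by (simp add: a_def)
      moreover have "P 1 \<le> 1" using P_dec[of 0] P0 by simp
      then have "\<rho> * P 1 \<le> P 1" "\<rho> * P 1 \<le> \<rho>"
        using \<rho> \<rho>1 Ppos[of 1] by (auto simp: mult_le_cancel_right1 mult_le_cancel_left2)
      ultimately have "\<rho> = 1" "P 1 = 1" using \<rho>1 \<open>P 1 \<le> 1\<close> by auto
      have "a m \<ge> 1" for m
      proof -
        have "lookup \<Phi> 0 = real D" using \<open>P 1 = 1\<close> Dpos by (simp add: P)
        then have "real D ^ m \<le> lookup (\<Phi> ^ m) 0" using lookup_power_0_ge[OF \<Phi>(1), of m] by simp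
        then show ?thesis using \<open>\<rho> = 1\<close> Dpos by (simp add: a_def P)
      qed
      then show False using not_ge_1 by blast
    qed
    then have A: "A > 0"
      using alternating_sum_pos[OF a_lim a_dec _ a_pos] sums_unique[OF A_sums] by (simp add: alt)
    \<comment> \<open>For \<open>c = 1\<close> all denominators are 1, so every \<open>a m\<close>
      would be a positive integer and could not tend to 0. The bound lets powers of \<open>c\<close>
      grow beyond \<open>Q\<^sup>2\<close>.\<close>
    have c2: "c \<ge> 2"
    proof (rule ccontr)
      assume "\<not> c \<ge> 2"
      then have "c = 1" using False by simp
      then have "D * nat \<bar>r2\<bar> * k = 1" using k by simp
      then have D: "D = 1" and r2: "\<bar>r2\<bar> = 1" by auto
      have "\<rho> = of_int \<bar>r1\<bar>" using r2 assms(6) by (auto simp: \<rho>_def abs_divide simp flip: of_int_abs)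
      then have "\<rho> \<ge> 1" using \<rho>(2) by auto
      have "a m \<ge> 1" for m
      proof -
        have "P m \<in> \<int>"
          using integral_gr_power[OF \<Phi>(2), of m] by (simp add: P D integral_gr_def)
        then have "P m \<ge> 1" using Ppos[of m] by (auto elim!: Ints_cases)
        then show ?thesis
          using \<open>\<rho> \<ge> 1\<close> mult_mono[of 1 "\<rho> ^ m" 1 "P m"] by (simp add: a_def one_le_power)
      qed
      then show False using not_ge_1 by blast
    qed
    have e\<rho>: "e / real c ^ N = \<rho> / real D" using e(1) by (simp only: \<rho>_def)
    have "r ^ m * P m = (- (e / real c ^ N)) ^ m * lookup (\<Phi> ^ m) 0" for m
    proof -
      have "- (e / real c ^ N) = r / real D" unfolding e\<rho> \<rho>(1) by simp
      then show ?thesis by (simp add: P power_divide)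
    qed
    then have "(\<lambda>m. (- (e / real c ^ N)) ^ m * lookup (\<Phi> ^ m) 0) sums A" using A_sums by simp
    moreover have "e > 0"
    proof -
      have "e / real c ^ N > 0" unfolding e\<rho> using \<rho>(2) Dpos by simp
      then show ?thesis using c2 by (simp add: zero_less_divide_iff)
    qed
    moreover have "e * mass \<Phi> \<le> real c ^ N"
    proof -
      have "e * real D = \<rho> * real c ^ N"
        using e\<rho> Dpos c2 by (simp add: field_simps)
      also have "\<dots> \<le> 1 * real c ^ N" using \<rho>1 by (intro mult_right_mono) auto
      finally show ?thesis by (simp add: mass)
    qed
    moreover have "lookup \<Phi> 0 > 0" using Ppos[of 1] Dpos by (simp add: P zero_less_divide_iff)
    moreover have "coeff x i = 0" if "x \<in> keys \<Phi>" "i \<ge> length (concat bs)" for x i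
      using block_product_degs_in[of 0 bs] that by (auto simp: \<Phi>_def degs_in_def)
    ultimately obtain f where "f \<in> tile_counting_functions" "(\<lambda>n. real (f n) / real c ^ n) \<longlonglongrightarrow> A"
      using realize_negative_ratio[OF \<Phi> c2 _ e(2) _ _ _ _ A, of N "length (concat bs)"] by blast
    then show ?thesis using asymp_equiv_of_limit A by blast
  qed
qed

end
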